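(* As $n\to\infty$, $$g_{\mathrm{PCB}}(n,K_3)=(1+o(1))\,3n.$$
   Context: Planar Constructor-Blocker game: Constructor and Blocker alternately claim previously unclaimed edges of $K_n$, Constructor moving first. Constructor may only claim an edge if her graph (the edges she has claimed) remains planar (no fixed embedding is required; at every moment her graph must admit some crossing-free plane embedding); Blocker may claim any unclaimed edge. The game ends when Constructor cannot claim any more edges or all edges are claimed. The score is the number of triangles in Constructor's graph at the end; Constructor maximizes it, Blocker minimizes it. $g_{\mathrm{PCB}}(n,K_3)$ denotes the score under optimal play. *)

theory Defs
  imports "HOL-Analysis.Analysis" "HOL-Library.Landau_Symbols"
begin

definition Kn_edges :: "nat \<Rightarrow> nat set set" where
  "Kn_edges n = {{u, v} | u v. u < n \<and> v < n \<and> u \<noteq> v}"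

definition planar_graph :: "'a set \<Rightarrow> 'a set set \<Rightarrow> bool" where
  "planar_graph V E \<longleftrightarrow>
     (\<exists>(p :: 'a \<Rightarrow> complex) (\<gamma> :: 'a set \<Rightarrow> real \<Rightarrow> complex).
        inj_on p V \<and>
        (\<forall>e\<in>E. \<exists>u v. u \<in> V \<and> v \<in> V \<and> u \<noteq> v \<and> e = {u, v} \<and>
              arc (\<gamma> e) \<and> pathstart (\<gamma> e) = p u \<and> pathfinish (\<gamma> e) = p v \<and>
              (\<forall>w\<in>V. p w \<in> path_image (\<gamma> e) \<longrightarrow> w = u \<or> w = v)) \<and>
        (\<forall>e\<in>E. \<forall>e'\<in>E. e \<noteq> e' \<longrightarrow>
              path_image (\<gamma> e) \<inter> path_image (\<gamma> e') \<subseteq> p ` (e \<inter> e')))"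

definition triangles :: "nat set set \<Rightarrow> nat" where
  "triangles C = card {T :: nat set. card T = 3 \<and> (\<forall>x\<in>T. \<forall>y\<in>T. x \<noteq> y \<longrightarrow> {x, y} \<in> C)}"

definition constr_moves :: "nat \<Rightarrow> nat set set \<Rightarrow> nat set set \<Rightarrow> nat set set" where
  "constr_moves n C B = {e \<in> Kn_edges n - C - B. planar_graph {0..<n} (insert e C)}"

text \<open>Value of the game under optimal play, with fuel k (an upper bound on the number of
  remaining moves); the Boolean says whether Constructor is to move. The game ends when
  Constructor cannot claim an edge or all edges are claimed.\<close>
fun pcb_val :: "nat \<Rightarrow> nat \<Rightarrow> bool \<Rightarrow> nat set set \<Rightarrow> nat set set \<Rightarrow> nat" where
  "pcb_val n 0 t C B = triangles C"
| "pcb_val n (Suc k) True C B =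
     (if constr_moves n C B = {} then triangles C
      else Max ((\<lambda>e. pcb_val n k False (insert e C) B) ` constr_moves n C B))"
| "pcb_val n (Suc k) False C B =
     (if constr_moves n C B = {} \<or> Kn_edges n - C - B = {} then triangles C
      else Min ((\<lambda>e. pcb_val n k True C (insert e B)) ` (Kn_edges n - C - B)))"

definition g_PCB_K3 :: "nat \<Rightarrow> nat" where
  "g_PCB_K3 n = pcb_val n (card (Kn_edges n)) True {} {}"

end

theory Submission
  imports Defs "HOL-Library.Ramsey" "HOL-Real_Asymp.Real_Asymp"
begin

text \<open>Upper bound: drawings in which vertices are disjoint path-connected compact sets survive the
  contraction of an edge. The complete graph on five vertices has no such drawing: paths through the
  three other vertices join two of the blobs to a theta graph, and a point on the direct connection
  between these blobs could reach all three paths, which no point of the plane can. Hence Mader's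
  contraction argument bounds the edges of a planar graph, and of the link of each vertex, and summing
  over the links bounds the triangles by \<open>3 * n\<close>.

  Lower bound: Constructor draws her graph inside a stacked (Apollonian) triangulation, which has a
  straight-line drawing. She first builds about \<open>sqrt n\<close> gadgets, each a hub joined to a path, in
  constantly many moves per gadget, and then inserts almost all other vertices one at a time into a
  face of a gadget. By pigeonhole some outside vertex has no blocked edge to some gadget, and
  Blocker's two replies leave a face that she can still complete: three moves, three triangles.\<close>

section \<open>Arcs and theta graphs in the plane\<close>

text \<open>Allowing a single point as an arc saves case distinctions when a path starts on its target.\<close>

definition arcset :: "complex set \<Rightarrow> complex \<Rightarrow> complex \<Rightarrow> bool" where
  "arcset S p q \<longleftrightarrow> (p = q \<and> S = {p}) \<or>
     (\<exists>g. arc g \<and> pathstart g = p \<and> pathfinish g = q \<and> path_image g = S)"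

lemma arcset_refl: "arcset {p} p p"
  by (simp add: arcset_def)

lemma arcset_ends: "arcset S p q \<Longrightarrow> p \<in> S \<and> q \<in> S"
  by (auto simp: arcset_def)

lemma arcset_sym: "arcset S p q \<Longrightarrow> arcset S q p"
  unfolding arcset_def
  by (metis arc_reversepath path_image_reversepath pathfinish_reversepath pathstart_reversepath)

lemma arcset_arcE:
  assumes "arcset S p q" "p \<noteq> q"
  obtains g where "arc g" "pathstart g = p" "pathfinish g = q" "path_image g = S"
  using assms by (auto simp: arcset_def)

lemma arcset_imp_compact: "arcset S p q \<Longrightarrow> compact S"
  by (auto simp: arcset_def compact_arc_image)

lemma arcset_imp_closed: "arcset S p q \<Longrightarrow> closed S"
  by (simp add: arcset_imp_compact compact_imp_closed)

lemma arcset_imp_connected: "arcset S p q \<Longrightarrow> connected S"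
  by (auto simp: arcset_def connected_arc_image)

lemma arcset_same_ends: "arcset S p p \<Longrightarrow> S = {p}"
  by (auto simp: arcset_def arc_distinct_ends)

lemma arcset_subpath:
  assumes "arc g" "0 \<le> s" "s \<le> t" "t \<le> 1"
  shows "arcset (g ` {s..t}) (g s) (g t)"
proof (cases "s = t")
  case False
  then have "arc (subpath s t g)" using assms by (auto intro!: arc_subpath_arc)
  moreover have "path_image (subpath s t g) = g ` {s..t}"
    using assms by (simp add: path_image_subpath)
  ultimately show ?thesis
    unfolding arcset_def by (metis pathstart_subpath pathfinish_subpath)
qed (simp add: arcset_refl)

lemma arcset_join:
  assumes "arcset S p q" "arcset T q r" "S \<inter> T = {q}"
  shows "arcset (S \<union> T) p r"
proof -
  consider "S = {p}" "p = q" | "T = {q}" "q = r" | "p \<noteq> q" "q \<noteq> r"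
    using assms arcset_same_ends by metis
  then show ?thesis
  proof cases
    case 1
    then show ?thesis using assms arcset_ends[OF assms(2)] by (simp add: insert_absorb)
  next
    case 2
    then show ?thesis using assms arcset_ends[OF assms(1)] by (simp add: insert_absorb)
  next
    case 3
    obtain g where g: "arc g" "pathstart g = p" "pathfinish g = q" "path_image g = S"
      using assms(1) 3(1) by (rule arcset_arcE)
    obtain h where h: "arc h" "pathstart h = q" "pathfinish h = r" "path_image h = T"
      using assms(2) 3(2) by (rule arcset_arcE)
    have "arc (g +++ h)" using g h assms(3) by (simp add: arc_join)
    moreover have "path_image (g +++ h) = S \<union> T" using g h by (simp add: path_image_join)
    ultimately show ?thesis
      using g h unfolding arcset_def by (metis pathfinish_join pathstart_join)
  qed
qed

lemma arcset_extend_ends: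
  assumes L: "arcset L u l" "L \<subseteq> S" and Q: "arcset Q l r" "Q \<inter> S = {l}" "Q \<inter> T = {r}"
    and R: "arcset R v r" "R \<subseteq> T" and ST: "S \<inter> T = {}"
  shows "arcset (L \<union> Q \<union> R) u v" "(L \<union> Q \<union> R) \<inter> S = L" "(L \<union> Q \<union> R) \<inter> T = R"
proof -
  note ends = arcset_ends[OF L(1)] arcset_ends[OF Q(1)] arcset_ends[OF R(1)]
  have "L \<inter> Q = {l}" "(L \<union> Q) \<inter> R = {r}" using ends L(2) R(2) Q(2,3) ST by auto
  then show "arcset (L \<union> Q \<union> R) u v"
    using arcset_join[OF arcset_join[OF L(1) Q(1)] arcset_sym[OF R(1)]] by blast
  have "L \<inter> S = L" "L \<inter> T = {}" "R \<inter> S = {}" "R \<inter> T = R" using L(2) R(2) ST by auto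
  then show "(L \<union> Q \<union> R) \<inter> S = L" "(L \<union> Q \<union> R) \<inter> T = R"
    unfolding Int_Un_distrib2 Q(2,3) using ends by auto
qed

lemma arcset_split:
  assumes "arcset S p q" "z \<in> S"
  obtains S1 S2 where "arcset S1 p z" "arcset S2 z q" "S1 \<union> S2 = S" "S1 \<inter> S2 = {z}"
proof (cases "p = q")
  case True
  then have "S = {p}" "z = p" using assms arcset_same_ends by auto
  then show ?thesis using True that[of "{p}" "{p}"] by (simp add: arcset_refl)
next
  case False
  obtain g where g: "arc g" "pathstart g = p" "pathfinish g = q" "path_image g = S"
    using assms(1) False by (rule arcset_arcE)
  obtain t where t: "t \<in> {0..1}" "z = g t" using assms(2) g(4) by (auto simp: path_image_def)
  have "arcset (g ` {0..t}) p z" "arcset (g ` {t..1}) z q"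
    using arcset_subpath[OF g(1), of 0 t] arcset_subpath[OF g(1), of t 1] t g
    by (auto simp: pathstart_def pathfinish_def)
  moreover have "{0..t} \<union> {t..1} = {0..1}" "{0..t} \<inter> {t..1} = {t}" using t by auto
  moreover from this have "g ` {0..t} \<union> g ` {t..1} = S"
    using g(4) by (metis image_Un path_image_def)
  moreover have "g ` {0..t} \<inter> g ` {t..1} = g ` ({0..t} \<inter> {t..1})"
    using g(1) t by (intro inj_on_image_Int[symmetric, of g "{0..1}"]) (auto simp: arc_def)
  ultimately show ?thesis using that t(2) by simp
qed

lemma arcset_first_hit:
  assumes "arcset S p q" "closed T" "q \<in> T"
  obtains S1 z where "arcset S1 p z" "S1 \<subseteq> S" "S1 \<inter> T = {z}"
proof (cases "p = q")
  case True
  then have "S = {p}" using assms arcset_same_ends by auto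
  then show ?thesis using True that[of "{p}" p] assms by (simp add: arcset_refl)
next
  case False
  obtain g where g: "arc g" "pathstart g = p" "pathfinish g = q" "path_image g = S"
    using assms(1) False by (rule arcset_arcE)
  define K where "K = {0..1} \<inter> g -` T"
  have "continuous_on {0..1} g" using g(1) by (simp add: arc_def path_def)
  then have "compact K"
    unfolding K_def compact_eq_bounded_closed using assms(2)
    by (auto intro: continuous_closed_preimage bounded_subset[of "{0..1}"])
  moreover have "1 \<in> K" unfolding K_def using assms(3) g by (auto simp: pathfinish_def)
  ultimately obtain t where t: "t \<in> K" "\<And>s. s \<in> K \<Longrightarrow> t \<le> s"
    using compact_attains_inf[of K] by blast
  have t01: "0 \<le> t" "t \<le> 1" "g t \<in> T" using t(1) by (auto simp: K_def)
  have "arcset (g ` {0..t}) p (g t)"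
    using arcset_subpath[OF g(1), of 0 t] t01 g by (auto simp: pathstart_def)
  moreover have "g ` {0..t} \<subseteq> S" using g(4) t01 by (auto simp: path_image_def)
  moreover have "g ` {0..t} \<inter> T = {g t}" using t(2) t01 by (force simp: K_def)
  ultimately show ?thesis using that by blast
qed

lemma path_connected_arcset:
  assumes "path_connected S" "p \<in> S" "q \<in> S"
  obtains T where "arcset T p q" "T \<subseteq> S"
proof (cases "p = q")
  case True
  then show ?thesis using that[of "{p}"] assms by (simp add: arcset_refl)
next
  case False
  then obtain g where "arc g" "path_image g \<subseteq> S" "pathstart g = p" "pathfinish g = q"
    using assms unfolding path_connected_arcwise by blast
  then show ?thesis using that[of "path_image g"] unfolding arcset_def by blast
qed

lemma path_connected_bridge:
  assumes S: "path_connected S" and T: "closed T" "S \<inter> T \<noteq> {}" and T': "closed T'" "S \<inter> T' \<noteq> {}"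
  obtains N s t where "arcset N s t" "N \<subseteq> S" "N \<inter> T = {s}" "N \<inter> T' = {t}"
proof -
  obtain p q where pq: "p \<in> S" "p \<in> T" "q \<in> S" "q \<in> T'" using T T' by blast
  obtain Q where Q: "arcset Q p q" "Q \<subseteq> S" using path_connected_arcset[OF S pq(1,3)] .
  obtain Q' t where Q': "arcset Q' p t" "Q' \<subseteq> Q" "Q' \<inter> T' = {t}"
    using arcset_first_hit[OF Q(1) T'(1) pq(4)] .
  obtain N s where N: "arcset N t s" "N \<subseteq> Q'" "N \<inter> T = {s}"
    using arcset_first_hit[OF arcset_sym[OF Q'(1)] T(1) pq(2)] .
  have "N \<inter> T' = {t}" using Q'(3) N(2) arcset_ends[OF N(1)] by blast
  then show ?thesis using that[OF arcset_sym[OF N(1)] _ N(3)] N(2) Q'(2) Q(2) by blast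
qed

lemma tripod:
  assumes S: "path_connected S" and p: "\<forall>x\<in>{c, d, e}. p x \<in> S" and "distinct [c, d, e]"
  obtains u L where "\<forall>x\<in>{c, d, e}. arcset (L x) u (p x) \<and> L x \<subseteq> S"
    "pairwise (\<lambda>x y. L x \<inter> L y = {u}) {c, d, e}"
proof -
  obtain Q where Q: "arcset Q (p c) (p d)" "Q \<subseteq> S"
    using path_connected_arcset[OF S, of "p c" "p d"] p by auto
  have "closed Q" "S \<inter> {p e} \<noteq> {}" "S \<inter> Q \<noteq> {}"
    using p Q arcset_ends[OF Q(1)] arcset_imp_closed by auto
  then obtain R s u where R: "arcset R s u" "R \<subseteq> S" "R \<inter> {p e} = {s}" "R \<inter> Q = {u}"
    using path_connected_bridge[OF S, of "{p e}" Q] by auto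
  then have s: "s = p e" and u: "u \<in> Q" by auto
  obtain Qc Qd where cd: "arcset Qc (p c) u" "arcset Qd u (p d)" "Qc \<union> Qd = Q" "Qc \<inter> Qd = {u}"
    using arcset_split[OF Q(1) u] .
  then have "R \<inter> Qc = {u}" "R \<inter> Qd = {u}"
    using R(4) arcset_ends[OF cd(1)] arcset_ends[OF cd(2)] by auto
  moreover define L where "L x = (if x = c then Qc else if x = d then Qd else R)" for x
  ultimately have L: "L c \<inter> L d = {u}" "L e \<inter> L c = {u}" "L e \<inter> L d = {u}"
    "L c = Qc" "L d = Qd" "L e = R" using cd(4) assms(3) by auto
  show ?thesis
  proof (rule that)
    show "\<forall>x\<in>{c, d, e}. arcset (L x) u (p x) \<and> L x \<subseteq> S"
      using arcset_sym[OF cd(1)] cd(2,3) arcset_sym[OF R(1)] R(2) Q(2) L(4-6) s by auto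
    show "pairwise (\<lambda>x y. L x \<inter> L y = {u}) {c, d, e}"
      using L(1-3) by (auto simp: pairwise_def Int_commute)
  qed
qed

lemma arcset_endless:
  assumes "arcset S p q" "p \<noteq> q"
  shows "connected (S - {p, q})" "S - {p, q} \<noteq> {}" "S \<subseteq> closure (S - {p, q})"
proof -
  obtain g where g: "arc g" "pathstart g = p" "pathfinish g = q" "path_image g = S"
    using assms by (rule arcset_arcE)
  have sp: "simple_path g" using g(1) arc_imp_simple_path by blast
  show "connected (S - {p, q})" using connected_simple_path_endless[OF sp] g by simp
  show "S - {p, q} \<noteq> {}" using nonempty_simple_path_endless[OF sp] g by simp
  have "continuous_on {0..1} g" using g(1) by (simp add: arc_def path_def)
  then have "g ` closure {0<..<1} \<subseteq> closure (g ` {0<..<1})"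
    using closure_subset[of "g ` {0<..<1}"] by (intro image_closure_subset) auto
  then show "S \<subseteq> closure (S - {p, q})"
    using simple_path_endless[OF sp] g by (simp add: path_image_def)
qed

lemma connected_component_closure:
  assumes "connected W" "W \<inter> J = {}" "q \<in> closure W" "q \<notin> J" "w \<in> W"
  shows "connected_component (- J) w q"
proof -
  have "connected (insert q W)"
    using connected_intermediate_closure[OF assms(1)] assms(3) closure_subset by blast
  then show ?thesis
    unfolding connected_component_def using assms by (intro exI[of _ "insert q W"]) auto
qed

lemma arcset_connected_component_end:
  assumes "arcset N s t" "n \<in> N - {s, t}" "N \<inter> J \<subseteq> {s, t}" "r \<in> {s, t}" "r \<notin> J"
  shows "connected_component (- J) n r"
proof -
  have "s \<noteq> t" using assms(1,2) arcset_same_ends by auto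
  note N = arcset_endless[OF assms(1) this]
  show ?thesis
    by (rule connected_component_closure[OF N(1)]) (use N(3) assms arcset_ends in auto)
qed

lemma connected_closed_cover_disjoint:
  assumes "connected S" "S \<subseteq> X \<union> Y" "closed X" "closed Y" "X \<inter> Y \<inter> S = {}" "X \<inter> S \<noteq> {}"
  shows "S \<inter> Y = {}"
  using assms unfolding connected_closed by blast

definition reaches :: "complex set \<Rightarrow> complex \<Rightarrow> complex set \<Rightarrow> bool" where
  "reaches J w S \<longleftrightarrow> (\<exists>s\<in>S. connected_component (- J) w s)"

lemma Jordan_two_sides:
  assumes "arcset P u v" "arcset Q u v" "u \<noteq> v" "P \<inter> Q = {u, v}"
  obtains I O' where "open I" "connected I" "frontier I = P \<union> Q"
    "open O'" "connected O'" "frontier O' = P \<union> Q" "I \<inter> O' = {}" "I \<union> O' = - (P \<union> Q)"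
proof -
  obtain g where g: "arc g" "pathstart g = u" "pathfinish g = v" "path_image g = P"
    using assms(1,3) by (rule arcset_arcE)
  obtain h where h: "arc h" "pathstart h = v" "pathfinish h = u" "path_image h = Q"
    using arcset_sym[OF assms(2)] assms(3) by (metis arcset_arcE)
  have "simple_path (g +++ h)" using g h assms by (intro simple_path_join_loop) auto
  moreover have "pathfinish (g +++ h) = pathstart (g +++ h)" using g h by simp
  moreover have "path_image (g +++ h) = P \<union> Q" using g h by (simp add: path_image_join)
  ultimately show ?thesis using that Jordan_inside_outside[of "g +++ h"] by metis
qed

lemma Jordan_same_side:
  assumes "arcset P u v" "arcset Q u v" "u \<noteq> v" "P \<inter> Q = {u, v}"
    and "x \<notin> P \<union> Q" "y \<notin> P \<union> Q" "z \<notin> P \<union> Q"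
    and "\<not> connected_component (- (P \<union> Q)) x z" "\<not> connected_component (- (P \<union> Q)) y z"
  shows "connected_component (- (P \<union> Q)) x y"
proof -
  obtain I O' where IO: "connected I" "connected O'" "I \<union> O' = - (P \<union> Q)"
    using Jordan_two_sides[OF assms(1-4)] by metis
  have "connected_component (- (P \<union> Q)) s t"
    if "s \<in> I \<and> t \<in> I \<or> s \<in> O' \<and> t \<in> O'" for s t
    using that IO unfolding connected_component_def by blast
  then show ?thesis using assms(5-9) IO(3) by (metis ComplI UnE)
qed

definition theta_graph :: "complex \<Rightarrow> complex \<Rightarrow> complex set \<Rightarrow> complex set \<Rightarrow> complex set \<Rightarrow> bool" where
  "theta_graph u v P Q R \<longleftrightarrow> u \<noteq> v \<and> arcset P u v \<and> arcset Q u v \<and> arcset R u v \<and>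
     P \<inter> Q = {u, v} \<and> P \<inter> R = {u, v} \<and> Q \<inter> R = {u, v}"

lemma theta_graph_missed_region:
  assumes "theta_graph u v P Q R"
  obtains D where "connected D" "D \<noteq> {}" "D \<inter> (P \<union> Q \<union> R) = {}" "Q \<union> R \<subseteq> closure D"
    "\<forall>y\<in>D. \<not> reaches (Q \<union> R) y P"
proof -
  have th: "u \<noteq> v" "arcset P u v" "arcset Q u v" "arcset R u v" "P \<inter> Q = {u, v}" "P \<inter> R = {u, v}"
    "Q \<inter> R = {u, v}" using assms by (auto simp: theta_graph_def)
  obtain I O' where IO: "open I" "connected I" "frontier I = Q \<union> R"
    "open O'" "connected O'" "frontier O' = Q \<union> R" "I \<inter> O' = {}" "I \<union> O' = - (Q \<union> R)"
    using Jordan_two_sides[OF th(3,4,1,7)] .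
  have P: "connected (P - {u, v})" "P - {u, v} \<subseteq> I \<union> O'"
    using arcset_endless(1)[OF th(2,1)] th(5-7) IO(8) by auto
  then have "P - {u, v} \<subseteq> I \<or> P - {u, v} \<subseteq> O'"
    using connectedD[OF P(1) IO(1,4)] IO(7) by blast
  then obtain D D' where D: "open D" "connected D" "frontier D = Q \<union> R"
    and D': "open D'" "P - {u, v} \<subseteq> D'" and DD': "D \<inter> D' = {}" "D \<union> D' = - (Q \<union> R)"
    using IO by (metis Int_commute Un_commute)
  show ?thesis
  proof (rule that)
    show "connected D" "Q \<union> R \<subseteq> closure D" using D by (auto simp: frontier_def)
    then show "D \<noteq> {}" using th(7) by auto
    show "D \<inter> (P \<union> Q \<union> R) = {}" using D' DD' th(5) by blast
    show "\<forall>y\<in>D. \<not> reaches (Q \<union> R) y P"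
    proof (intro ballI notI)
      fix y assume y: "y \<in> D" and "reaches (Q \<union> R) y P"
      then obtain p T where T: "p \<in> P" "connected T" "T \<subseteq> D \<union> D'" "y \<in> T" "p \<in> T"
        unfolding reaches_def connected_component_def DD'(2) by blast
      then have "p \<in> D'" using D' DD' th(5-7) by blast
      then show False using connectedD[OF T(2) D(1) D'(1)] T y DD'(1) by blast
    qed
  qed
qed

text \<open>A region that misses \<open>P\<close> touches \<open>Q\<close> and \<open>R\<close>. A point reaching all three paths would be
  connected to it off \<open>P \<union> Q\<close> and off \<open>P \<union> R\<close>, hence off the whole graph, because \<open>P\<close> is connected.\<close>

lemma theta_graph_not_reaches_all:
  assumes th: "theta_graph u v P Q R"
    and w: "reaches (P \<union> Q) w R" "reaches (P \<union> R) w Q"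
  shows "\<not> reaches (Q \<union> R) w P"
proof
  assume "reaches (Q \<union> R) w P"
  then obtain p where p: "p \<in> P" "connected_component (- (Q \<union> R)) w p" by (auto simp: reaches_def)
  have PQR: "arcset P u v" "arcset Q u v" "arcset R u v" "(P \<union> Q) \<inter> (P \<union> R) = P"
    using th by (auto simp: theta_graph_def)
  obtain D where D: "connected D" "D \<noteq> {}" "D \<inter> (P \<union> Q \<union> R) = {}" "Q \<union> R \<subseteq> closure D"
    "\<forall>y\<in>D. \<not> reaches (Q \<union> R) y P" using theta_graph_missed_region[OF th] .
  obtain y where y: "y \<in> D" using D(2) by blast
  have joined: "connected_component (- J) w y"
    if "reaches J w S" "S \<subseteq> Q \<union> R" "J \<subseteq> P \<union> Q \<union> R" for J S
  proof -
    obtain s where s: "s \<in> S" "connected_component (- J) w s" using \<open>reaches J w S\<close>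
      by (auto simp: reaches_def)
    then have "s \<notin> J" using connected_component_in by blast
    then have "connected_component (- J) y s"
      using connected_component_closure[OF D(1) _ _ _ y] s(1) that D(3,4) by blast
    then show ?thesis using s(2) by (metis connected_component_sym connected_component_trans)
  qed
  have "connected_component (- ((P \<union> Q) \<union> (P \<union> R))) w y"
  proof (rule Janiszewski)
    show "compact (P \<union> Q)" "closed (P \<union> R)" "connected ((P \<union> Q) \<inter> (P \<union> R))"
      unfolding PQR(4) using PQR arcset_imp_compact arcset_imp_closed arcset_imp_connected by blast+
    show "connected_component (- (P \<union> Q)) w y" "connected_component (- (P \<union> R)) w y"
      using joined w by blast+
  qed
  then have "connected_component (- (Q \<union> R)) w y"
    by (rule connected_component_of_subset) auto
  then have "connected_component (- (Q \<union> R)) y p"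
    using p(2) by (metis connected_component_sym connected_component_trans)
  then show False using D(5) y p(1) by (auto simp: reaches_def)
qed

lemma crossing_chords_separated:
  assumes th: "theta_graph c d A B K" and N: "arcset N s t" "N \<inter> (A \<union> B \<union> K) = {s, t}"
    and st: "s \<in> A - {c, d}" "t \<in> B - {c, d}" and n: "n \<in> N - {s, t}"
  shows "\<not> reaches (A \<union> B) n K"
proof
  assume K: "reaches (A \<union> B) n K"
  have "s \<notin> B \<union> K" "t \<notin> A \<union> K" using th st by (auto simp: theta_graph_def)
  then have "connected_component (- (B \<union> K)) n s" "connected_component (- (A \<union> K)) n t"
    using N(2) by (intro arcset_connected_component_end[OF N(1) n]; blast)+
  then show False
    using theta_graph_not_reaches_all[OF th K] st by (auto simp: reaches_def)
qed

text \<open>Two chords of the cycle \<open>A \<union> B\<close> that cross the chord \<open>K\<close> both lie on the side without \<open>K\<close>.\<close>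

lemma chords_crossing_same_chord_connected:
  assumes th: "theta_graph c d A B K"
    and N: "arcset N s t" "N \<inter> (A \<union> B \<union> K) = {s, t}" "s \<in> A - {c, d}" "t \<in> B - {c, d}"
      "n \<in> N - {s, t}"
    and N': "arcset N' s' t'" "N' \<inter> (A \<union> B \<union> K) = {s', t'}" "s' \<in> A - {c, d}" "t' \<in> B - {c, d}"
      "n' \<in> N' - {s', t'}"
  shows "connected_component (- (A \<union> B)) n n'"
proof -
  have AB: "c \<noteq> d" "arcset A c d" "arcset B c d" "arcset K c d" "A \<inter> B = {c, d}"
    "A \<inter> K = {c, d}" "B \<inter> K = {c, d}"
    using th by (auto simp: theta_graph_def)
  obtain k where k: "k \<in> K - {c, d}" using arcset_endless(2)[OF AB(4,1)] by blast
  show ?thesis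
  proof (rule Jordan_same_side[OF AB(2,3,1,5), where z = k])
    show "n \<notin> A \<union> B" "n' \<notin> A \<union> B" "k \<notin> A \<union> B" using N(2,5) N'(2,5) k AB(6,7) by auto
    show "\<not> connected_component (- (A \<union> B)) n k" "\<not> connected_component (- (A \<union> B)) n' k"
      using crossing_chords_separated[OF th N] crossing_chords_separated[OF th N'] k
      by (auto simp: reaches_def)
  qed
qed

lemma theta_graph_resplit:
  assumes "theta_graph u v P Q R" "c \<in> P - {u, v}" "d \<in> Q - {u, v}"
  obtains A B where "arcset A c d" "arcset B c d" "A \<union> B = P \<union> Q" "A \<inter> B = {c, d}" "u \<in> A" "v \<in> B"
proof -
  have th: "u \<noteq> v" "arcset P u v" "arcset Q u v" "P \<inter> Q = {u, v}"
    using assms(1) by (auto simp: theta_graph_def)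
  obtain P1 P2 where P: "arcset P1 u c" "arcset P2 c v" "P1 \<union> P2 = P" "P1 \<inter> P2 = {c}"
    using arcset_split[OF th(2)] assms(2) by blast
  obtain Q1 Q2 where Q: "arcset Q1 u d" "arcset Q2 d v" "Q1 \<union> Q2 = Q" "Q1 \<inter> Q2 = {d}"
    using arcset_split[OF th(3)] assms(3) by blast
  note ends = arcset_ends[OF P(1)] arcset_ends[OF P(2)] arcset_ends[OF Q(1)] arcset_ends[OF Q(2)]
  have "P1 \<inter> P2 \<inter> {u, v} = {}" "Q1 \<inter> Q2 \<inter> {u, v} = {}"
    unfolding P(4) Q(4) using assms(2,3) by auto
  then have "v \<notin> P1" "u \<notin> P2" "v \<notin> Q1" "u \<notin> Q2" using ends by auto
  moreover have "P1 \<inter> Q1 \<subseteq> {u, v}" "P2 \<inter> Q2 \<subseteq> {u, v}" "P1 \<inter> Q2 \<subseteq> {u, v}" "P2 \<inter> Q1 \<subseteq> {u, v}"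
    using P(3) Q(3) th(4) by auto
  ultimately have I: "P1 \<inter> Q1 = {u}" "P2 \<inter> Q2 = {v}" "P1 \<inter> Q2 = {}" "P2 \<inter> Q1 = {}"
    using ends by auto
  show ?thesis
  proof (rule that[of "P1 \<union> Q1" "P2 \<union> Q2"])
    show "arcset (P1 \<union> Q1) c d" using arcset_join[OF arcset_sym[OF P(1)] Q(1) I(1)] .
    show "arcset (P2 \<union> Q2) c d" using arcset_join[OF P(2) arcset_sym[OF Q(2)] I(2)] .
    show "(P1 \<union> Q1) \<union> (P2 \<union> Q2) = P \<union> Q" using P(3) Q(3) by auto
    show "(P1 \<union> Q1) \<inter> (P2 \<union> Q2) = {c, d}" using P(4) Q(4) I(3,4) by auto
  qed (use ends in auto)
qed

lemma connected_misses_far_arc: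
  assumes arcs: "closed A" "closed B" "closed R" "A \<inter> B = {c, d}" "R \<inter> (A \<union> B) = {u, v}"
    "u \<in> A - {c, d}"
    and L: "connected L" "L \<subseteq> A \<union> B \<union> R" "c \<notin> L" "d \<notin> L" "u \<in> L" "v \<notin> L"
  shows "L \<inter> B = {}"
proof (rule connected_closed_cover_disjoint[OF L(1), of "A \<union> R"])
  have "(A \<union> R) \<inter> B \<subseteq> {c, d, v}" using arcs(4-6) by auto
  then show "(A \<union> R) \<inter> B \<inter> L = {}" using L(3,4,6) by blast
qed (use arcs L in auto)

lemma theta_graph_crossed_chord_reaches:
  assumes th: "theta_graph u v P Q R"
    and K: "arcset K c d" "K \<inter> (P \<union> Q \<union> R) = {c, d}" "c \<in> P" "d \<in> Q" "u \<notin> K" "v \<notin> K"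
    and N: "arcset N s t" "N \<inter> (P \<union> Q \<union> R) = {s, t}" "N \<inter> K = {}" "n \<in> N - {s, t}"
    and L: "connected L" "L \<subseteq> P \<union> Q \<union> R" "L \<inter> K = {}" "u \<in> L" "s \<in> L" "v \<notin> L"
    and L': "connected L'" "L' \<subseteq> P \<union> Q \<union> R" "L' \<inter> K = {}" "v \<in> L'" "t \<in> L'" "u \<notin> L'"
  shows "reaches (P \<union> Q) n R"
proof (cases "s \<in> P \<union> Q \<and> t \<in> P \<union> Q")
  case False
  then obtain r where "r \<in> {s, t}" "r \<notin> P \<union> Q" by blast
  moreover from this have "r \<in> R" using N(2) by blast
  ultimately show ?thesis
    using arcset_connected_component_end[OF N(1,4)] N(2) unfolding reaches_def by blast
next
  case True
  have PQR: "arcset R u v" "u \<noteq> v" "P \<inter> R = {u, v}" "Q \<inter> R = {u, v}" "P \<inter> Q = {u, v}"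
    using th by (auto simp: theta_graph_def)
  have cd: "c \<in> K" "d \<in> K" "c \<in> P - {u, v}" "d \<in> Q - {u, v}"
    using K arcset_ends[OF K(1)] by auto
  obtain A B where AB: "arcset A c d" "arcset B c d" "A \<union> B = P \<union> Q" "A \<inter> B = {c, d}" "u \<in> A"
    "v \<in> B"
    using theta_graph_resplit[OF th cd(3,4)] .
  have RAB: "R \<inter> (A \<union> B) = {u, v}" unfolding AB(3) using PQR(3,4) by auto
  have KN: "K \<inter> (A \<union> B \<union> R) = {c, d}" "N \<inter> (A \<union> B \<union> R) = {s, t}"
    unfolding AB(3) by (rule K(2), rule N(2))
  have closed: "closed A" "closed B" "closed R" using AB(1,2) PQR(1) arcset_imp_closed by auto
  have ends: "c \<notin> L" "d \<notin> L" "c \<notin> L'" "d \<notin> L'" using L(3) L'(3) cd(1,2) by auto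
  have "L \<inter> B = {}"
    by (rule connected_misses_far_arc[OF closed AB(4) RAB _ L(1)])
      (use L ends AB(3,5) cd(3,4) in auto)
  then have s: "s \<in> A - {c, d}" using L(5) ends True AB(3) by auto
  have "L' \<inter> A = {}"
    by (rule connected_misses_far_arc[of B A R c d v u])
      (use closed L' ends AB(3,4,6) RAB cd(3,4) in auto)
  then have t: "t \<in> B - {c, d}" using L'(5) ends True AB(3) by auto
  have thK: "theta_graph c d A B K"
    unfolding theta_graph_def using AB(1,2,4) K(1) KN(1) cd(3,4) PQR(5) by auto
  obtain r where r: "r \<in> R - {u, v}" using arcset_endless(2)[OF PQR(1,2)] by blast
  have "connected_component (- (A \<union> B)) n r"
  proof (rule chords_crossing_same_chord_connected[OF thK N(1) _ s t N(4) PQR(1) _ _ _ r])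
    show "N \<inter> (A \<union> B \<union> K) = {s, t}" using KN(2) N(3) s t by auto
    show "R \<inter> (A \<union> B \<union> K) = {u, v}" using RAB KN(1) K(5,6) cd(3,4) PQR(3,4) by auto
  qed (use AB(5,6) cd(3,4) in auto)
  then show ?thesis using r AB(3) unfolding reaches_def by auto
qed

section \<open>Drawings with blobs for vertices\<close>

definition graph :: "'a set \<Rightarrow> 'a set set \<Rightarrow> bool" where
  "graph V E \<longleftrightarrow> finite V \<and> E \<subseteq> [V]\<^bsup>2\<^esup>"

lemma graph_edge: "graph V E \<Longrightarrow> {x, y} \<in> E \<Longrightarrow> x \<in> V \<and> y \<in> V \<and> x \<noteq> y"
  unfolding graph_def by (metis doubleton_in_nsets_2 subsetD)

definition blob_drawing ::
  "'a set \<Rightarrow> 'a set set \<Rightarrow> ('a \<Rightarrow> complex set) \<Rightarrow> ('a set \<Rightarrow> complex set) \<Rightarrow> bool" where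
  "blob_drawing V E A G \<longleftrightarrow>
     (\<forall>v\<in>V. compact (A v) \<and> path_connected (A v)) \<and>
     (\<forall>u\<in>V. \<forall>v\<in>V. u \<noteq> v \<longrightarrow> A u \<inter> A v = {}) \<and>
     (\<forall>e\<in>E. compact (G e) \<and> path_connected (G e) \<and> (\<forall>v\<in>V. G e \<inter> A v \<noteq> {} \<longleftrightarrow> v \<in> e)) \<and>
     (\<forall>e\<in>E. \<forall>e'\<in>E. e \<noteq> e' \<longrightarrow> G e \<inter> G e' \<subseteq> \<Union> (A ` (e \<inter> e')))"

definition blob_planar :: "'a set \<Rightarrow> 'a set set \<Rightarrow> bool" where
  "blob_planar V E \<longleftrightarrow> graph V E \<and> (\<exists>A G. blob_drawing V E A G)"

lemma blob_drawing_vertex: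
  assumes "blob_drawing V E A G" "v \<in> V"
  shows "compact (A v)" "path_connected (A v)" "u \<in> V \<Longrightarrow> u \<noteq> v \<Longrightarrow> A u \<inter> A v = {}"
  using assms unfolding blob_drawing_def by auto

lemma blob_drawing_edge:
  assumes "blob_drawing V E A G" "e \<in> E"
  shows "compact (G e)" "path_connected (G e)" "v \<in> V \<Longrightarrow> G e \<inter> A v \<noteq> {} \<longleftrightarrow> v \<in> e"
    "e' \<in> E \<Longrightarrow> e \<noteq> e' \<Longrightarrow> G e \<inter> G e' \<subseteq> \<Union> (A ` (e \<inter> e'))"
  using assms unfolding blob_drawing_def by simp_all

lemma planar_graph_imp_blob_planar:
  assumes "planar_graph V E" "finite V"
  shows "blob_planar V E"
proof -
  obtain p :: "'a \<Rightarrow> complex" and \<gamma> where p: "inj_on p V" and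
    \<gamma>: "\<forall>e\<in>E. \<exists>u v. u \<in> V \<and> v \<in> V \<and> u \<noteq> v \<and> e = {u, v} \<and>
          arc (\<gamma> e) \<and> pathstart (\<gamma> e) = p u \<and> pathfinish (\<gamma> e) = p v \<and>
          (\<forall>w\<in>V. p w \<in> path_image (\<gamma> e) \<longrightarrow> w = u \<or> w = v)" and
    cross: "\<forall>e\<in>E. \<forall>e'\<in>E. e \<noteq> e' \<longrightarrow> path_image (\<gamma> e) \<inter> path_image (\<gamma> e') \<subseteq> p ` (e \<inter> e')"
    using assms(1) unfolding planar_graph_def by blast
  have edge: "e \<in> [V]\<^bsup>2\<^esup> \<and> arc (\<gamma> e) \<and> (\<forall>v\<in>V. p v \<in> path_image (\<gamma> e) \<longleftrightarrow> v \<in> e)" if e: "e \<in> E" for e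
  proof -
    obtain u v where "u \<in> V" "v \<in> V" "u \<noteq> v" "e = {u, v}" "arc (\<gamma> e)" "pathstart (\<gamma> e) = p u"
      "pathfinish (\<gamma> e) = p v" "\<forall>w\<in>V. p w \<in> path_image (\<gamma> e) \<longrightarrow> w = u \<or> w = v"
      using bspec[OF \<gamma> e] by (elim exE conjE)
    moreover from this have "p u \<in> path_image (\<gamma> e)" "p v \<in> path_image (\<gamma> e)"
      by (metis pathstart_in_path_image, metis pathfinish_in_path_image)
    ultimately show ?thesis by auto
  qed
  have "blob_drawing V E (\<lambda>v. {p v}) (\<lambda>e. path_image (\<gamma> e))"
    unfolding blob_drawing_def UNION_singleton_eq_range
    using edge cross
    by (simp add: inj_on_eq_iff[OF p] compact_arc_image arc_imp_path path_connected_path_image)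
  then show ?thesis unfolding blob_planar_def graph_def using edge assms(2) by blast
qed

lemma blob_planar_subgraph:
  assumes "blob_planar V E" "V' \<subseteq> V" "E' \<subseteq> E" "E' \<subseteq> [V']\<^bsup>2\<^esup>"
  shows "blob_planar V' E'"
proof -
  obtain A G where "blob_drawing V E A G" using assms(1) unfolding blob_planar_def by blast
  then have "blob_drawing V' E' A G" using assms(2,3) unfolding blob_drawing_def by (meson subsetD)
  then show ?thesis
    using assms unfolding blob_planar_def graph_def by (meson finite_subset)
qed

definition contract :: "'a \<Rightarrow> 'a \<Rightarrow> 'a set set \<Rightarrow> 'a set set" where
  "contract u v E = {e \<in> E. v \<notin> e} \<union> {{u, x} | x. {v, x} \<in> E \<and> x \<noteq> u}"

lemma graph_contract:
  assumes "graph V E" "{u, v} \<in> E"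
  shows "graph (V - {v}) (contract u v E)"
  using assms by (auto simp: graph_def contract_def nsets_def card_insert_if subset_iff
    split: if_splits)

lemma contract_origin:
  assumes "graph V E" "{u, v} \<in> E" "e \<in> contract u v E"
  obtains f where "f \<in> E" "f \<noteq> {u, v}" "(\<lambda>x. if x = v then u else x) ` f = e"
proof -
  consider "e \<in> E" "v \<notin> e" | x where "{v, x} \<in> E" "x \<noteq> u" "e = {u, x}"
    using assms(3) by (auto simp: contract_def)
  then show ?thesis
  proof cases
    case 1
    then show ?thesis using that[of e] by force
  next
    case 2
    then have "x \<noteq> v" using graph_edge[OF assms(1)] by blast
    then show ?thesis using that[of "{v, x}"] 2 by (auto simp: doubleton_eq_iff)
  qed
qed

lemma blob_drawing_merge:
  fixes u v :: 'a
  assumes D: "blob_drawing V E A G" and uv: "u \<in> V" "v \<in> V" "{u, v} \<in> E" and x: "x \<in> V - {v}"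
  defines "A' \<equiv> A(u := A u \<union> G {u, v} \<union> A v)"
  shows "compact (A' x) \<and> path_connected (A' x)" "y \<in> V - {v} \<Longrightarrow> x \<noteq> y \<Longrightarrow> A' x \<inter> A' y = {}"
proof -
  note vertex = blob_drawing_vertex[OF D] and edge = blob_drawing_edge[OF D uv(3)]
  have "path_connected (A' u)"
    unfolding A'_def fun_upd_same
    using edge(2) edge(3) vertex(2) uv by (intro path_connected_Un) auto
  then show "compact (A' x) \<and> path_connected (A' x)"
    using vertex(1,2) edge(1) uv x by (auto simp: A'_def)
  have "A' u \<inter> A z = {}" if "z \<in> V - {u, v}" for z
    using vertex(3)[of z u] vertex(3)[of z v] edge(3)[of z] uv that by (auto simp: A'_def)
  then show "A' x \<inter> A' y = {}" if "y \<in> V - {v}" "x \<noteq> y"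
    using vertex(3)[of y x] x that by (auto simp: A'_def)
qed

lemma blob_drawing_contract:
  fixes u v :: 'a
  defines "\<phi> \<equiv> \<lambda>x. if x = v then u else x"
  assumes D: "blob_drawing V E A G" and uv: "u \<in> V" "v \<in> V" "{u, v} \<in> E"
    and \<psi>: "\<And>e. e \<in> F \<Longrightarrow> \<psi> e \<in> E \<and> \<psi> e \<noteq> {u, v} \<and> \<phi> ` \<psi> e = e"
  shows "blob_drawing (V - {v}) F (A(u := A u \<union> G {u, v} \<union> A v)) (\<lambda>e. G (\<psi> e))"
proof -
  define A' where "A' = A(u := A u \<union> G {u, v} \<union> A v)"
  note edge = blob_drawing_edge[OF D] and merge = blob_drawing_merge[OF D uv, folded A'_def]
  have sub: "A x \<subseteq> A' (\<phi> x)" for x by (auto simp: A'_def \<phi>_def)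
  have "G (\<psi> e) \<inter> A' w \<noteq> {} \<longleftrightarrow> w \<in> e" if e: "e \<in> F" and w: "w \<in> V - {v}" for e w
  proof (cases "w = u")
    case True
    note p = \<psi>[OF e]
    have "u \<in> e \<longleftrightarrow> u \<in> \<psi> e \<or> v \<in> \<psi> e" using p by (force simp: \<phi>_def)
    moreover have "G (\<psi> e) \<inter> G {u, v} \<subseteq> A u \<union> A v" using edge(4)[of "\<psi> e" "{u, v}"] p uv(3) by auto
    ultimately show ?thesis
      unfolding True using edge(3)[of "\<psi> e" u] edge(3)[of "\<psi> e" v] uv p by (auto simp: A'_def)
  next
    case False
    then have "w \<in> e \<longleftrightarrow> w \<in> \<psi> e" using \<psi>[OF e] w by (force simp: \<phi>_def)
    then show ?thesis using edge(3)[of "\<psi> e" w] \<psi>[OF e] w False by (auto simp: A'_def)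
  qed
  moreover have "G (\<psi> e) \<inter> G (\<psi> e') \<subseteq> \<Union> (A' ` (e \<inter> e'))" if "e \<in> F" "e' \<in> F" "e \<noteq> e'" for e e'
  proof -
    have "\<psi> e \<noteq> \<psi> e'" using \<psi> that by metis
    then have "G (\<psi> e) \<inter> G (\<psi> e') \<subseteq> \<Union> (A ` (\<psi> e \<inter> \<psi> e'))" using edge(4) \<psi> that by blast
    moreover have "\<phi> x \<in> e \<inter> e'" if "x \<in> \<psi> e \<inter> \<psi> e'" for x
      using \<psi>[OF \<open>e \<in> F\<close>] \<psi>[OF \<open>e' \<in> F\<close>] that by blast
    ultimately show ?thesis using sub by blast
  qed
  ultimately show ?thesis
    unfolding blob_drawing_def A'_def[symmetric] using merge edge(1,2) \<psi> by simp
qed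

lemma blob_planar_contract:
  assumes "blob_planar V E" "{u, v} \<in> E"
  shows "blob_planar (V - {v}) (contract u v E)"
proof -
  have g: "graph V E" using assms by (simp add: blob_planar_def)
  obtain A G where D: "blob_drawing V E A G" using assms(1) unfolding blob_planar_def by blast
  have "\<forall>e\<in>contract u v E. \<exists>f. f \<in> E \<and> f \<noteq> {u, v} \<and> (\<lambda>x. if x = v then u else x) ` f = e"
    using contract_origin[OF g assms(2)] by metis
  then obtain \<psi> where "\<forall>e\<in>contract u v E.
      \<psi> e \<in> E \<and> \<psi> e \<noteq> {u, v} \<and> (\<lambda>x. if x = v then u else x) ` \<psi> e = e"
    by (rule bchoice[THEN exE])
  note blob_drawing_contract[OF D _ _ assms(2) bspec[OF this]]
  moreover have "u \<in> V" "v \<in> V" using graph_edge[OF g assms(2)] by auto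
  ultimately show ?thesis unfolding blob_planar_def using graph_contract[OF g assms(2)] by blast
qed

locale blob_K5 =
  fixes a b c d e :: 'a and A :: "'a \<Rightarrow> complex set" and G :: "'a set \<Rightarrow> complex set"
  assumes distinct: "distinct [a, b, c, d, e]"
    and drawing: "blob_drawing {a, b, c, d, e} ([{a, b, c, d, e}]\<^bsup>2\<^esup>) A G"
begin

definition corridor :: "'a \<Rightarrow> 'a \<Rightarrow> complex set" where
  "corridor i j = A i \<union> G {i, j} \<union> A j"

lemma blob:
  assumes "i \<in> {a, b, c, d, e}"
  shows "closed (A i)" "path_connected (A i)" "j \<in> {a, b, c, d, e} \<Longrightarrow> i \<noteq> j \<Longrightarrow> A i \<inter> A j = {}"
  using blob_drawing_vertex[OF drawing assms] compact_imp_closed by auto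

lemma link:
  assumes "i \<in> {a, b, c, d, e}" "j \<in> {a, b, c, d, e}" "i \<noteq> j"
  shows "closed (G {i, j})" "path_connected (G {i, j})"
    "k \<in> {a, b, c, d, e} \<Longrightarrow> G {i, j} \<inter> A k = {} \<longleftrightarrow> k \<noteq> i \<and> k \<noteq> j"
    "k \<in> {a, b, c, d, e} \<Longrightarrow> l \<in> {a, b, c, d, e} \<Longrightarrow> k \<noteq> l \<Longrightarrow> {i, j} \<noteq> {k, l} \<Longrightarrow>
      G {i, j} \<inter> G {k, l} \<subseteq> \<Union> (A ` ({i, j} \<inter> {k, l}))"
proof -
  have ij: "{i, j} \<in> [{a, b, c, d, e}]\<^bsup>2\<^esup>" using assms by simp
  note edge = blob_drawing_edge[OF drawing ij]
  show "closed (G {i, j})" "path_connected (G {i, j})" using edge(1,2) compact_imp_closed by auto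
  show "G {i, j} \<inter> A k = {} \<longleftrightarrow> k \<noteq> i \<and> k \<noteq> j" if "k \<in> {a, b, c, d, e}"
    using edge(3)[OF that] by auto
  show "G {i, j} \<inter> G {k, l} \<subseteq> \<Union> (A ` ({i, j} \<inter> {k, l}))"
    if "k \<in> {a, b, c, d, e}" "l \<in> {a, b, c, d, e}" "k \<noteq> l" "{i, j} \<noteq> {k, l}"
    using edge(4)[OF _ that(4)] that by simp
qed

lemma corridor_commute: "corridor i j = corridor j i"
  unfolding corridor_def by (auto simp: insert_commute)

lemma path_connected_corridor:
  assumes "i \<in> {a, b, c, d, e}" "j \<in> {a, b, c, d, e}" "i \<noteq> j"
  shows "path_connected (corridor i j)"
proof -
  have "G {i, j} \<inter> A i \<noteq> {}" "G {i, j} \<inter> A j \<noteq> {}"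
    using link(3)[OF assms assms(1)] link(3)[OF assms assms(2)] by auto
  then show ?thesis
    unfolding corridor_def by (intro path_connected_Un blob(2) link(2) assms) blast+
qed

lemma corridors_disjoint:
  assumes "i \<in> {a, b, c, d, e}" "j \<in> {a, b, c, d, e}" "k \<in> {a, b, c, d, e}" "l \<in> {a, b, c, d, e}"
    "distinct [i, j, k, l]"
  shows "corridor i j \<inter> corridor k l = {}"
proof -
  note blobs = blob(3)[OF assms(1,3)] blob(3)[OF assms(1,4)] blob(3)[OF assms(2,3)]
    blob(3)[OF assms(2,4)]
  have ne: "i \<noteq> j" "k \<noteq> l" using assms(5) by auto
  note links = link(3)[OF assms(1,2) ne(1) assms(3)] link(3)[OF assms(1,2) ne(1) assms(4)]
    link(3)[OF assms(3,4) ne(2) assms(1)] link(3)[OF assms(3,4) ne(2) assms(2)]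
  have "G {i, j} \<inter> G {k, l} = {}"
    using link(4)[OF assms(1,2) ne(1) assms(3,4) ne(2)] assms(5) by (auto simp: doubleton_eq_iff)
  then show ?thesis using blobs links assms(5) unfolding corridor_def by auto
qed

lemma corridor_Int_corridor:
  assumes "i \<in> {a, b, c, d, e}" "j \<in> {a, b, c, d, e}" "k \<in> {a, b, c, d, e}" "distinct [i, j, k]"
  shows "corridor i j \<inter> corridor i k \<subseteq> A i"
proof -
  have ne: "i \<noteq> j" "i \<noteq> k" "j \<noteq> k" using assms(4) by auto
  have "A i \<inter> A k = {}" "A j \<inter> A k = {}" "G {i, j} \<inter> A k = {}" "G {i, k} \<inter> A j = {}"
    using blob(3)[OF assms(1,3)] blob(3)[OF assms(2,3)] link(3)[OF assms(1,2) ne(1) assms(3)]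
      link(3)[OF assms(1,3) ne(2) assms(2)] ne by auto
  moreover have "G {i, j} \<inter> G {i, k} \<subseteq> A i"
    using link(4)[OF assms(1,2) ne(1) assms(1,3) ne(2)] ne by (auto simp: doubleton_eq_iff)
  ultimately show ?thesis unfolding corridor_def by auto
qed

lemma arc_through_corridors:
  assumes x: "x \<in> {c, d, e}"
  obtains P l r where "arcset P l r" "P \<inter> A a = {l}" "P \<inter> A b = {r}"
    "P \<subseteq> corridor a x \<union> corridor b x" "P \<inter> A x \<noteq> {}"
proof -
  have V: "a \<in> {a, b, c, d, e}" "b \<in> {a, b, c, d, e}" "x \<in> {a, b, c, d, e}"
    and ne: "a \<noteq> b" "a \<noteq> x" "b \<noteq> x" using x distinct by auto
  have "G {a, x} \<inter> A x \<noteq> {}" using link(3)[OF V(1,3) ne(2) V(3)] by simp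
  then have "path_connected (corridor a x \<union> corridor b x)"
    by (intro path_connected_Un path_connected_corridor V ne) (auto simp: corridor_def)
  moreover have "(corridor a x \<union> corridor b x) \<inter> A a \<noteq> {}"
    "(corridor a x \<union> corridor b x) \<inter> A b \<noteq> {}"
    using link(3)[OF V(1,2) ne(1) V(1)] link(3)[OF V(1,2) ne(1) V(2)] by (auto simp: corridor_def)
  ultimately obtain P l r where P: "arcset P l r" "P \<subseteq> corridor a x \<union> corridor b x"
    "P \<inter> A a = {l}" "P \<inter> A b = {r}"
    using path_connected_bridge[OF _ blob(1)[OF V(1)] _ blob(1)[OF V(2)]] by metis
  have "P \<inter> A x \<noteq> {}"
  proof
    assume disj: "P \<inter> A x = {}"
    have "corridor a x \<inter> corridor b x \<subseteq> A x"
      using corridor_Int_corridor[OF V(3,1,2)] ne by (simp add: corridor_commute[of x])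
    then have "P \<inter> (A b \<union> G {b, x}) = {}"
      using P(2,3) disj unfolding corridor_def
      by (intro connected_closed_cover_disjoint[OF arcset_imp_connected[OF P(1)],
            of "A a \<union> G {a, x}"] closed_Un blob(1) link(1) V ne) auto
    then show False using P(4) by auto
  qed
  then show ?thesis using that[OF P(1,3,4,2)] by auto
qed

definition thin_roads :: "complex \<Rightarrow> complex \<Rightarrow> ('a \<Rightarrow> complex set) \<Rightarrow> bool" where
  "thin_roads u v P \<longleftrightarrow> u \<in> A a \<and> v \<in> A b \<and>
     (\<forall>x\<in>{c, d, e}. arcset (P x) u v \<and> P x \<subseteq> corridor a x \<union> corridor b x \<and> P x \<inter> A x \<noteq> {} \<and>
        connected (P x \<inter> A a) \<and> connected (P x \<inter> A b)) \<and>
     pairwise (\<lambda>x y. P x \<inter> P y = {u, v}) {c, d, e}"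

lemma corridors_Int_corridors:
  assumes "x \<in> {c, d, e}" "y \<in> {c, d, e}" "x \<noteq> y"
  shows "(corridor a x \<union> corridor b x) \<inter> (corridor a y \<union> corridor b y) \<subseteq> A a \<union> A b"
  using assms distinct corridor_Int_corridor[of a x y] corridor_Int_corridor[of b x y]
    corridors_disjoint[of a x b y] corridors_disjoint[of b x a y] by auto

lemma thin_roads_join:
  assumes Q: "\<forall>x\<in>{c, d, e}. arcset (Q x) (l x) (r x) \<and> Q x \<inter> A a = {l x} \<and> Q x \<inter> A b = {r x} \<and>
      Q x \<subseteq> corridor a x \<union> corridor b x \<and> Q x \<inter> A x \<noteq> {}"
    and L: "\<forall>x\<in>{c, d, e}. arcset (L x) u (l x) \<and> L x \<subseteq> A a"
      "pairwise (\<lambda>x y. L x \<inter> L y = {u}) {c, d, e}"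
    and R: "\<forall>x\<in>{c, d, e}. arcset (R x) v (r x) \<and> R x \<subseteq> A b"
      "pairwise (\<lambda>x y. R x \<inter> R y = {v}) {c, d, e}"
  shows "thin_roads u v (\<lambda>x. L x \<union> Q x \<union> R x)"
proof -
  have ab: "A a \<inter> A b = {}" using blob(3)[of a b] distinct by simp
  define P where "P x = L x \<union> Q x \<union> R x" for x
  have P: "arcset (P x) u v" "P x \<inter> A a = L x" "P x \<inter> A b = R x"
    "P x \<subseteq> corridor a x \<union> corridor b x" "P x \<inter> A x \<noteq> {}" if x: "x \<in> {c, d, e}" for x
  proof -
    have arcs: "arcset (L x) u (l x)" "L x \<subseteq> A a" "arcset (Q x) (l x) (r x)" "Q x \<inter> A a = {l x}"
        "Q x \<inter> A b = {r x}" "arcset (R x) v (r x)" "R x \<subseteq> A b"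
      and Qx: "Q x \<subseteq> corridor a x \<union> corridor b x" "Q x \<inter> A x \<noteq> {}"
      using bspec[OF Q x] bspec[OF L(1) x] bspec[OF R(1) x] by simp_all
    show "arcset (P x) u v" "P x \<inter> A a = L x" "P x \<inter> A b = R x"
      unfolding P_def by (rule arcset_extend_ends[OF arcs ab])+
    show "P x \<subseteq> corridor a x \<union> corridor b x" "P x \<inter> A x \<noteq> {}"
      unfolding P_def using arcs(2,7) Qx by (auto simp: corridor_def)
  qed
  have "P x \<inter> P y = {u, v}" if xy: "x \<in> {c, d, e}" "y \<in> {c, d, e}" "x \<noteq> y" for x y
  proof -
    have "P x \<inter> P y \<subseteq> A a \<union> A b"
      using P(4)[OF xy(1)] P(4)[OF xy(2)] corridors_Int_corridors[OF xy] by auto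
    then have "P x \<inter> P y = (P x \<inter> A a) \<inter> (P y \<inter> A a) \<union> (P x \<inter> A b) \<inter> (P y \<inter> A b)" by auto
    then show ?thesis using P(2,3) xy pairwiseD[OF L(2) xy] pairwiseD[OF R(2) xy] by auto
  qed
  then have "pairwise (\<lambda>x y. P x \<inter> P y = {u, v}) {c, d, e}" by (auto intro: pairwiseI)
  moreover have "connected (P x \<inter> A a)" "connected (P x \<inter> A b)" if x: "x \<in> {c, d, e}" for x
    unfolding P(2,3)[OF x] using L(1) R(1) x arcset_imp_connected by blast+
  moreover have "u \<in> A a" "v \<in> A b" using L(1) R(1) arcset_ends by blast+
  ultimately show ?thesis using P(1,4,5) unfolding thin_roads_def P_def by simp
qed

lemma thin_roads_exist: obtains u v P where "thin_roads u v P"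
proof -
  have V: "a \<in> {a, b, c, d, e}" "b \<in> {a, b, c, d, e}" and ne: "distinct [c, d, e]" using distinct
    by auto
  have "\<forall>x\<in>{c, d, e}. \<exists>Q l r. arcset Q l r \<and> Q \<inter> A a = {l} \<and> Q \<inter> A b = {r} \<and>
      Q \<subseteq> corridor a x \<union> corridor b x \<and> Q \<inter> A x \<noteq> {}"
    using arc_through_corridors by metis
  then obtain Q l r where Q: "\<forall>x\<in>{c, d, e}. arcset (Q x) (l x) (r x) \<and> Q x \<inter> A a = {l x} \<and>
      Q x \<inter> A b = {r x} \<and> Q x \<subseteq> corridor a x \<union> corridor b x \<and> Q x \<inter> A x \<noteq> {}"
    by metis
  then have lr: "\<forall>x\<in>{c, d, e}. l x \<in> A a" "\<forall>x\<in>{c, d, e}. r x \<in> A b" by auto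
  obtain u L where L: "\<forall>x\<in>{c, d, e}. arcset (L x) u (l x) \<and> L x \<subseteq> A a"
    "pairwise (\<lambda>x y. L x \<inter> L y = {u}) {c, d, e}"
    using tripod[OF blob(2)[OF V(1)] lr(1) ne] .
  obtain v R where R: "\<forall>x\<in>{c, d, e}. arcset (R x) v (r x) \<and> R x \<subseteq> A b"
    "pairwise (\<lambda>x y. R x \<inter> R y = {v}) {c, d, e}"
    using tripod[OF blob(2)[OF V(2)] lr(2) ne] .
  show ?thesis by (rule that[OF thin_roads_join[OF Q L R]])
qed

lemma thin_roads_theta_graph:
  assumes "thin_roads u v P" "x \<in> {c, d, e}" "y \<in> {c, d, e}" "z \<in> {c, d, e}" "distinct [x, y, z]"
  shows "theta_graph u v (P x) (P y) (P z)"
proof -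
  have arcs: "\<forall>w\<in>{c, d, e}. arcset (P w) u v" and uv: "u \<in> A a" "v \<in> A b"
    and PP: "pairwise (\<lambda>x y. P x \<inter> P y = {u, v}) {c, d, e}"
    using assms(1) unfolding thin_roads_def by blast+
  have "A a \<inter> A b = {}" using blob(3)[of a b] distinct by simp
  then have "u \<noteq> v" using uv by auto
  moreover have "P x \<inter> P y = {u, v}" "P x \<inter> P z = {u, v}" "P y \<inter> P z = {u, v}"
    using pairwiseD[OF PP assms(2,3)] pairwiseD[OF PP assms(2,4)]
      pairwiseD[OF PP assms(3,4)] assms(5) by simp_all
  ultimately show ?thesis unfolding theta_graph_def using arcs assms(2-4) by blast
qed

lemma thin_roads_link:
  assumes roads: "thin_roads u v P" and xyz: "{x, y, z} = {c, d, e}" "distinct [x, y, z]"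
  obtains K p q where "arcset K p q" "K \<subseteq> corridor x y" "K \<inter> P x = {p}" "K \<inter> P y = {q}"
    "K \<inter> P z = {}"
proof -
  have X: "x \<in> {c, d, e}" "y \<in> {c, d, e}" "z \<in> {c, d, e}" and ne: "x \<noteq> y"
    using xyz by (simp_all flip: xyz(1))
  then have V: "a \<in> {a, b, c, d, e}" "b \<in> {a, b, c, d, e}" "x \<in> {a, b, c, d, e}"
    "y \<in> {a, b, c, d, e}" "z \<in> {a, b, c, d, e}"
    and dist: "distinct [x, y, a, z]" "distinct [x, y, b, z]"
    using distinct xyz(2) by auto
  have P: "\<And>w. w \<in> {c, d, e} \<Longrightarrow> arcset (P w) u v" "\<And>w. w \<in> {c, d, e} \<Longrightarrow> P w \<inter> A w \<noteq> {}"
      "P z \<subseteq> corridor a z \<union> corridor b z"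
    using roads X(3) unfolding thin_roads_def by auto
  have "corridor x y \<inter> P x \<noteq> {}" "corridor x y \<inter> P y \<noteq> {}"
    using P(2)[OF X(1)] P(2)[OF X(2)] by (auto simp: corridor_def)
  then obtain K p q where K: "arcset K p q" "K \<subseteq> corridor x y" "K \<inter> P x = {p}" "K \<inter> P y = {q}"
    using path_connected_bridge[OF path_connected_corridor[OF V(3,4) ne]
        arcset_imp_closed[OF P(1)[OF X(1)]] _ arcset_imp_closed[OF P(1)[OF X(2)]]] by metis
  moreover have "K \<inter> P z = {}"
    using K(2) P(3) corridors_disjoint[OF V(3,4,1,5) dist(1)]
      corridors_disjoint[OF V(3,4,2,5) dist(2)]
    by blast
  ultimately show ?thesis by (rule that)
qed

lemma ab_chord_reaches:
  assumes roads: "thin_roads u v P" and xyz: "{x, y, z} = {c, d, e}" "distinct [x, y, z]"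
    and N: "arcset N s t" "N \<subseteq> corridor a b" "N \<inter> \<Union> (P ` {c, d, e}) = {s, t}"
      "s \<in> A a" "t \<in> A b" and n: "n \<in> N - {s, t}"
  shows "reaches (P x \<union> P y) n (P z)"
proof -
  have X: "x \<in> {c, d, e}" "y \<in> {c, d, e}" "z \<in> {c, d, e}"
    using xyz by (simp_all flip: xyz(1))
  then have V: "a \<in> {a, b, c, d, e}" "b \<in> {a, b, c, d, e}" "x \<in> {a, b, c, d, e}"
    "y \<in> {a, b, c, d, e}" and dist: "distinct [a, b, x, y]"
    using distinct xyz(2) by auto
  have uv: "u \<in> A a" "v \<in> A b"
    and P: "\<And>w. w \<in> {c, d, e} \<Longrightarrow> arcset (P w) u v"
      "\<And>w. w \<in> {c, d, e} \<Longrightarrow> connected (P w \<inter> A a)" "\<And>w. w \<in> {c, d, e} \<Longrightarrow> connected (P w \<inter> A b)"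
    using roads unfolding thin_roads_def by auto
  define \<Theta> where "\<Theta> = P x \<union> P y \<union> P z"
  have N\<Theta>: "N \<inter> \<Theta> = {s, t}" using N(3) unfolding \<Theta>_def xyz(1)[symmetric] by auto
  obtain K p q where K: "arcset K p q" "K \<subseteq> corridor x y" "K \<inter> P x = {p}" "K \<inter> P y = {q}"
    "K \<inter> P z = {}"
    using thin_roads_link[OF roads xyz] .
  then have K\<Theta>: "K \<inter> \<Theta> = {p, q}" unfolding \<Theta>_def by auto
  have "K \<inter> corridor a b = {}" using K(2) corridors_disjoint[OF V dist] by auto
  then have Kab: "K \<inter> A a = {}" "K \<inter> A b = {}" "N \<inter> K = {}" using N(2) unfolding corridor_def
    by auto
  have ab: "A a \<inter> A b = {}" using blob(3)[OF V(1,2)] distinct by auto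
  have ends: "u \<in> P w" "v \<in> P w" if "w \<in> {c, d, e}" for w using arcset_ends[OF P(1)[OF that]]
    by auto
  have con: "connected (\<Theta> \<inter> A a)" "connected (\<Theta> \<inter> A b)"
    unfolding \<Theta>_def Int_Un_distrib2 using ends[OF X(1)] ends[OF X(2)] ends[OF X(3)] uv
    by (intro connected_Un P X; blast)+
  show ?thesis
  proof (rule theta_graph_crossed_chord_reaches[OF
        thin_roads_theta_graph[OF roads X xyz(2)] K(1) _ _ _ _ _ N(1) _ Kab(3) n,
        folded \<Theta>_def, OF K\<Theta> _ _ _ _ N\<Theta> con(1) _ _ _ _ _ con(2)])
    show "p \<in> P x" "q \<in> P y" using K(3,4) by auto
    have "u \<in> \<Theta>" "v \<in> \<Theta>" using ends[OF X(1)] by (auto simp: \<Theta>_def)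
    then show "u \<in> \<Theta> \<inter> A a" "v \<in> \<Theta> \<inter> A b" using uv by auto
    show "s \<in> \<Theta> \<inter> A a" "t \<in> \<Theta> \<inter> A b" using N\<Theta> N(4,5) by auto
    show "v \<notin> \<Theta> \<inter> A a" "u \<notin> \<Theta> \<inter> A b" using ab uv by auto
  qed (use Kab uv in auto)
qed

theorem contradiction: False
proof -
  have V: "a \<in> {a, b, c, d, e}" "b \<in> {a, b, c, d, e}" "a \<noteq> b" using distinct by auto
  obtain u v P where roads: "thin_roads u v P" using thin_roads_exist .
  define \<Theta> where "\<Theta> = \<Union> (P ` {c, d, e})"
  have P: "\<forall>x\<in>{c, d, e}. arcset (P x) u v \<and> P x \<subseteq> corridor a x \<union> corridor b x"
    and uv: "u \<in> A a" "v \<in> A b"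
    using roads unfolding thin_roads_def by blast+
  then have "closed \<Theta>" unfolding \<Theta>_def using arcset_imp_closed by (intro closed_UN) auto
  then have "closed (\<Theta> \<inter> A a)" "closed (\<Theta> \<inter> A b)" using blob(1) V by auto
  moreover have "u \<in> \<Theta>" "v \<in> \<Theta>" unfolding \<Theta>_def using P arcset_ends[of "P c" u v] by auto
  then have "corridor a b \<inter> (\<Theta> \<inter> A a) \<noteq> {}" "corridor a b \<inter> (\<Theta> \<inter> A b) \<noteq> {}"
    using uv by (auto simp: corridor_def)
  ultimately obtain N s t where N: "arcset N s t" "N \<subseteq> corridor a b" "N \<inter> (\<Theta> \<inter> A a) = {s}"
    "N \<inter> (\<Theta> \<inter> A b) = {t}"
    using path_connected_bridge[OF path_connected_corridor[OF V]] by metis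
  have "corridor a b \<inter> (corridor a x \<union> corridor b x) \<subseteq> A a \<union> A b" if "x \<in> {c, d, e}" for x
    using that distinct corridor_Int_corridor[of a b x] corridor_Int_corridor[of b a x]
    by (auto simp: corridor_commute[of b a])
  then have "N \<inter> \<Theta> \<subseteq> A a \<union> A b" using N(2) P unfolding \<Theta>_def by blast
  then have N\<Theta>: "N \<inter> \<Theta> = {s, t}" "s \<in> A a" "t \<in> A b" using N(3,4) by auto
  then have "s \<noteq> t" using blob(3)[OF V] by auto
  then obtain n where n: "n \<in> N - {s, t}" using arcset_endless(2)[OF N(1)] by blast
  note reaches = ab_chord_reaches[OF roads _ _ N(1,2) N\<Theta>[unfolded \<Theta>_def] n]
  have "theta_graph u v (P c) (P d) (P e)" using thin_roads_theta_graph[OF roads] distinct by simp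
  moreover have "reaches (P c \<union> P d) n (P e)" "reaches (P c \<union> P e) n (P d)"
    "reaches (P d \<union> P e) n (P c)"
    using distinct by (auto intro!: reaches)
  ultimately show False using theta_graph_not_reaches_all by blast
qed

end

lemma blob_planar_no_K5:
  assumes "card V = 5"
  shows "\<not> blob_planar V ([V]\<^bsup>2\<^esup>)"
proof
  assume "blob_planar V ([V]\<^bsup>2\<^esup>)"
  then obtain A G where D: "blob_drawing V ([V]\<^bsup>2\<^esup>) A G" by (auto simp: blob_planar_def)
  have "finite V" using assms card_ge_0_finite by force
  then obtain xs where xs: "set xs = V" "distinct xs" using finite_distinct_list by blast
  then have "length xs = 5" using assms distinct_card by metis
  then obtain a b c d e where "xs = [a, b, c, d, e]" by (auto simp: numeral_eq_Suc length_Suc_conv)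
  then have "blob_K5 a b c d e A G" using xs D by unfold_locales auto
  then show False by (rule blob_K5.contradiction)
qed

section \<open>Edges and triangles in graphs without a complete minor on five vertices\<close>

definition minor_closed :: "('a set \<Rightarrow> 'a set set \<Rightarrow> bool) \<Rightarrow> bool" where
  "minor_closed P \<longleftrightarrow> (\<forall>V E. P V E \<longrightarrow> graph V E) \<and>
     (\<forall>V E V' E'. P V E \<longrightarrow> V' \<subseteq> V \<longrightarrow> E' \<subseteq> E \<longrightarrow> E' \<subseteq> [V']\<^bsup>2\<^esup> \<longrightarrow> P V' E') \<and>
     (\<forall>V E u v. P V E \<longrightarrow> {u, v} \<in> E \<longrightarrow> P (V - {v}) (contract u v E))"

lemma minor_closed_blob_planar: "minor_closed blob_planar"
  unfolding minor_closed_def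
  by (metis blob_planar_def blob_planar_subgraph blob_planar_contract)

lemma minor_closed_graph: "minor_closed P \<Longrightarrow> P V E \<Longrightarrow> graph V E"
  by (simp add: minor_closed_def)

lemma minor_closed_subgraph:
  "minor_closed P \<Longrightarrow> P V E \<Longrightarrow> V' \<subseteq> V \<Longrightarrow> E' \<subseteq> E \<Longrightarrow> E' \<subseteq> [V']\<^bsup>2\<^esup> \<Longrightarrow> P V' E'"
  unfolding minor_closed_def by meson

lemma minor_closed_contract:
  "minor_closed P \<Longrightarrow> P V E \<Longrightarrow> {u, v} \<in> E \<Longrightarrow> P (V - {v}) (contract u v E)"
  unfolding minor_closed_def by meson

definition nbrs :: "'a set set \<Rightarrow> 'a \<Rightarrow> 'a set" where
  "nbrs E v = {w. {v, w} \<in> E}"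

lemma mem_nbrs [simp]: "w \<in> nbrs E v \<longleftrightarrow> {v, w} \<in> E"
  by (simp add: nbrs_def)

lemma finite_graph_edges: "graph V E \<Longrightarrow> finite E"
  unfolding graph_def by (meson finite_imp_finite_nsets finite_subset)

lemma nbrs_subset: "graph V E \<Longrightarrow> nbrs E v \<subseteq> V - {v}"
  unfolding nbrs_def using graph_edge[of V E v] by blast

lemma finite_nbrs: "graph V E \<Longrightarrow> finite (nbrs E v)"
  using finite_subset[OF nbrs_subset, of V E v] by (simp add: graph_def)

lemma card_incident_edges:
  assumes "graph V E"
  shows "card {e \<in> E. v \<in> e} = card (nbrs E v)"
proof -
  have "{e \<in> E. v \<in> e} = (\<lambda>w. {v, w}) ` nbrs E v"
    using assms by (fastforce simp: graph_def insert_commute elim!: nsets2_E dest!: subsetD)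
  moreover have "inj_on (\<lambda>w. {v, w}) (nbrs E v)" by (auto simp: inj_on_def doubleton_eq_iff)
  ultimately show ?thesis by (simp add: card_image)
qed

lemma handshake:
  assumes "graph V E"
  shows "(\<Sum>v\<in>V. card (nbrs E v)) = 2 * card E"
proof -
  have "card {v \<in> V. v \<in> e} = 2" if "e \<in> E" for e
  proof -
    have "{v \<in> V. v \<in> e} = e" "card e = 2" using assms that by (auto simp: graph_def nsets_def)
    then show ?thesis by simp
  qed
  then have "(\<Sum>v\<in>V. card {e \<in> E. v \<in> e}) = 2 * card E"
    using assms finite_graph_edges by (intro sum_multicount) (auto simp: graph_def)
  then show ?thesis using card_incident_edges[OF assms] by simp
qed

lemma low_degree_vertex_exists:
  assumes "graph V E" "2 * card E < k * card V"
  shows "\<exists>v\<in>V. card (nbrs E v) < k"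
proof (rule ccontr)
  assume "\<not> ?thesis"
  then have "(\<Sum>v\<in>V. k) \<le> (\<Sum>v\<in>V. card (nbrs E v))" by (intro sum_mono) auto
  then show False using handshake[OF assms(1)] assms(2) by (simp add: mult.commute)
qed

lemma card_delete_vertex:
  assumes "graph V E"
  shows "card E = card (E \<inter> [V - {v}]\<^bsup>2\<^esup>) + card (nbrs E v)"
proof -
  have "E \<inter> [V - {v}]\<^bsup>2\<^esup> = {e \<in> E. v \<notin> e}" using assms by (auto simp: graph_def nsets_def)
  moreover have "card E = card {e \<in> E. v \<notin> e} + card {e \<in> E. v \<in> e}"
    using finite_graph_edges[OF assms]
      by (subst card_Un_disjoint[symmetric]) (auto intro: arg_cong[of _ _ card])
  ultimately show ?thesis using card_incident_edges[OF assms] by simp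
qed

lemma card_contract:
  assumes "graph V E" "{u, v} \<in> E"
  shows "card E \<le> card (contract u v E) + card (nbrs E u \<inter> nbrs E v) + 1"
proof -
  let ?N = "nbrs E v - {u} - nbrs E u"
  have fin: "finite E" "finite (nbrs E v)" using assms finite_graph_edges finite_nbrs by auto
  have "card (nbrs E v) \<le> card ?N + card ({u} \<union> (nbrs E u \<inter> nbrs E v))"
    using fin by (intro order_trans[OF card_mono card_Un_le]) auto
  also have "card ({u} \<union> (nbrs E u \<inter> nbrs E v)) \<le> 1 + card (nbrs E u \<inter> nbrs E v)"
    using card_Un_le[of "{u}"] by simp
  finally have "card (nbrs E v) \<le> card ?N + card (nbrs E u \<inter> nbrs E v) + 1" by simp
  moreover have "card {e \<in> E. v \<notin> e} + card ?N \<le> card (contract u v E)"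
  proof -
    have "card ?N = card ((\<lambda>x. {u, x}) ` ?N)"
      by (intro card_image[symmetric]) (auto simp: inj_on_def doubleton_eq_iff)
    then have "card {e \<in> E. v \<notin> e} + card ?N = card ({e \<in> E. v \<notin> e} \<union> (\<lambda>x. {u, x}) ` ?N)"
      using fin by (subst card_Un_disjoint) auto
    also have "\<dots> \<le> card (contract u v E)"
      using finite_graph_edges[OF graph_contract[OF assms]]
      by (intro card_mono) (auto simp: contract_def)
    finally show ?thesis .
  qed
  moreover have "E \<inter> [V - {v}]\<^bsup>2\<^esup> = {e \<in> E. v \<notin> e}" using assms by (auto simp: graph_def nsets_def)
  ultimately show ?thesis using card_delete_vertex[OF assms(1), of v] by simp
qed

text \<open>If \<open>v\<close> has five neighbours and the non-edges \<open>{z, w}\<close>, \<open>{x, y}\<close> between them are the only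
  ones, then contracting \<open>{x, z}\<close> makes \<open>v\<close> and the remaining four neighbours complete.\<close>

lemma K5_minor_if_nonedges_matching:
  assumes P: "minor_closed P" "P V F" and v: "v \<in> V" "card (nbrs F v) = 5"
    and matching: "\<And>w q q'. w \<in> nbrs F v \<Longrightarrow> q \<in> nbrs F v - {w} \<Longrightarrow> q' \<in> nbrs F v - {w} \<Longrightarrow>
      {w, q} \<notin> F \<Longrightarrow> {w, q'} \<notin> F \<Longrightarrow> q = q'"
    and zw: "z \<in> nbrs F v" "w \<in> nbrs F v" "z \<noteq> w" "{z, w} \<notin> F"
    and xy: "x \<in> nbrs F v - {z}" "y \<in> nbrs F v - {z}" "x \<noteq> y" "{x, y} \<notin> F"
  shows "\<exists>S. card S = 5 \<and> P S ([S]\<^bsup>2\<^esup>)"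
proof -
  define N where "N = nbrs F v"
  note matching = matching[folded N_def] and zw = zw[folded N_def] and xy = xy[folded N_def]
  have g: "graph V F" using minor_closed_graph P by blast
  have N: "finite N" "N \<subseteq> V" "v \<notin> N" "card N = 5"
    unfolding N_def using finite_nbrs[OF g] nbrs_subset[OF g] v(2) by blast+
  have w: "w \<noteq> x" "w \<noteq> y"
    using matching[of w z y] matching[of w z x] zw xy by (auto simp: insert_commute)
  then have xz: "{x, z} \<in> F" "{y, z} \<in> F"
    using matching[of z w x] matching[of z w y] zw xy by (auto simp: insert_commute)
  have end_xy: "p \<in> {x, y}" if pq: "p \<in> N - {z}" "q \<in> N - {z}" "p \<noteq> q" "{p, q} \<notin> F" for p q
  proof (rule ccontr)
    assume p: "p \<notin> {x, y}"
    have "p \<noteq> w" "q \<noteq> w"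
      using matching[of w q z] matching[of w p z] zw(1-4) pq by (auto simp: insert_commute)
    moreover have "q \<noteq> x" "q \<noteq> y"
      using matching[of x p y] matching[of y p x] xy pq p by (auto simp: insert_commute)
    ultimately have "card {x, y, z, w, p, q} = 6" using p pq w xy zw by (auto simp: card_insert_if)
    moreover have "card {x, y, z, w, p, q} \<le> card N" using pq xy zw N(1) by (intro card_mono) auto
    ultimately show False using N(4) by simp
  qed
  let ?S = "insert v (N - {z})"
  have "e \<in> contract x z F" if e: "e \<in> [?S]\<^bsup>2\<^esup>" for e
  proof (cases "e \<in> F")
    case True
    then show ?thesis using e N(3) zw(1) by (auto simp: contract_def nsets_def)
  next
    case False
    obtain p q where pq: "e = {p, q}" "p \<in> ?S" "q \<in> ?S" "p \<noteq> q" using e by (rule nsets2_E)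
    then have "p \<in> N - {z}" "q \<in> N - {z}" using False by (auto simp: N_def insert_commute)
    then have "e = {x, y}" using end_xy[of p q] end_xy[of q p] pq False
      by (auto simp: insert_commute)
    then show ?thesis using xz(2) xy(3) by (auto simp: contract_def insert_commute)
  qed
  then have "P ?S ([?S]\<^bsup>2\<^esup>)"
    using minor_closed_subgraph[OF P(1) minor_closed_contract[OF P xz(1)], of ?S] N zw(1) v(1)
      by auto
  moreover have "card ?S = 5" using N zw(1) by simp
  ultimately show ?thesis by blast
qed

lemma nonedgeE:
  assumes "\<not> [M]\<^bsup>2\<^esup> \<subseteq> F"
  obtains x y where "x \<in> M" "y \<in> M" "x \<noteq> y" "{x, y} \<notin> F"
proof -
  obtain e where e: "e \<in> [M]\<^bsup>2\<^esup>" "e \<notin> F" using assms by (meson subsetI)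
  from e(1) obtain x y where "e = {x, y}" "x \<in> M" "y \<in> M" "x \<noteq> y" by (rule nsets2_E)
  then show ?thesis using that e(2) by blast
qed

lemma K5_minor_if_dense_neighbourhood:
  assumes P: "minor_closed P" "P V F" and v: "v \<in> V" "nbrs F v \<noteq> {}" "card (nbrs F v) \<le> 5"
    and common: "\<And>w. w \<in> nbrs F v \<Longrightarrow> 3 \<le> card (nbrs F v \<inter> nbrs F w)"
  shows "\<exists>S. card S = 5 \<and> P S ([S]\<^bsup>2\<^esup>)"
proof -
  define N where "N = nbrs F v"
  have g: "graph V F" using minor_closed_graph P by blast
  have N: "finite N" "N \<subseteq> V" "v \<notin> N" unfolding N_def using finite_nbrs[OF g] nbrs_subset[OF g]
    by blast+
  have loop: "{w} \<notin> F" for w using g by (auto simp: graph_def nsets_def)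
  have card_N: "3 + card X \<le> card N" if X: "X \<subseteq> N" "w \<in> X" "X \<inter> nbrs F w = {}" for X w
  proof -
    have "card (N \<inter> nbrs F w) + card X = card (N \<inter> nbrs F w \<union> X)"
      using X N(1) finite_subset by (subst card_Un_disjoint) blast+
    also have "\<dots> \<le> card N" using X(1) N(1) by (intro card_mono) auto
    finally show ?thesis using common[of w] X(1,2) by (auto simp: N_def)
  qed
  have matching: "q = q'"
    if "w \<in> N" "q \<in> N - {w}" "q' \<in> N - {w}" "{w, q} \<notin> F" "{w, q'} \<notin> F" for w q q'
    using card_N[of "{w, q, q'}" w] that loop v(3) by (cases "q = q'") (auto simp: N_def)
  show ?thesis
  proof (cases "\<exists>M\<subseteq>N. card M = 4 \<and> [M]\<^bsup>2\<^esup> \<subseteq> F")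
    case True
    then obtain M where M: "M \<subseteq> N" "card M = 4" "[M]\<^bsup>2\<^esup> \<subseteq> F" by blast
    have "[insert v M]\<^bsup>2\<^esup> \<subseteq> F" using M(1,3)
      by (fastforce simp: N_def insert_commute elim!: nsets2_E)
    then have "P (insert v M) ([insert v M]\<^bsup>2\<^esup>)"
      using M(1) N(2) v(1) by (intro minor_closed_subgraph[OF P]) auto
    moreover have "card (insert v M) = 5"
      using M(1,2) N(1,3) by (subst card_insert_disjoint) (auto intro: finite_subset)
    ultimately show ?thesis by blast
  next
    case False
    obtain r where "r \<in> N" using v(2) by (auto simp: N_def)
    then have "4 \<le> card N" using card_N[of "{r}" r] loop by simp
    then obtain M where M: "M \<subseteq> N" "card M = 4" by (rule obtain_subset_with_card_n)
    then obtain z w where zw: "z \<in> N" "w \<in> N" "z \<noteq> w" "{z, w} \<notin> F"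
      using False nonedgeE[of M F] by (metis subsetD)
    then have card5: "card N = 5" using card_N[of "{z, w}" z] loop v(3) by (auto simp: N_def)
    then have "card (N - {z}) = 4" using zw(1) by simp
    then obtain x y where xy: "x \<in> N - {z}" "y \<in> N - {z}" "x \<noteq> y" "{x, y} \<notin> F"
      using False nonedgeE[of "N - {z}" F] by (metis Diff_subset)
    show ?thesis
      using K5_minor_if_nonedges_matching[OF P v(1), folded N_def, OF card5 matching zw xy] .
  qed
qed

theorem minor_closed_card_edges:
  assumes P: "minor_closed P" and K5: "\<And>S. card S = 5 \<Longrightarrow> \<not> P S ([S]\<^bsup>2\<^esup>)"
  shows "P V E \<Longrightarrow> 3 \<le> card V \<Longrightarrow> card E + 6 \<le> 3 * card V"
proof (induction "card V" arbitrary: V E rule: less_induct)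
  case less
  have g: "graph V E" using minor_closed_graph[OF P less.prems(1)] .
  show ?case
  proof (rule ccontr)
    assume big: "\<not> ?case"
    have "card E \<le> card V choose 2"
      using card_mono[of "[V]\<^bsup>2\<^esup>" E] g by (simp add: graph_def finite_imp_finite_nsets)
    then have "card V \<noteq> 3" using big by (auto simp: choose_two)
    then have V4: "4 \<le> card V" using less.prems(2) by simp
    have "3 * card V - 5 \<le> card E" using big by simp
    then obtain F where "F \<subseteq> E" "card F = 3 * card V - 5" by (rule obtain_subset_with_card_n)
    then have F: "F \<subseteq> E" "card F + 5 = 3 * card V" using V4 by auto
    have PF: "P V F" using minor_closed_subgraph[OF P less.prems(1) _ F(1)] F(1) g
      by (auto simp: graph_def)
    have gF: "graph V F" using minor_closed_graph[OF P PF] .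
    have smaller: "card F' + 4 \<le> card F" if "P (V - {v}) F'" "v \<in> V" for F' v
    proof -
      have "card (V - {v}) = card V - 1" using card_Diff_singleton[OF that(2)] .
      then have "card F' + 6 \<le> 3 * (card V - 1)" using less.hyps[OF _ that(1)] V4 by simp
      then show ?thesis using V4 F(2) by linarith
    qed
    have deg: "4 \<le> card (nbrs F v)" if v: "v \<in> V" for v
    proof -
      have "P (V - {v}) (F \<inter> [V - {v}]\<^bsup>2\<^esup>)" by (rule minor_closed_subgraph[OF P PF]) auto
      from smaller[OF this v] show ?thesis using card_delete_vertex[OF gF, of v] by simp
    qed
    have common: "3 \<le> card (nbrs F u \<inter> nbrs F v)" if e: "{u, v} \<in> F" for u v
      using smaller[OF minor_closed_contract[OF P PF e]] card_contract[OF gF e] graph_edge[OF gF e]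
        by simp
    obtain v where v: "v \<in> V" "card (nbrs F v) \<le> 5"
      using low_degree_vertex_exists[OF gF, of 6] F(2) by auto
    moreover have "nbrs F v \<noteq> {}" using deg[OF v(1)] by auto
    ultimately show False using K5_minor_if_dense_neighbourhood[OF P PF] common K5 by auto
  qed
qed

lemma blob_planar_card_edges:
  assumes "blob_planar V E" "3 \<le> card V"
  shows "card E + 6 \<le> 3 * card V"
  using minor_closed_card_edges[OF minor_closed_blob_planar blob_planar_no_K5 assms] .

lemma blob_planar_card_link_edges:
  assumes "blob_planar V E" "v \<in> V" "2 \<le> card (nbrs E v)"
  shows "card (E \<inter> [nbrs E v]\<^bsup>2\<^esup>) + 3 \<le> 2 * card (nbrs E v)"
proof -
  let ?N = "nbrs E v" and ?E = "E \<inter> [insert v (nbrs E v)]\<^bsup>2\<^esup>"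
  have g: "graph V E" using assms(1) by (simp add: blob_planar_def)
  have N: "?N \<subseteq> V" "v \<notin> ?N" "finite ?N" using nbrs_subset[OF g] finite_nbrs[OF g] by blast+
  have H: "blob_planar (insert v ?N) ?E"
    by (rule blob_planar_subgraph[OF assms(1)]) (use N(1) assms(2) in auto)
  then have gH: "graph (insert v ?N) ?E" by (simp add: blob_planar_def)
  have "card ?E + 6 \<le> 3 * card (insert v ?N)"
    using blob_planar_card_edges[OF H] N(2,3) assms(3) by simp
  moreover have "?E \<inter> [insert v ?N - {v}]\<^bsup>2\<^esup> = E \<inter> [?N]\<^bsup>2\<^esup>"
    using N(2) nsets_mono[of ?N "insert v ?N" 2] by auto
  moreover have "nbrs ?E v = ?N" using N(2) by (auto simp: nbrs_def)
  ultimately show ?thesis using card_delete_vertex[OF gH, of v] N(2,3) by simp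
qed

definition triangle_sets :: "'a set set \<Rightarrow> 'a set set" where
  "triangle_sets E = {T. card T = 3 \<and> [T]\<^bsup>2\<^esup> \<subseteq> E}"

lemma triangles_eq_card: "triangles C = card (triangle_sets C)"
proof -
  have "(\<forall>x\<in>T. \<forall>y\<in>T. x \<noteq> y \<longrightarrow> {x, y} \<in> C) \<longleftrightarrow> [T]\<^bsup>2\<^esup> \<subseteq> C" for T
    by (auto simp: nsets_2_eq)
  then show ?thesis by (simp add: triangles_def triangle_sets_def)
qed

lemma triangle_sets_mono: "E \<subseteq> E' \<Longrightarrow> triangle_sets E \<subseteq> triangle_sets E'"
  by (auto simp: triangle_sets_def)

lemma triangle_sets_subset_vertices:
  assumes "T \<in> triangle_sets E"
  shows "T \<subseteq> \<Union>E"
proof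
  fix x assume x: "x \<in> T"
  have "T \<noteq> {x}" using assms by (auto simp: triangle_sets_def)
  then obtain y where "y \<in> T" "y \<noteq> x" using x by blast
  then have "{x, y} \<in> E" using x assms by (auto simp: triangle_sets_def)
  then show "x \<in> \<Union>E" by blast
qed

lemma triangle_sets_subset_nsets:
  assumes "graph V E"
  shows "triangle_sets E \<subseteq> [V]\<^bsup>3\<^esup>"
proof
  fix T assume T: "T \<in> triangle_sets E"
  then have "card T = 3" by (simp add: triangle_sets_def)
  moreover have "finite T" by (rule card_ge_0_finite) (simp add: \<open>card T = 3\<close>)
  moreover have "\<Union>E \<subseteq> V" using assms by (auto simp: graph_def nsets_def)
  ultimately show "T \<in> [V]\<^bsup>3\<^esup>" using triangle_sets_subset_vertices[OF T] by (auto simp: nsets_def)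
qed

lemma finite_triangle_sets: "graph V E \<Longrightarrow> finite (triangle_sets E)"
  using finite_subset[OF triangle_sets_subset_nsets] finite_imp_finite_nsets
    by (auto simp: graph_def)

lemma card_triangles_at:
  assumes "graph V E"
  shows "card {T \<in> triangle_sets E. v \<in> T} \<le> card (E \<inter> [nbrs E v]\<^bsup>2\<^esup>)"
proof (rule card_inj_on_le[of "\<lambda>T. T - {v}"])
  show "inj_on (\<lambda>T. T - {v}) {T \<in> triangle_sets E. v \<in> T}"
    by (rule inj_onI) (metis (mono_tags, lifting) insert_Diff mem_Collect_eq)
  show "finite (E \<inter> [nbrs E v]\<^bsup>2\<^esup>)" using finite_graph_edges[OF assms] by simp
  show "(\<lambda>T. T - {v}) ` {T \<in> triangle_sets E. v \<in> T} \<subseteq> E \<inter> [nbrs E v]\<^bsup>2\<^esup>"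
  proof
    fix e assume "e \<in> (\<lambda>T. T - {v}) ` {T \<in> triangle_sets E. v \<in> T}"
    then obtain T where T: "T \<in> [V]\<^bsup>3\<^esup>" "[T]\<^bsup>2\<^esup> \<subseteq> E" "v \<in> T" "e = T - {v}"
      using triangle_sets_subset_nsets[OF assms] by (auto simp: triangle_sets_def)
    then have "e \<in> [T]\<^bsup>2\<^esup>" by (auto simp: nsets_def)
    moreover have "e \<subseteq> nbrs E v" using T(2-4) by (auto simp: nbrs_def)
    ultimately show "e \<in> E \<inter> [nbrs E v]\<^bsup>2\<^esup>" using T(2) by (auto simp: nsets_def)
  qed
qed

lemma sum_card_triangles_at:
  assumes "graph V E"
  shows "(\<Sum>v\<in>V. card {T \<in> triangle_sets E. v \<in> T}) = 3 * card (triangle_sets E)"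
proof -
  have "card {v \<in> V. v \<in> T} = 3" if "T \<in> triangle_sets E" for T
  proof -
    have "T \<in> [V]\<^bsup>3\<^esup>" using triangle_sets_subset_nsets[OF assms] that by blast
    then have "{v \<in> V. v \<in> T} = T" "card T = 3" by (auto simp: nsets_def)
    then show ?thesis by simp
  qed
  then show ?thesis
    using assms finite_triangle_sets by (intro sum_multicount) (auto simp: graph_def)
qed

lemma triangle_sets_delete_low_degree:
  assumes "graph V E" "card (nbrs E v) \<le> 1"
  shows "triangle_sets E = triangle_sets (E \<inter> [V - {v}]\<^bsup>2\<^esup>)"
proof (rule equalityI[OF subsetI triangle_sets_mono])
  fix T assume T: "T \<in> triangle_sets E"
  have "[nbrs E v]\<^bsup>2\<^esup> = {}" using assms(2) finite_nbrs[OF assms(1)] by (simp add: nsets_eq_empty)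
  then have "card {T \<in> triangle_sets E. v \<in> T} = 0" using card_triangles_at[OF assms(1), of v]
    by simp
  then have "v \<notin> T" using T finite_triangle_sets[OF assms(1)] by auto
  then have "[T]\<^bsup>2\<^esup> \<subseteq> [V - {v}]\<^bsup>2\<^esup>"
    using T triangle_sets_subset_nsets[OF assms(1)] by (intro nsets_mono) (auto simp: nsets_def)
  then show "T \<in> triangle_sets (E \<inter> [V - {v}]\<^bsup>2\<^esup>)" using T by (auto simp: triangle_sets_def)
qed simp

lemma blob_planar_card_triangle_sets_min_degree:
  assumes E: "blob_planar V E" and deg: "\<And>v. v \<in> V \<Longrightarrow> 2 \<le> card (nbrs E v)"
  shows "card (triangle_sets E) \<le> 3 * card V"
proof (cases "V = {}")
  case True
  have "graph V E" using E by (simp add: blob_planar_def)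
  from triangle_sets_subset_nsets[OF this] show ?thesis using True by (simp add: nsets_eq_empty)
next
  case False
  have g: "graph V E" and fin: "finite V" using E by (auto simp: blob_planar_def graph_def)
  obtain v where v: "v \<in> V" using False by blast
  have "card (nbrs E v) \<le> card (V - {v})" using fin nbrs_subset[OF g] by (intro card_mono) auto
  then have "3 \<le> card V" using deg[OF v] v fin by simp
  note edges = blob_planar_card_edges[OF E this]
  have "3 * card (triangle_sets E) + 3 * card V = (\<Sum>v\<in>V. card {T \<in> triangle_sets E. v \<in> T} + 3)"
    using sum_card_triangles_at[OF g] by (simp add: sum.distrib)
  also have "\<dots> \<le> (\<Sum>v\<in>V. 2 * card (nbrs E v))"
  proof (rule sum_mono)
    fix v assume v: "v \<in> V"
    show "card {T \<in> triangle_sets E. v \<in> T} + 3 \<le> 2 * card (nbrs E v)"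
      using card_triangles_at[OF g, of v] blob_planar_card_link_edges[OF E v deg[OF v]] by linarith
  qed
  also have "\<dots> = 4 * card E" using handshake[OF g] by (simp flip: sum_distrib_left)
  finally show ?thesis using edges by linarith
qed

theorem blob_planar_card_triangle_sets:
  "blob_planar V E \<Longrightarrow> card (triangle_sets E) \<le> 3 * card V"
proof (induction "card V" arbitrary: V E rule: less_induct)
  case less
  have g: "graph V E" and fin: "finite V" using less.prems by (auto simp: blob_planar_def graph_def)
  show ?case
  proof (cases "\<forall>v\<in>V. 2 \<le> card (nbrs E v)")
    case True
    then show ?thesis using blob_planar_card_triangle_sets_min_degree[OF less.prems] by blast
  next
    case False
    then obtain v where v: "v \<in> V" "card (nbrs E v) \<le> 1" by force
    have "blob_planar (V - {v}) (E \<inter> [V - {v}]\<^bsup>2\<^esup>)"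
      by (rule blob_planar_subgraph[OF less.prems]) auto
    then have "card (triangle_sets (E \<inter> [V - {v}]\<^bsup>2\<^esup>)) \<le> 3 * card (V - {v})"
      by (rule less.hyps[OF card_Diff1_less[OF fin v(1)]])
    then have "card (triangle_sets E) \<le> 3 * card (V - {v})"
      using triangle_sets_delete_low_degree[OF g v(2)] by simp
    also have "\<dots> \<le> 3 * card V" using fin by (simp add: card_mono)
    finally show ?thesis .
  qed
qed

corollary planar_triangles_le:
  assumes "planar_graph V C" "finite V"
  shows "triangles C \<le> 3 * card V"
  unfolding triangles_eq_card
  by (rule blob_planar_card_triangle_sets[OF planar_graph_imp_blob_planar[OF assms]])

section \<open>Stacked triangulations and their straight-line drawings\<close>

definition star :: "'a \<Rightarrow> 'a set \<Rightarrow> 'a set set \<Rightarrow> 'a set set" where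
  "star w t K = (K - {t}) \<union> insert w ` (Pow t - {t})"

inductive apollonian :: "'a set set \<Rightarrow> bool" where
  triangle: "card t = 3 \<Longrightarrow> apollonian (Pow t)"
| insert: "apollonian K \<Longrightarrow> t \<in> K \<Longrightarrow> card t = 3 \<Longrightarrow> w \<notin> \<Union>K \<Longrightarrow> apollonian (star w t K)"

definition realizes :: "('a \<Rightarrow> 'b::real_vector) \<Rightarrow> 'a set set \<Rightarrow> bool" where
  "realizes p K \<longleftrightarrow> (\<forall>\<sigma>\<in>K. \<forall>\<tau>\<in>K. convex hull (p ` \<sigma>) \<inter> convex hull (p ` \<tau>) \<subseteq>
      convex hull (p ` (\<sigma> \<inter> \<tau>)))"

lemma realizesD:
  assumes "realizes p K" "\<sigma> \<in> K" "\<tau> \<in> K" "x \<in> convex hull (p ` \<sigma>)" "x \<in> convex hull (p ` \<tau>)"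
  shows "x \<in> convex hull (p ` (\<sigma> \<inter> \<tau>))"
  using assms unfolding realizes_def by blast

lemma realizes_inj_on:
  assumes "realizes p K" "\<forall>\<sigma>\<in>K. Pow \<sigma> \<subseteq> K"
  shows "inj_on p (\<Union>K)"
proof (rule inj_onI)
  fix x y assume xy: "x \<in> \<Union>K" "y \<in> \<Union>K" "p x = p y"
  then have "{x} \<in> K" "{y} \<in> K" using assms(2) by blast+
  then have "p x \<in> convex hull (p ` ({x} \<inter> {y}))"
    by (rule realizesD[OF assms(1)]) (simp_all add: xy(3))
  then show "x = y" by (cases "x = y") auto
qed

lemma realizes_affine_independent:
  assumes "realizes p K" "\<sigma> \<in> K" "Pow \<sigma> \<subseteq> K" "finite \<sigma>"
  shows "\<not> affine_dependent (p ` \<sigma>)"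
proof
  assume "affine_dependent (p ` \<sigma>)"
  then obtain M N where MN: "M \<inter> N = {}" "M \<union> N = p ` \<sigma>" "convex hull M \<inter> convex hull N \<noteq> {}"
    using Radon_partition[of "p ` \<sigma>"] assms(4) by auto
  then obtain \<mu> \<nu> where \<mu>\<nu>: "\<mu> \<subseteq> \<sigma>" "M = p ` \<mu>" "\<nu> \<subseteq> \<sigma>" "N = p ` \<nu>"
    by (metis Un_upper1 Un_upper2 subset_image_iff)
  then have "\<mu> \<inter> \<nu> = {}" "\<mu> \<in> K" "\<nu> \<in> K" using MN(1) assms(3) by auto
  then show False using MN(3) \<mu>\<nu>(2,4) realizesD[OF assms(1), of \<mu> \<nu>] by auto
qed

lemma convex_hull_psubset_disjoint_rel_interior:
  fixes S :: "'a::euclidean_space set"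
  assumes "\<not> affine_dependent S" "T \<subset> S"
  shows "convex hull T \<inter> rel_interior (convex hull S) = {}"
proof (rule face_of_disjoint_rel_interior)
  show "convex hull T face_of convex hull S"
    using face_of_convex_hull_affine_independent[OF assms(1)] assms(2) by blast
  obtain s where s: "s \<in> S" "s \<notin> T" using assms(2) by blast
  have "\<not> affine_dependent ({s} \<union> T)"
    using affine_independent_subset[OF assms(1), of "{s} \<union> T"] assms(2) s(1) by blast
  then have "s \<notin> convex hull T" using convex_hull_Int_subset[of "{s}" T] s(2) by auto
  then show "convex hull T \<noteq> convex hull S" using hull_inc[OF s(1)] by metis
qed

lemma convex_hull_Int_star:
  fixes S :: "'a::euclidean_space set"
  assumes ind: "\<not> affine_dependent S" and T: "T \<subset> S" and R: "R \<subseteq> S"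
    and q: "q \<in> rel_interior (convex hull S)"
  shows "convex hull T \<inter> convex hull (insert q R) \<subseteq> convex hull (T \<inter> R)"
proof -
  have "R \<subseteq> convex hull S" using order_trans[OF R hull_subset] .
  then have "convex hull T \<inter> convex hull (insert q R) = convex hull T \<inter> convex hull R"
    using convex_hull_psubset_disjoint_rel_interior[OF ind T] q
    by (intro Int_convex_hull_insert_rel_exterior[of "convex hull S"]) (auto simp: disjnt_def)
  also have "\<dots> \<subseteq> convex hull (T \<inter> R)"
    using affine_independent_subset[OF ind, of "T \<union> R"] T R by (intro convex_hull_Int_subset) auto
  finally show ?thesis .
qed

lemma realizes_convex_hull_Int_cone:
  fixes p :: "'a \<Rightarrow> 'b::euclidean_space"
  assumes p: "realizes p K" "inj_on p (\<Union>K)" and t: "t \<in> K" "\<not> affine_dependent (p ` t)"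
    and q: "q \<in> rel_interior (convex hull (p ` t))" and \<sigma>: "\<sigma> \<in> K" "\<not> t \<subseteq> \<sigma>" and \<rho>: "\<rho> \<subseteq> t"
  shows "convex hull (p ` \<sigma>) \<inter> convex hull (insert q (p ` \<rho>)) \<subseteq> convex hull (p ` (\<sigma> \<inter> \<rho>))"
proof
  fix x assume x: "x \<in> convex hull (p ` \<sigma>) \<inter> convex hull (insert q (p ` \<rho>))"
  have "insert q (p ` \<rho>) \<subseteq> convex hull (p ` t)"
    using \<rho> q rel_interior_subset[of "convex hull (p ` t)"] hull_subset[of "p ` t" convex] by blast
  then have "convex hull (insert q (p ` \<rho>)) \<subseteq> convex hull (p ` t)" by (simp add: hull_minimal)
  then have "x \<in> convex hull (p ` (\<sigma> \<inter> t))" using realizesD[OF p(1) \<sigma>(1) t(1)] x by blast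
  moreover have "\<sigma> \<inter> t \<subset> t" using \<sigma>(2) by blast
  then have "p ` (\<sigma> \<inter> t) \<subset> p ` t" using inj_on_image_eq_iff[OF p(2), of "\<sigma> \<inter> t" t] t(1) by blast
  ultimately have "x \<in> convex hull (p ` (\<sigma> \<inter> t) \<inter> p ` \<rho>)"
    using convex_hull_Int_star[OF t(2) _ _ q, of "p ` (\<sigma> \<inter> t)" "p ` \<rho>"] x \<rho> by blast
  moreover have "p ` (\<sigma> \<inter> t) \<inter> p ` \<rho> = p ` (\<sigma> \<inter> t \<inter> \<rho>)"
    using \<rho> t(1) by (intro inj_on_image_Int[OF p(2), symmetric]) auto
  moreover have "\<sigma> \<inter> t \<inter> \<rho> = \<sigma> \<inter> \<rho>" using \<rho> by blast
  ultimately show "x \<in> convex hull (p ` (\<sigma> \<inter> \<rho>))" by simp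
qed

lemma convex_hull_cone_Int_cone:
  fixes p :: "'a \<Rightarrow> 'b::euclidean_space"
  assumes p: "inj_on p t" "\<not> affine_dependent (p ` t)" and q: "q \<in> convex hull (p ` t)"
    and \<rho>: "\<rho> \<subseteq> t" "\<rho>' \<subseteq> t"
  shows "convex hull (insert q (p ` \<rho>)) \<inter> convex hull (insert q (p ` \<rho>')) =
    convex hull (insert q (p ` (\<rho> \<inter> \<rho>')))"
  unfolding inj_on_image_Int[OF p(1) \<rho>]
  by (rule convex_hull_exchange_Int[OF p(2) q image_mono[OF \<rho>(1)] image_mono[OF \<rho>(2)]])

lemma star_pair_cases:
  assumes "\<sigma> \<in> star w t K" "\<tau> \<in> star w t K"
  obtains "\<sigma> \<in> K" "\<tau> \<in> K"
    | \<rho> where "\<sigma> \<in> K - {t}" "\<rho> \<subset> t" "\<tau> = insert w \<rho>"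
    | \<rho> where "\<tau> \<in> K - {t}" "\<rho> \<subset> t" "\<sigma> = insert w \<rho>"
    | \<rho> \<rho>' where "\<rho> \<subset> t" "\<rho>' \<subset> t" "\<sigma> = insert w \<rho>" "\<tau> = insert w \<rho>'"
  using assms unfolding star_def by blast

lemma realizes_star:
  fixes p :: "'a \<Rightarrow> 'b::euclidean_space"
  assumes p: "realizes p K" and K: "\<forall>\<sigma>\<in>K. finite \<sigma> \<and> Pow \<sigma> \<subseteq> K"
    and t: "t \<in> K" "\<And>\<sigma>. \<sigma> \<in> K \<Longrightarrow> \<not> t \<subset> \<sigma>" and w: "w \<notin> \<Union>K"
    and q: "q \<in> rel_interior (convex hull (p ` t))"
  shows "realizes (p(w := q)) (star w t K)"
proof -
  let ?p = "p(w := q)"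
  have inj: "inj_on p (\<Union>K)" using realizes_inj_on[OF p] K by blast
  have ind: "\<not> affine_dependent (p ` t)" using realizes_affine_independent[OF p t(1)] K t(1)
    by blast
  have old: "?p ` \<sigma> = p ` \<sigma>" if "\<sigma> \<subseteq> \<Union>K" for \<sigma> using that w by auto
  have new: "?p ` insert w \<rho> = insert q (p ` \<rho>)" if "\<rho> \<subseteq> t" for \<rho> using that t(1) w by auto
  have old_new: "convex hull (?p ` \<sigma>) \<inter> convex hull (?p ` insert w \<rho>) \<subseteq>
      convex hull (?p ` (\<sigma> \<inter> insert w \<rho>))"
    if \<sigma>: "\<sigma> \<in> K - {t}" and \<rho>: "\<rho> \<subset> t" for \<sigma> \<rho>
  proof -
    have "\<sigma> \<inter> insert w \<rho> = \<sigma> \<inter> \<rho>" "\<sigma> \<subseteq> \<Union>K" "\<sigma> \<inter> \<rho> \<subseteq> \<Union>K" using \<sigma> w by auto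
    moreover have "\<not> t \<subseteq> \<sigma>" using t(2)[of \<sigma>] \<sigma> by blast
    ultimately show ?thesis
      using realizes_convex_hull_Int_cone[OF p inj t(1) ind q, of \<sigma> \<rho>] \<sigma> \<rho>
        by (simp only: old new) auto
  qed
  have qt: "q \<in> convex hull (p ` t)" using q rel_interior_subset by blast
  have injt: "inj_on p t" using inj t(1) by (auto intro: inj_on_subset)
  have new_new: "convex hull (?p ` insert w \<rho>) \<inter> convex hull (?p ` insert w \<rho>') \<subseteq>
      convex hull (?p ` (insert w \<rho> \<inter> insert w \<rho>'))" if \<rho>: "\<rho> \<subset> t" "\<rho>' \<subset> t" for \<rho> \<rho>'
    using convex_hull_cone_Int_cone[OF injt ind qt, of \<rho> \<rho>'] \<rho> new[of \<rho>] new[of \<rho>'] new[of "\<rho> \<inter> \<rho>'"]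
    by (simp add: le_infI1 psubset_imp_subset)
  show ?thesis
    unfolding realizes_def
  proof (intro ballI)
    fix \<sigma> \<tau> assume "\<sigma> \<in> star w t K" "\<tau> \<in> star w t K"
    then show "convex hull (?p ` \<sigma>) \<inter> convex hull (?p ` \<tau>) \<subseteq> convex hull (?p ` (\<sigma> \<inter> \<tau>))"
    proof (cases rule: star_pair_cases)
      case 1
      then have "\<sigma> \<subseteq> \<Union>K" "\<tau> \<subseteq> \<Union>K" "\<sigma> \<inter> \<tau> \<subseteq> \<Union>K" by auto
      then show ?thesis using p 1 unfolding realizes_def by (simp only: old)
    next
      case 2
      then show ?thesis using old_new by simp
    next
      case 3
      then show ?thesis using old_new[OF 3(1,2)] by (simp only: Int_commute)
    next
      case 4
      then show ?thesis using new_new by simp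
    qed
  qed
qed

lemma apollonian_simplices:
  assumes "apollonian K"
  shows "\<forall>\<sigma>\<in>K. finite \<sigma> \<and> card \<sigma> \<le> 3 \<and> Pow \<sigma> \<subseteq> K"
  using assms
proof induction
  case (triangle t)
  then have "finite t" by (intro card_ge_0_finite) simp
  then show ?case using triangle by (auto intro: finite_subset) (metis card_mono)
next
  case (insert K t w)
  have t: "finite t" "Pow t \<subseteq> K" using insert.IH insert.hyps(2) by auto
  show ?case
  proof
    fix \<sigma> assume "\<sigma> \<in> star w t K"
    then consider "\<sigma> \<in> K" "\<sigma> \<noteq> t" | \<rho> where "\<rho> \<subset> t" "\<sigma> = insert w \<rho>" by (auto simp: star_def)
    then show "finite \<sigma> \<and> card \<sigma> \<le> 3 \<and> Pow \<sigma> \<subseteq> star w t K"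
    proof cases
      case 1
      then have \<sigma>: "finite \<sigma>" "card \<sigma> \<le> 3" "Pow \<sigma> \<subseteq> K" using insert.IH by auto
      then have "\<not> t \<subseteq> \<sigma>" using 1(2) insert.hyps(3) card_seteq[of \<sigma> t] by auto
      then show ?thesis using \<sigma> by (auto simp: star_def)
    next
      case 2
      then have "finite \<rho>" "card \<rho> < 3"
        using t(1) insert.hyps(3) psubset_card_mono[of t \<rho>] finite_subset by auto
      then have "finite \<sigma>" "card \<sigma> \<le> 3" using 2(2) by (auto simp: card_insert_if)
      moreover have "Pow \<sigma> \<subseteq> star w t K"
      proof
        fix \<tau> assume "\<tau> \<in> Pow \<sigma>"
        then have "\<tau> - {w} \<in> Pow t - {t}" using 2 by auto
        moreover from this have "\<tau> - {w} \<in> star w t K" using t(2) by (auto simp: star_def)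
        ultimately show "\<tau> \<in> star w t K"
          by (cases "w \<in> \<tau>") (auto simp: star_def intro!: image_eqI[of _ _ "\<tau> - {w}"])
      qed
      ultimately show ?thesis by blast
    qed
  qed
qed

lemma not_affine_dependent_triangle: "\<not> affine_dependent {0, 1, \<i>}"
proof
  assume "affine_dependent {0, 1, \<i>}"
  then have "collinear {0, 1, \<i>}" by (simp add: collinear_3_eq_affine_dependent)
  then obtain u where "1 = u *\<^sub>R 0 + (1 - u) *\<^sub>R \<i>" using collinear_3_expand[of 0 1 \<i>] by auto
  then have "Re 1 = Re ((1 - u) *\<^sub>R \<i>)" by simp
  then show False by simp
qed

lemma apollonian_realization:
  assumes "apollonian K"
  shows "\<exists>p :: 'a \<Rightarrow> complex. realizes p K"
  using assms
proof induction
  case (triangle t)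
  then obtain a b c where t: "t = {a, b, c}" "a \<noteq> b" "a \<noteq> c" "b \<noteq> c" by (auto simp: card_3_iff)
  define p where "p v = (if v = a then 0 else if v = b then 1 else \<i>)" for v
  have p: "p a = 0" "p b = 1" "p c = \<i>" using t by (auto simp: p_def)
  have inj: "inj_on p t" using t p by auto
  have "p ` t = {0, 1, \<i>}" using t(1) p by auto
  then have "\<not> affine_dependent (p ` t)" using not_affine_dependent_triangle by simp
  then have "convex hull (p ` \<sigma>) \<inter> convex hull (p ` \<tau>) \<subseteq> convex hull (p ` (\<sigma> \<inter> \<tau>))"
    if "\<sigma> \<subseteq> t" "\<tau> \<subseteq> t" for \<sigma> \<tau>
    unfolding inj_on_image_Int[OF inj that]
    using that affine_independent_subset[of "p ` t" "p ` \<sigma> \<union> p ` \<tau>"]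
      by (intro convex_hull_Int_subset) auto
  then show ?case unfolding realizes_def by blast
next
  case (insert K t w)
  then obtain p :: "'a \<Rightarrow> complex" where p: "realizes p K" by blast
  have K: "\<forall>\<sigma>\<in>K. finite \<sigma> \<and> card \<sigma> \<le> 3 \<and> Pow \<sigma> \<subseteq> K" using apollonian_simplices[OF insert.hyps(1)] .
  have "p ` t \<noteq> {}" using insert.hyps(3) by auto
  then obtain q where "q \<in> rel_interior (convex hull (p ` t))"
    using rel_interior_eq_empty[of "convex hull (p ` t)"] by auto
  then have "realizes (p(w := q)) (star w t K)"
  proof (rule realizes_star[OF p _ insert.hyps(2) _ insert.hyps(4), rotated -1])
    show "\<forall>\<sigma>\<in>K. finite \<sigma> \<and> Pow \<sigma> \<subseteq> K" using K by blast
    show "\<not> t \<subset> \<sigma>" if "\<sigma> \<in> K" for \<sigma>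
      using K that insert.hyps(3) psubset_card_mono[of \<sigma> t] by fastforce
  qed
  then show ?case by blast
qed

lemma Union_star:
  assumes "t \<in> K" "card t = 3"
  shows "\<Union>(star w t K) = insert w (\<Union>K)"
proof
  show "\<Union>(star w t K) \<subseteq> insert w (\<Union>K)" using assms(1) by (auto simp: star_def)
  have new: "insert w \<rho> \<in> star w t K" if "\<rho> \<subseteq> t" "card \<rho> \<noteq> 3" for \<rho>
    using that assms(2) by (auto simp: star_def)
  have "v \<in> \<Union>(star w t K)" if "v \<in> t" for v
    by (rule UnionI[OF new[of "{v}"]]) (use that in auto)
  moreover have "w \<in> \<Union>(star w t K)" by (rule UnionI[OF new[of "{}"]]) auto
  moreover have "\<Union>K \<subseteq> \<Union>(star w t K) \<union> t" by (auto simp: star_def)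
  ultimately show "insert w (\<Union>K) \<subseteq> \<Union>(star w t K)" by blast
qed

lemma finite_Union_apollonian: "apollonian K \<Longrightarrow> finite (\<Union>K)"
proof (induction rule: apollonian.induct)
  case (triangle t)
  then show ?case using card_ge_0_finite[of t] by simp
next
  case (insert K t w)
  then show ?case by (simp add: Union_star)
qed

lemma planar_graph_straight_line:
  fixes q :: "'a::linorder \<Rightarrow> complex"
  assumes inj: "inj_on q V" and E: "E \<subseteq> [V]\<^bsup>2\<^esup>"
    and vertex: "\<And>e w. e \<in> E \<Longrightarrow> w \<in> V \<Longrightarrow> q w \<in> convex hull (q ` e) \<Longrightarrow> w \<in> e"
    and edge: "\<And>e e'. e \<in> E \<Longrightarrow> e' \<in> E \<Longrightarrow> e \<noteq> e' \<Longrightarrow>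
      convex hull (q ` e) \<inter> convex hull (q ` e') \<subseteq> q ` (e \<inter> e')"
  shows "planar_graph V E"
proof -
  define \<gamma> where "\<gamma> e = linepath (q (Min e)) (q (Max e))" for e
  have \<gamma>: "path_image (\<gamma> e) = convex hull (q ` e)" "\<exists>u\<in>V. \<exists>v\<in>V. u \<noteq> v \<and> e = {u, v} \<and> arc (\<gamma> e) \<and>
      pathstart (\<gamma> e) = q u \<and> pathfinish (\<gamma> e) = q v" if e: "e \<in> E" for e
  proof -
    obtain x y where xy: "e = {x, y}" "x \<in> V" "y \<in> V" "x < y"
      using subsetD[OF E e] by (elim nsets2_E) (metis insert_commute neqE)
    then have g: "\<gamma> e = linepath (q x) (q y)" by (simp add: \<gamma>_def min_absorb1 max_absorb2)
    then show "path_image (\<gamma> e) = convex hull (q ` e)" using xy(1)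
      by (simp add: segment_convex_hull)
    have "q x \<noteq> q y" using inj_onD[OF inj _ xy(2,3)] xy(4) by auto
    then have "x \<noteq> y \<and> e = {x, y} \<and> arc (\<gamma> e) \<and> pathstart (\<gamma> e) = q x \<and> pathfinish (\<gamma> e) = q y"
      unfolding g using xy by simp
    then show "\<exists>u\<in>V. \<exists>v\<in>V. u \<noteq> v \<and> e = {u, v} \<and> arc (\<gamma> e) \<and>
      pathstart (\<gamma> e) = q u \<and> pathfinish (\<gamma> e) = q v" using xy(2,3) by blast
  qed
  show ?thesis
    unfolding planar_graph_def
  proof (rule exI[of _ q], rule exI[of _ \<gamma>], intro conjI ballI impI)
    show "inj_on q V" by (rule inj)
    fix e assume e: "e \<in> E"
    then obtain u v where "u \<in> V" "v \<in> V" "u \<noteq> v" "e = {u, v}" "arc (\<gamma> e)" "pathstart (\<gamma> e) = q u"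
      "pathfinish (\<gamma> e) = q v" using \<gamma>(2) by blast
    then show "\<exists>u v. u \<in> V \<and> v \<in> V \<and> u \<noteq> v \<and> e = {u, v} \<and> arc (\<gamma> e) \<and> pathstart (\<gamma> e) = q u \<and>
        pathfinish (\<gamma> e) = q v \<and> (\<forall>w\<in>V. q w \<in> path_image (\<gamma> e) \<longrightarrow> w = u \<or> w = v)"
      using vertex[OF e] \<gamma>(1)[OF e] by (intro exI[of _ u] exI[of _ v]) simp
    fix e' assume "e' \<in> E" "e \<noteq> e'"
    then show "path_image (\<gamma> e) \<inter> path_image (\<gamma> e') \<subseteq> q ` (e \<inter> e')" using edge e \<gamma>(1) by simp
  qed
qed

text \<open>The vertices outside the complex are put outside the convex hull of the drawing.\<close>

lemma realizes_extend_inj: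
  fixes p :: "nat \<Rightarrow> complex"
  assumes p: "realizes p K" and K: "finite (\<Union>K)" "\<forall>\<sigma>\<in>K. Pow \<sigma> \<subseteq> K"
  obtains q :: "nat \<Rightarrow> complex" where "realizes q K" "inj q"
    "\<forall>v. q v \<in> convex hull (q ` \<Union>K) \<longrightarrow> v \<in> \<Union>K"
proof -
  let ?H = "convex hull (p ` \<Union>K)"
  have "bounded ?H" using K(1) by (intro bounded_convex_hull finite_imp_bounded finite_imageI)
  then have "\<not> bounded (- ?H)" by (intro cobounded_imp_unbounded) simp
  then have "infinite (- ?H)" using finite_imp_bounded by blast
  then obtain f :: "nat \<Rightarrow> complex" where f: "inj f" "range f \<subseteq> - ?H" using infinite_countable_subset
    by blast
  define q where "q v = (if v \<in> \<Union>K then p v else f v)" for v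
  have image: "q ` \<sigma> = p ` \<sigma>" if "\<sigma> \<subseteq> \<Union>K" for \<sigma>
    using subsetD[OF that] by (intro image_cong) (simp_all add: q_def)
  have q_hull: "q v \<in> ?H \<longleftrightarrow> v \<in> \<Union>K" for v
    using subsetD[OF f(2) rangeI, of v] hull_inc[of "p v" "p ` \<Union>K" convex] by (simp add: q_def)
  show ?thesis
  proof (rule that)
    show "realizes q K"
      unfolding realizes_def
    proof (intro ballI)
      fix \<sigma> \<tau> assume h: "\<sigma> \<in> K" "\<tau> \<in> K"
      then have "\<sigma> \<subseteq> \<Union>K" "\<tau> \<subseteq> \<Union>K" "\<sigma> \<inter> \<tau> \<subseteq> \<Union>K" by auto
      then show "convex hull (q ` \<sigma>) \<inter> convex hull (q ` \<tau>) \<subseteq> convex hull (q ` (\<sigma> \<inter> \<tau>))"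
        using p h unfolding realizes_def by (simp only: image)
    qed
    show "inj q"
    proof (rule injI)
      fix u v assume "q u = q v"
      moreover from this have "u \<in> \<Union>K \<longleftrightarrow> v \<in> \<Union>K" using q_hull by metis
      ultimately show "u = v"
        using inj_onD[OF realizes_inj_on[OF p K(2)], of u v] injD[OF f(1), of u v]
        unfolding q_def by presburger
    qed
    show "\<forall>v. q v \<in> convex hull (q ` \<Union>K) \<longrightarrow> v \<in> \<Union>K" using q_hull image[of "\<Union>K"] by simp
  qed
qed

theorem apollonian_planar_graph:
  fixes K :: "nat set set"
  assumes K: "apollonian K" and E: "E \<subseteq> K" "E \<subseteq> [V]\<^bsup>2\<^esup>"
  shows "planar_graph V E"
proof -
  have simplices: "\<forall>\<sigma>\<in>K. Pow \<sigma> \<subseteq> K" using apollonian_simplices[OF K] by blast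
  obtain p :: "nat \<Rightarrow> complex" where p: "realizes p K" using apollonian_realization[OF K] by blast
  obtain q :: "nat \<Rightarrow> complex" where q: "realizes q K" "inj q"
    "\<forall>v. q v \<in> convex hull (q ` \<Union>K) \<longrightarrow> v \<in> \<Union>K"
    using realizes_extend_inj[OF p finite_Union_apollonian[OF K] simplices] .
  show ?thesis
  proof (rule planar_graph_straight_line[of q])
    show "inj_on q V" using q(2) inj_on_subset by blast
    show "w \<in> e" if e: "e \<in> E" and w: "q w \<in> convex hull (q ` e)" for e w
    proof -
      have eK: "e \<in> K" using e E(1) by auto
      then have "convex hull (q ` e) \<subseteq> convex hull (q ` \<Union>K)" by (intro hull_mono image_mono) auto
      then have "w \<in> \<Union>K" using w q(3) by blast
      then have "{w} \<in> K" using simplices by auto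
      then have "q w \<in> convex hull (q ` ({w} \<inter> e))" using realizesD[OF q(1) _ eK _ w] by simp
      then show ?thesis by (cases "w \<in> e") auto
    qed
    show "convex hull (q ` e) \<inter> convex hull (q ` e') \<subseteq> q ` (e \<inter> e')"
      if "e \<in> E" "e' \<in> E" "e \<noteq> e'" for e e'
    proof -
      have "e \<in> [V]\<^bsup>2\<^esup>" "e' \<in> [V]\<^bsup>2\<^esup>" using that(1,2) E(2) by auto
      then obtain x y x' y' where "e = {x, y}" "e' = {x', y'}" by (metis nsets2_E)
      then have "e \<inter> e' = {} \<or> (\<exists>z. e \<inter> e' = {z})" using that(3) by auto
      then have "convex hull (q ` (e \<inter> e')) = q ` (e \<inter> e')" by (elim disjE exE) simp_all
      then show ?thesis using q(1) that(1,2) E(1) unfolding realizes_def by (metis subsetD)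
    qed
  qed (rule E(2))
qed

section \<open>The game\<close>

lemma Kn_edges_eq_nsets: "Kn_edges n = [{0..<n}]\<^bsup>2\<^esup>"
proof (rule equalityI)
  show "Kn_edges n \<subseteq> [{0..<n}]\<^bsup>2\<^esup>" by (auto simp: Kn_edges_def)
  show "[{0..<n}]\<^bsup>2\<^esup> \<subseteq> Kn_edges n"
  proof
    fix e assume "e \<in> [{0..<n}]\<^bsup>2\<^esup>"
    then obtain u v where "e = {u, v}" "u \<in> {0..<n}" "v \<in> {0..<n}" "u \<noteq> v" by (rule nsets2_E)
    then show "e \<in> Kn_edges n" unfolding Kn_edges_def by auto
  qed
qed

lemma finite_Kn_edges: "finite (Kn_edges n)"
  by (simp add: Kn_edges_eq_nsets finite_imp_finite_nsets)

lemma finite_constr_moves: "finite (constr_moves n C B)"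
  unfolding constr_moves_def using finite_Kn_edges by (rule rev_finite_subset) auto

lemma graph_Kn_edges: "C \<subseteq> Kn_edges n \<Longrightarrow> graph {0..<n} C"
  by (simp add: graph_def Kn_edges_eq_nsets)

lemma planar_graph_empty: "planar_graph (V :: nat set) {}"
  by (rule planar_graph_straight_line[of of_nat]) (auto simp: inj_on_def)

lemma pcb_val_le:
  "planar_graph {0..<n} C \<Longrightarrow> pcb_val n k t C B \<le> 3 * n"
proof (induction k arbitrary: t C B)
  case 0
  then show ?case using planar_triangles_le[of "{0..<n}"] by simp
next
  case (Suc k)
  have tri: "triangles C \<le> 3 * n" using planar_triangles_le[OF Suc.prems] by simp
  show ?case
  proof (cases t)
    case True
    have "pcb_val n k False (insert e C) B \<le> 3 * n" if "e \<in> constr_moves n C B" for e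
      using Suc.IH that by (auto simp: constr_moves_def)
    then show ?thesis using True tri finite_constr_moves by auto
  next
    case Blocker: False
    show ?thesis
    proof (cases "constr_moves n C B = {} \<or> Kn_edges n - C - B = {}")
      case True
      then show ?thesis using Blocker tri by auto
    next
      case False
      then obtain f where f: "f \<in> Kn_edges n - C - B" by blast
      then have "Min ((\<lambda>e. pcb_val n k True C (insert e B)) ` (Kn_edges n - C - B)) \<le>
          pcb_val n k True C (insert f B)"
        using finite_Kn_edges by (intro Min_le) auto
      also have "\<dots> \<le> 3 * n" using Suc by blast
      finally show ?thesis using False Blocker by simp
    qed
  qed
qed

theorem g_PCB_K3_le: "g_PCB_K3 n \<le> 3 * n"
  unfolding g_PCB_K3_def by (rule pcb_val_le[OF planar_graph_empty])

lemma pcb_val_no_moves: "constr_moves n C B = {} \<Longrightarrow> pcb_val n k t C B = triangles C"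
  by (cases k; cases t) simp_all

lemma le_pcb_val_Constructor:
  assumes "e \<in> constr_moves n C B" "L \<le> pcb_val n k False (insert e C) B"
  shows "L \<le> pcb_val n (Suc k) True C B"
proof -
  have "pcb_val n k False (insert e C) B \<le>
      Max ((\<lambda>e. pcb_val n k False (insert e C) B) ` constr_moves n C B)"
    using assms(1) finite_constr_moves by (intro Max_ge) auto
  then show ?thesis using assms by auto
qed

lemma le_pcb_val_Blocker:
  assumes free: "Kn_edges n - C - B \<noteq> {}"
    and L: "\<And>f. f \<in> Kn_edges n - C - B \<Longrightarrow> L \<le> pcb_val n k True C (insert f B)"
  shows "L \<le> pcb_val n (Suc k) False C B"
proof (cases "constr_moves n C B = {}")
  case True
  obtain f where f: "f \<in> Kn_edges n - C - B" using free by blast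
  have "constr_moves n C (insert f B) = {}" using True by (auto simp: constr_moves_def)
  then show ?thesis using L[OF f] pcb_val_no_moves True by metis
next
  case False
  have "L \<le> Min ((\<lambda>f. pcb_val n k True C (insert f B)) ` (Kn_edges n - C - B))"
    using free L finite_Kn_edges by (intro Min.boundedI) auto
  then show ?thesis using False free by simp
qed

lemma triangles_mono: "C \<subseteq> C' \<Longrightarrow> C' \<subseteq> Kn_edges n \<Longrightarrow> triangles C \<le> triangles C'"
  unfolding triangles_eq_card
  by (rule card_mono[OF finite_triangle_sets[OF graph_Kn_edges] triangle_sets_mono])

lemma triangles_le_pcb_val:
  "C \<subseteq> Kn_edges n \<Longrightarrow> triangles C \<le> pcb_val n k t C B"
proof (induction k arbitrary: t C B)
  case (Suc k)
  consider "constr_moves n C B = {}" | e where t "e \<in> constr_moves n C B"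
    | "\<not> t" "Kn_edges n - C - B = {}" | "\<not> t" "Kn_edges n - C - B \<noteq> {}" by blast
  then show ?case
  proof cases
    case 1
    then show ?thesis by (simp add: pcb_val_no_moves)
  next
    case (2 e)
    then have e: "insert e C \<subseteq> Kn_edges n" using Suc.prems by (auto simp: constr_moves_def)
    have "triangles C \<le> triangles (insert e C)" by (rule triangles_mono[OF _ e]) auto
    also have "\<dots> \<le> pcb_val n k False (insert e C) B" by (rule Suc.IH[OF e])
    finally show ?thesis using le_pcb_val_Constructor[OF 2(2)] 2(1) by simp
  next
    case 3
    then show ?thesis by simp
  next
    case 4
    then show ?thesis using le_pcb_val_Blocker[OF 4(2) Suc.IH[OF Suc.prems]] by simp
  qed
qed simp

text \<open>Constructor is to move, both now and in the position with \<open>Q\<close> that she can force.\<close>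

inductive force :: "nat \<Rightarrow> (nat set set \<Rightarrow> nat set set \<Rightarrow> bool) \<Rightarrow> nat set set \<Rightarrow> nat set set \<Rightarrow> bool"
  for n Q where
  base: "Q C B \<Longrightarrow> force n Q C B"
| step: "e \<in> constr_moves n C B \<Longrightarrow> Kn_edges n - insert e C - B \<noteq> {} \<Longrightarrow>
    (\<And>f. f \<in> Kn_edges n - insert e C - B \<Longrightarrow> force n Q (insert e C) (insert f B)) \<Longrightarrow> force n Q C B"

lemma force_trans:
  assumes "force n Q C B" "\<And>C B. Q C B \<Longrightarrow> force n R C B"
  shows "force n R C B"
  using assms(1)
proof induction
  case (base C B)
  then show ?case by (rule assms(2))
next
  case (step e C B)
  show ?case by (rule force.step[OF step.hyps(1,2) step.IH])
qed

lemma force_imp_le_pcb_val: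
  assumes "force n Q C B" "\<And>C B. Q C B \<Longrightarrow> L \<le> triangles C"
  shows "C \<subseteq> Kn_edges n \<Longrightarrow> card (Kn_edges n - C - B) \<le> k \<Longrightarrow> L \<le> pcb_val n k True C B"
  using assms(1)
proof (induction arbitrary: k rule: force.induct)
  case (base C B)
  then show ?case using assms(2) triangles_le_pcb_val le_trans by metis
next
  case (step e C B)
  let ?free = "Kn_edges n - insert e C - B"
  have e: "e \<in> Kn_edges n - C - B" using step.hyps(1) by (auto simp: constr_moves_def)
  then have "card ?free < card (Kn_edges n - C - B)"
    using finite_Kn_edges by (intro psubset_card_mono) auto
  moreover have "0 < card ?free" using step.hyps(2) finite_Kn_edges by (simp add: card_gt_0_iff)
  ultimately obtain k' where k: "k = Suc (Suc k')" "card ?free \<le> Suc k'"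
    using step.prems(2) by (cases k rule: nat.exhaust; cases "k - 1") auto
  have "L \<le> pcb_val n k' True (insert e C) (insert f B)" if f: "f \<in> ?free" for f
  proof (rule step.IH[OF f])
    show "insert e C \<subseteq> Kn_edges n" using e step.prems(1) by auto
    have "card (Kn_edges n - insert e C - insert f B) < card ?free"
      using f finite_Kn_edges by (intro psubset_card_mono) auto
    then show "card (Kn_edges n - insert e C - insert f B) \<le> k'" using k(2) by simp
  qed
  then have "L \<le> pcb_val n (Suc k') False (insert e C) B"
    by (rule le_pcb_val_Blocker[OF step.hyps(2)])
  then show ?case unfolding k(1) by (rule le_pcb_val_Constructor[OF step.hyps(1)])
qed

lemma force_imp_le_g_PCB_K3:
  assumes "force n Q {} {}" "\<And>C B. Q C B \<Longrightarrow> L \<le> triangles C"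
  shows "L \<le> g_PCB_K3 n"
  unfolding g_PCB_K3_def by (rule force_imp_le_pcb_val[OF assms]) auto

definition after_rounds :: "nat \<Rightarrow> nat \<Rightarrow> nat set set \<Rightarrow> nat set set \<Rightarrow> bool" where
  "after_rounds n m C B \<longleftrightarrow> C \<subseteq> Kn_edges n \<and> B \<subseteq> Kn_edges n \<and> card C = m \<and> card B = m"

lemma after_rounds_finite: "after_rounds n m C B \<Longrightarrow> finite C \<and> finite B"
  unfolding after_rounds_def using finite_Kn_edges finite_subset by blast

lemma force_claim:
  assumes r: "after_rounds n m C B" "2 * m + 1 < n choose 2"
    and e: "e \<in> Kn_edges n" "e \<notin> C" "e \<notin> B" "planar_graph {0..<n} (insert e C)"
    and Q: "\<And>f. after_rounds n (Suc m) (insert e C) (insert f B) \<Longrightarrow>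
      force n Q (insert e C) (insert f B)"
  shows "force n Q C B"
proof (rule force.step)
  have fin: "finite C" "finite B" using after_rounds_finite[OF r(1)] by auto
  have r': "C \<subseteq> Kn_edges n" "B \<subseteq> Kn_edges n" "card C = m" "card B = m" using r(1)
    by (auto simp: after_rounds_def)
  show "e \<in> constr_moves n C B" using e by (simp add: constr_moves_def)
  have "card (insert e C \<union> B) \<le> 2 * m + 1"
    using card_Un_le[of "insert e C" B] r'(3,4) e(2) fin by simp
  also have "\<dots> < card (Kn_edges n)" using r(2) by (simp add: Kn_edges_eq_nsets)
  finally have "\<not> Kn_edges n \<subseteq> insert e C \<union> B"
    using card_mono[of "insert e C \<union> B" "Kn_edges n"] fin by auto
  then show "Kn_edges n - insert e C - B \<noteq> {}" by blast
  fix f assume f: "f \<in> Kn_edges n - insert e C - B"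
  then have "after_rounds n (Suc m) (insert e C) (insert f B)"
    using r' e(1,2) fin by (simp add: after_rounds_def)
  then show "force n Q (insert e C) (insert f B)" by (rule Q)
qed

section \<open>Building the gadgets\<close>

definition consecutive :: "'a list \<Rightarrow> ('a \<times> 'a) set" where
  "consecutive ls = set (zip ls (tl ls))"

definition spokes :: "'a \<Rightarrow> 'a list \<Rightarrow> 'a set set" where
  "spokes x ls = (\<lambda>l. {x, l}) ` set ls"

definition rim :: "'a list \<Rightarrow> 'a set set" where
  "rim ls = (\<lambda>(a, b). {a, b}) ` consecutive ls"

definition fan_faces :: "'a \<Rightarrow> 'a list \<Rightarrow> 'a set set" where
  "fan_faces x ls = (\<lambda>(a, b). {x, a, b}) ` consecutive ls"

text \<open>A gadget lists its hub, a neighbour of the hub that is off the rim, and the rim path.\<close>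

definition gadget_edges :: "'a list \<Rightarrow> 'a set set" where
  "gadget_edges g = spokes (hd g) (tl g) \<union> rim (tl (tl g))"

lemma consecutive_simps [simp]:
  "consecutive [] = {}" "consecutive [a] = {}"
  "consecutive (a # b # ls) = insert (a, b) (consecutive (b # ls))"
  by (simp_all add: consecutive_def)

lemma consecutive_snoc: "ls \<noteq> [] \<Longrightarrow> consecutive (ls @ [c]) = insert (last ls, c) (consecutive ls)"
  by (induction ls rule: induct_list012) auto

lemma consecutive_mono: "consecutive (tl ls) \<subseteq> consecutive ls"
  by (cases ls rule: remdups_adj.cases) auto

lemma consecutive_subset: "(a, b) \<in> consecutive ls \<Longrightarrow> a \<in> set ls \<and> b \<in> set ls"
  unfolding consecutive_def by (metis in_set_zipE list.set_sel(2) empty_iff list.set(1) tl_Nil)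

lemma predecessor_exists: "l \<in> set ls \<Longrightarrow> \<exists>a. (a, l) \<in> consecutive (z # ls)"
  by (induction ls arbitrary: z) auto

lemma gadget_edges_vertices: "g \<noteq> [] \<Longrightarrow> e \<in> gadget_edges g \<Longrightarrow> e \<subseteq> set g"
  using consecutive_subset[of _ _ "tl (tl g)"]
  by (cases g; cases "tl g") (auto simp: gadget_edges_def spokes_def rim_def)

definition gadget_extension :: "'a list \<Rightarrow> 'a \<Rightarrow> 'a set set \<Rightarrow> 'a list \<Rightarrow> bool" where
  "gadget_extension g c E g' \<longleftrightarrow> distinct g' \<and> length g' = Suc (length g) \<and>
     set g' = insert c (set g) \<and> gadget_edges g' = E \<union> gadget_edges g"

text \<open>While the rim is a single vertex, it and the dangling vertex may exchange their roles.\<close>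

definition rim_ends :: "'a list \<Rightarrow> 'a set" where
  "rim_ends g = (if length g = 3 then set (tl g) else {hd (tl (tl g)), last g})"

lemma gadget_extension_spoke:
  assumes "length g = 1 \<or> length g = 2" "distinct g" "c \<notin> set g"
  shows "gadget_extension g c {{hd g, c}} (g @ [c])"
proof -
  consider x where "g = [x]" | x d where "g = [x, d]"
    using assms(1) by (auto simp: numeral_eq_Suc length_Suc_conv)
  then show ?thesis
    by cases
      (use assms(2,3) in \<open>auto simp: gadget_extension_def gadget_edges_def spokes_def rim_def\<close>)
qed

lemma gadget_extension_rim:
  assumes "3 \<le> length g" "distinct g" "c \<notin> set g" "b \<in> rim_ends g"
  shows "\<exists>g'. gadget_extension g c {{hd g, c}, {b, c}} g'"
proof -
  obtain x d a l where g: "g = x # d # a # l" using assms(1)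
    by (auto simp: numeral_eq_Suc Suc_le_length_iff)
  consider "l = []" "b = d" | "b = a" | "l \<noteq> []" "b = last g"
    using assms(4) g by (auto simp: rim_ends_def split: if_splits)
  then show ?thesis
  proof cases
    case 1
    then have "gadget_extension g c {{hd g, c}, {b, c}} [x, a, d, c]"
      using assms(2,3) g by (auto simp: gadget_extension_def gadget_edges_def spokes_def rim_def)
    then show ?thesis by blast
  next
    case 2
    then have "gadget_extension g c {{hd g, c}, {b, c}} (x # d # c # a # l)"
      using assms(2,3) g by (auto simp: gadget_extension_def gadget_edges_def spokes_def rim_def)
    then show ?thesis by blast
  next
    case 3
    then have "gadget_extension g c {{hd g, c}, {b, c}} (g @ [c])"
      using assms(2,3) g consecutive_snoc[of "a # l" c]
      by (auto simp: gadget_extension_def gadget_edges_def spokes_def rim_def)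
    then show ?thesis by blast
  qed
qed

lemma rim_ends_pair:
  assumes "3 \<le> length g" "distinct g"
  obtains b1 b2 where "b1 \<noteq> b2" "rim_ends g = {b1, b2}" "{b1, b2} \<subseteq> set (tl g)"
proof -
  obtain x d a l where g: "g = x # d # a # l" using assms(1)
    by (auto simp: numeral_eq_Suc Suc_le_length_iff)
  show thesis
  proof (cases "l = []")
    case True
    then show ?thesis using that[of d a] g assms(2) by (simp add: rim_ends_def)
  next
    case False
    then have "last l \<in> set l" by simp
    then have "a \<noteq> last l" using g assms(2) by auto
    then show ?thesis using False that[of a "last l"] g by (simp add: rim_ends_def)
  qed
qed

lemma apollonian_fan:
  assumes "apollonian K" "{x, q, y} \<in> K" "card {x, q, y} = 3" "distinct ls" "set ls \<inter> \<Union>K = {}"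
  shows "\<exists>K'. apollonian K' \<and> \<Union>K' = \<Union>K \<union> set ls \<and> K - {{x, q, y}} \<subseteq> K' \<and> fan_faces x (y # ls) \<subseteq> K'"
  using assms
proof (induction ls arbitrary: K y)
  case Nil
  then show ?case by (intro exI[of _ K]) (auto simp: fan_faces_def)
next
  case (Cons l ls)
  let ?t = "{x, q, y}"
  define K1 where "K1 = star l ?t K"
  have l: "l \<notin> \<Union>K" "l \<noteq> x" "l \<noteq> q" "l \<noteq> y" using Cons.prems(2,5) by auto
  have ne: "x \<noteq> q" "x \<noteq> y" "q \<noteq> y" using Cons.prems(3)
    by (auto simp: card_insert_if split: if_splits)
  have new: "insert l (?t - {v}) \<in> K1" if "v \<in> ?t" for v using that by (auto simp: K1_def star_def)
  have "insert l (?t - {y}) = {x, q, l}" "insert l (?t - {q}) = {x, y, l}" using ne by auto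
  then have faces: "{x, q, l} \<in> K1" "{x, y, l} \<in> K1" using new[of y] new[of q] by auto
  have U: "\<Union>K1 = insert l (\<Union>K)" unfolding K1_def by (rule Union_star[OF Cons.prems(2,3)])
  have "apollonian K1" unfolding K1_def by (rule apollonian.insert[OF Cons.prems(1-3) l(1)])
  moreover have "card {x, q, l} = 3" "distinct ls" "set ls \<inter> \<Union>K1 = {}" using ne l Cons.prems(4,5) U
    by auto
  ultimately obtain K' where K': "apollonian K'" "\<Union>K' = \<Union>K1 \<union> set ls" "K1 - {{x, q, l}} \<subseteq> K'"
    "fan_faces x (l # ls) \<subseteq> K'" using Cons.IH[of K1 l] faces(1) by blast
  have "K - {?t} \<subseteq> K1 - {{x, q, l}}" using l(1) by (auto simp: K1_def star_def)
  moreover have "{x, y, l} \<in> K'" using K'(3) faces(2) ne l by (auto simp: doubleton_eq_iff)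
  ultimately show ?case using K' U by (intro exI[of _ K']) (auto simp: fan_faces_def)
qed

lemma apollonian_new_fan:
  assumes K: "apollonian K" "{p, q, y} \<in> K" "card {p, q, y} = 3"
    and ls: "distinct (x # ls)" "set (x # ls) \<inter> \<Union>K = {}"
  shows "\<exists>K'. apollonian K' \<and> \<Union>K' = \<Union>K \<union> set (x # ls) \<and> K - {{p, q, y}} \<subseteq> K' \<and>
    {p, q, x} \<in> K' \<and> fan_faces x (y # ls) \<subseteq> K'"
proof -
  let ?t = "{p, q, y}"
  define K1 where "K1 = star x ?t K"
  have x: "x \<notin> \<Union>K" using ls(2) by auto
  then have "x \<noteq> p" "x \<noteq> q" "x \<noteq> y" using K(2) by auto
  then have ne: "x \<noteq> p" "x \<noteq> q" "x \<noteq> y" "p \<noteq> q" "p \<noteq> y" "q \<noteq> y"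
    using K(3) by (auto simp: card_insert_if split: if_splits)
  have new: "insert x (?t - {v}) \<in> K1" if "v \<in> ?t" for v using that by (auto simp: K1_def star_def)
  have "insert x (?t - {y}) = {p, q, x}" "insert x (?t - {p}) = {x, q, y}" using ne by auto
  then have faces: "{p, q, x} \<in> K1" "{x, q, y} \<in> K1" using new[of y] new[of p] by auto
  have U: "\<Union>K1 = insert x (\<Union>K)" unfolding K1_def by (rule Union_star[OF K(2,3)])
  have "apollonian K1" unfolding K1_def by (rule apollonian.insert[OF K x])
  moreover have "card {x, q, y} = 3" "distinct ls" "set ls \<inter> \<Union>K1 = {}" using ne ls U by auto
  ultimately obtain K' where K': "apollonian K'" "\<Union>K' = \<Union>K1 \<union> set ls" "K1 - {{x, q, y}} \<subseteq> K'"
    "fan_faces x (y # ls) \<subseteq> K'" using apollonian_fan[of K1 x q y ls] faces(2) by blast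
  have "{x, q, y} \<notin> K" using x by blast
  then have "K - {?t} \<subseteq> K1 - {{x, q, y}}" unfolding K1_def star_def by blast
  then have old: "K - {?t} \<subseteq> K'" using K'(3) by (rule order_trans)
  have "p \<notin> {x, q, y}" using ne by simp
  then have "{p, q, x} \<noteq> {x, q, y}" by (metis insertI1)
  then have face: "{p, q, x} \<in> K'" using faces(1) subsetD[OF K'(3)] by simp
  have "\<Union>K' = \<Union>K \<union> set (x # ls)" using K'(2) U by simp
  then show ?thesis by (intro exI[of _ K'] conjI K'(1,4) old face)
qed

lemma apollonian_fans:
  assumes "[] \<notin> set gs" "distinct (concat gs)" "distinct [p, q, r]"
    "set (concat gs) \<inter> {p, q, r} = {}"
  shows "\<exists>K y. apollonian K \<and> \<Union>K = {p, q, r} \<union> set (concat gs) \<and> {p, q, y} \<in> K \<and>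
    card {p, q, y} = 3 \<and>
    (\<forall>g\<in>set gs. \<exists>z. z \<noteq> p \<and> fan_faces (hd g) (z # tl g) \<subseteq> K)"
  using assms
proof (induction gs)
  case Nil
  then have "apollonian (Pow {p, q, r})" by (intro apollonian.triangle) auto
  then show ?case using Nil by (intro exI[of _ "Pow {p, q, r}"] exI[of _ r]) auto
next
  case (Cons g gs)
  obtain x ls where g: "g = x # ls" using Cons.prems(1) by (cases g) auto
  obtain K y where IH: "apollonian K" "\<Union>K = {p, q, r} \<union> set (concat gs)" "{p, q, y} \<in> K"
    "card {p, q, y} = 3" "\<forall>g\<in>set gs. \<exists>z. z \<noteq> p \<and> fan_faces (hd g) (z # tl g) \<subseteq> K"
    using Cons.IH Cons.prems by auto
  have "distinct (x # ls)" "set (x # ls) \<inter> \<Union>K = {}" using Cons.prems(2,4) unfolding IH(2) g by auto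
  from apollonian_new_fan[OF IH(1,3,4) this]
  obtain K' where K': "apollonian K'" "\<Union>K' = \<Union>K \<union> set (x # ls)" "K - {{p, q, y}} \<subseteq> K'"
    "{p, q, x} \<in> K'" "fan_faces x (y # ls) \<subseteq> K'" by (elim exE conjE) (rule that)
  have "\<exists>z. z \<noteq> p \<and> fan_faces (hd g') (z # tl g') \<subseteq> K'" if g': "g' \<in> set gs" for g'
  proof -
    obtain z where z: "z \<noteq> p" "fan_faces (hd g') (z # tl g') \<subseteq> K" using IH(5) g' by blast
    have "g' \<noteq> []" using g' Cons.prems(1) by auto
    then have "set g' = insert (hd g') (set (tl g'))" by (cases g') auto
    then have "p \<notin> insert (hd g') (set (tl g'))" using g' Cons.prems(4) by auto
    then have "p \<notin> {hd g', a, b}" if "(a, b) \<in> consecutive (z # tl g')" for a b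
      using consecutive_subset[OF that] z(1) by auto
    then have "p \<notin> \<sigma>" if "\<sigma> \<in> fan_faces (hd g') (z # tl g')" for \<sigma>
      using that unfolding fan_faces_def by auto
    then have "{p, q, y} \<notin> fan_faces (hd g') (z # tl g')" by blast
    then show ?thesis using z K'(3) by blast
  qed
  moreover have "p \<noteq> y" "p \<noteq> q" using IH(4) by (auto simp: card_insert_if split: if_splits)
  then have "z \<noteq> p \<and> fan_faces (hd g) (z # tl g) \<subseteq> K'" if "z = y" for z using that K'(5) g by simp
  moreover have "x \<noteq> p" "x \<noteq> q" using Cons.prems(4) g by auto
  then have "card {p, q, x} = 3" using \<open>p \<noteq> q\<close> by auto
  ultimately show ?case
    using K'(1,2,4) IH(2) g by (intro exI[of _ K'] exI[of _ x]) auto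
qed

lemma gadget_edges_subset:
  assumes "apollonian K" "fan_faces (hd g) (z # tl g) \<subseteq> K"
  shows "gadget_edges g \<subseteq> K"
proof -
  have face: "{hd g, a, b} \<in> K" if "(a, b) \<in> consecutive (z # tl g)" for a b
    using that assms(2) by (auto simp: fan_faces_def)
  have sub: "e \<in> K" if "e \<subseteq> \<sigma>" "\<sigma> \<in> K" for e \<sigma> using that apollonian_simplices[OF assms(1)] by blast
  have "{hd g, l} \<in> K" if l: "l \<in> set (tl g)" for l
  proof -
    obtain a where "(a, l) \<in> consecutive (z # tl g)" using predecessor_exists[OF l] by blast
    then show ?thesis using sub[of "{hd g, l}" "{hd g, a, l}"] face by simp
  qed
  moreover have "{a, b} \<in> K" if "(a, b) \<in> consecutive (tl (tl g))" for a b
  proof -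
    have "(a, b) \<in> consecutive (z # tl g)"
      using that consecutive_mono[of "tl g"] consecutive_mono[of "z # tl g"] by auto
    then show ?thesis using sub[of "{a, b}" "{hd g, a, b}"] face by simp
  qed
  ultimately show ?thesis by (auto simp: gadget_edges_def spokes_def rim_def)
qed

lemma apollonian_gadgets:
  fixes n :: nat
  assumes "[] \<notin> set gs" "distinct (concat gs)" "set (concat gs) \<subseteq> {0..<n}"
  obtains K where "apollonian K" "\<Union>K \<inter> {0..<n} = set (concat gs)"
    "\<And>g. g \<in> set gs \<Longrightarrow> gadget_edges g \<subseteq> K"
    "\<And>g. g \<in> set gs \<Longrightarrow> \<exists>z. fan_faces (hd g) (z # tl g) \<subseteq> K"
proof -
  have "distinct [n, n + 1, n + 2]" "set (concat gs) \<inter> {n, n + 1, n + 2} = {}" using assms(3)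
    by auto
  then obtain K y where K: "apollonian K" "\<Union>K = {n, n + 1, n + 2} \<union> set (concat gs)"
    "\<forall>g\<in>set gs. \<exists>z. z \<noteq> n \<and> fan_faces (hd g) (z # tl g) \<subseteq> K"
    using apollonian_fans[OF assms(1,2), of n "n + 1" "n + 2"] by blast
  show ?thesis
  proof (rule that[OF K(1)])
    show "\<Union>K \<inter> {0..<n} = set (concat gs)" using K(2) assms(3) by auto
    fix g assume g: "g \<in> set gs"
    then obtain z where z: "fan_faces (hd g) (z # tl g) \<subseteq> K" using K(3) by blast
    then show "\<exists>z. fan_faces (hd g) (z # tl g) \<subseteq> K" by blast
    show "gadget_edges g \<subseteq> K" by (rule gadget_edges_subset[OF K(1) z])
  qed
qed

lemma gadgets_planar:
  assumes "[] \<notin> set gs" "distinct (concat gs)" "set (concat gs) \<subseteq> {0..<n}"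
    and C: "C \<subseteq> \<Union> (gadget_edges ` set gs)" "C \<subseteq> Kn_edges n"
  shows "planar_graph {0..<n} C"
proof -
  obtain K where K: "apollonian K" "\<And>g. g \<in> set gs \<Longrightarrow> gadget_edges g \<subseteq> K"
    using apollonian_gadgets[OF assms(1-3)] by metis
  then have "C \<subseteq> K" using C(1) by blast
  then show ?thesis using apollonian_planar_graph[OF K(1)] C(2) by (simp add: Kn_edges_eq_nsets)
qed

lemma fresh_vertex_exists:
  assumes "after_rounds n m C B" "finite Z" "card Z + 2 * m < n"
  obtains c where "c < n" "c \<notin> Z" "c \<notin> \<Union>B"
proof -
  have B: "finite B" "card B = m" "\<And>e. e \<in> B \<Longrightarrow> finite e \<and> card e = 2"
    using assms(1) after_rounds_finite[OF assms(1)]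
      by (auto simp: after_rounds_def Kn_edges_eq_nsets nsets_def)
  then have fin: "finite (Z \<union> \<Union>B)" using assms(2) by blast
  have "card (\<Union>B) \<le> (\<Sum>e\<in>B. card e)" by (rule card_Union_le_sum_card)
  then have "card (\<Union>B) \<le> 2 * m" using B by simp
  then have "card (Z \<union> \<Union>B) < card {0..<n}" using card_Un_le[of Z "\<Union>B"] assms(3) by simp
  then have "\<not> {0..<n} \<subseteq> Z \<union> \<Union>B" using card_mono[OF fin] leD by blast
  then obtain c where "c \<in> {0..<n}" "c \<notin> Z \<union> \<Union>B" by blast
  then show thesis using that[of c] by simp
qed

definition gadgets_state :: "nat \<Rightarrow> nat list list \<Rightarrow> nat \<Rightarrow> nat set set \<Rightarrow> nat set set \<Rightarrow> bool" where
  "gadgets_state n gs m C B \<longleftrightarrow> [] \<notin> set gs \<and> distinct (concat gs) \<and> set (concat gs) \<subseteq> {0..<n} \<and>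
     C = \<Union> (gadget_edges ` set gs) \<and> after_rounds n m C B"

lemma gadgets_state_edge_vertices:
  assumes "gadgets_state n gs m C B" "e \<in> C"
  shows "e \<subseteq> set (concat gs)"
proof -
  obtain g where g: "g \<in> set gs" "e \<in> gadget_edges g" using assms by (auto simp: gadgets_state_def)
  have "g \<noteq> []" using g(1) assms(1) by (auto simp: gadgets_state_def)
  then have "e \<subseteq> set g" using gadget_edges_vertices g(2) by blast
  then show ?thesis using g(1) by auto
qed

lemma gadgets_state_extension:
  assumes "gadgets_state n (g # gs) m C B" "gadget_extension g c E g'" "c < n"
    "c \<notin> set (concat (g # gs))"
  shows "C' \<subseteq> E \<union> C \<Longrightarrow> C' \<subseteq> Kn_edges n \<Longrightarrow> planar_graph {0..<n} C'"
    and "after_rounds n m' (E \<union> C) B' \<Longrightarrow> gadgets_state n (g' # gs) m' (E \<union> C) B'"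
proof -
  have g': "[] \<notin> set (g' # gs)" "distinct (concat (g' # gs))" "set (concat (g' # gs)) \<subseteq> {0..<n}"
    "E \<union> C = \<Union> (gadget_edges ` set (g' # gs))"
    using assms by (auto simp: gadgets_state_def gadget_extension_def)
  show "planar_graph {0..<n} C'" if "C' \<subseteq> E \<union> C" "C' \<subseteq> Kn_edges n"
    using gadgets_planar[OF g'(1-3) _ that(2)] that(1) unfolding g'(4) .
  show "gadgets_state n (g' # gs) m' (E \<union> C) B'" if "after_rounds n m' (E \<union> C) B'"
    using g' that unfolding gadgets_state_def by blast
qed

lemma le_choose_two: "2 * k + 1 \<le> n \<Longrightarrow> k * n \<le> n choose 2"
proof -
  assume "2 * k + 1 \<le> n"
  then have "n * (2 * k) \<le> n * (n - 1)" by (intro mult_le_mono2) simp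
  then show ?thesis unfolding choose_two using div_le_mono[of "n * (2 * k)" _ 2]
    by (simp add: mult.commute)
qed

lemma force_gadgets_claim:
  assumes s: "gadgets_state n (g # gs) m C B" "c < n" "c \<notin> set (concat (g # gs))"
    and ext: "gadget_extension g c E g'"
    and r: "after_rounds n m' C' B'" "2 * m' + 2 < n"
    and e: "{b, c} \<in> E" "{b, c} \<notin> C'" "{b, c} \<notin> B'" "C' \<subseteq> E \<union> C" "b \<in> set g"
    and Q: "\<And>f. after_rounds n (Suc m') (insert {b, c} C') (insert f B') \<Longrightarrow>
      force n Q (insert {b, c} C') (insert f B')"
  shows "force n Q C' B'"
proof (rule force_claim[OF r(1) _ _ e(2,3) _ Q])
  show "2 * m' + 1 < n choose 2" using le_choose_two[of 1 n] r(2) by simp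
  have "b < n" "b \<noteq> c" using s e(5) by (auto simp: gadgets_state_def)
  then show K: "{b, c} \<in> Kn_edges n" using s(2) unfolding Kn_edges_def by blast
  show "planar_graph {0..<n} (insert {b, c} C')"
    by (rule gadgets_state_extension(1)[OF s(1) ext s(2,3)])
      (use e K r(1) in \<open>auto simp: after_rounds_def\<close>)
qed

definition gadget_begun ::
    "nat \<Rightarrow> nat list list \<Rightarrow> nat \<Rightarrow> nat \<Rightarrow> nat set set \<Rightarrow> nat set set \<Rightarrow> bool" where
  "gadget_begun n gs l m C B \<longleftrightarrow> (\<exists>g. length g = l \<and> gadgets_state n (g # gs) m C B)"

lemma force_spoke:
  assumes s: "gadget_begun n gs l m C B" "l = 1 \<or> l = 2"
    and n: "l + length (concat gs) + 2 * m + 1 < n"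
  shows "force n (gadget_begun n gs (Suc l) (Suc m)) C B"
proof -
  obtain g where g: "length g = l" and st: "gadgets_state n (g # gs) m C B"
    using s(1) by (auto simp: gadget_begun_def)
  let ?Z = "set (concat (g # gs))"
  have r: "after_rounds n m C B" using st unfolding gadgets_state_def by blast
  have "card ?Z + 2 * m < n" using card_length[of "concat (g # gs)"] n g by simp
  then obtain c where c: "c < n" "c \<notin> ?Z" "c \<notin> \<Union>B" by (rule fresh_vertex_exists[OF r finite_set])
  have ext: "gadget_extension g c {{hd g, c}} (g @ [c])"
    by (rule gadget_extension_spoke) (use st c(2) s(2) g in \<open>auto simp: gadgets_state_def\<close>)
  have "2 * m + 2 < n" using n s(2) by auto
  then show ?thesis
  proof (rule force_gadgets_claim[OF st c(1,2) ext r])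
    show "{hd g, c} \<notin> C" "{hd g, c} \<notin> B" using gadgets_state_edge_vertices[OF st] c(2,3) by blast+
    show "hd g \<in> set g" using s(2) g by (cases g) auto
    fix f assume "after_rounds n (Suc m) (insert {hd g, c} C) (insert f B)"
    then have "gadgets_state n ((g @ [c]) # gs) (Suc m) (insert {hd g, c} C) (insert f B)"
      using gadgets_state_extension(2)[OF st ext c(1,2)] by simp
    then show "force n (gadget_begun n gs (Suc l) (Suc m)) (insert {hd g, c} C) (insert f B)"
      unfolding gadget_begun_def using g by (intro force.base exI[of _ "g @ [c]"]) simp
  qed auto
qed

lemma force_rim_edge:
  assumes st: "gadgets_state n (g # gs) m C B" "3 \<le> length g"
    and c: "c < n" "c \<notin> set (concat (g # gs))" and b: "b \<in> rim_ends g" "{b, c} \<notin> B'"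
    and r: "after_rounds n (Suc m) (insert {hd g, c} C) B'" "2 * Suc m + 2 < n"
  shows "force n (gadget_begun n gs (Suc (length g)) (m + 2)) (insert {hd g, c} C) B'"
proof -
  have g: "distinct g" "g \<noteq> []" using st(1) by (auto simp: gadgets_state_def)
  obtain g' where g': "gadget_extension g c {{hd g, c}, {b, c}} g'"
    using gadget_extension_rim[OF st(2) g(1) _ b(1)] c(2) by auto
  have bg: "b \<in> set (tl g)" by (rule rim_ends_pair[OF st(2) g(1)]) (use b(1) in auto)
  show ?thesis
  proof (rule force_gadgets_claim[OF st(1) c g' r])
    have "b \<noteq> hd g" "hd g \<noteq> c" using bg g c(2) by (cases g; auto)+
    moreover have "{b, c} \<notin> C"
      using gadgets_state_edge_vertices[OF st(1), of "{b, c}"] c(2) by blast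
    ultimately show "{b, c} \<notin> insert {hd g, c} C" by (auto simp: doubleton_eq_iff)
    show "{b, c} \<notin> B'" by (rule b)
    show "b \<in> set g" by (rule list.set_sel(2)[OF g(2) bg])
    fix f assume "after_rounds n (Suc (Suc m)) (insert {b, c} (insert {hd g, c} C)) (insert f B')"
    then have "gadgets_state n (g' # gs) (m + 2) (insert {b, c} (insert {hd g, c} C)) (insert f B')"
      using gadgets_state_extension(2)[OF st(1) g' c] by (simp add: insert_commute)
    then show "force n (gadget_begun n gs (Suc (length g)) (m + 2))
        (insert {b, c} (insert {hd g, c} C)) (insert f B')"
      using g' by (intro force.base) (auto simp: gadget_begun_def gadget_extension_def)
  qed auto
qed

lemma force_rim_extension:
  assumes l: "gadget_begun n gs l m C B" "3 \<le> l"
    and n: "l + length (concat gs) + 2 * m + 1 < n"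
  shows "force n (gadget_begun n gs (Suc l) (m + 2)) C B"
proof -
  obtain g where g: "length g = l" and st: "gadgets_state n (g # gs) m C B"
    using l(1) by (auto simp: gadget_begun_def)
  let ?Z = "set (concat (g # gs))"
  have r: "after_rounds n m C B" using st unfolding gadgets_state_def by blast
  have l3: "3 \<le> length g" and dist: "distinct g" using l(2) g st by (auto simp: gadgets_state_def)
  have "card ?Z + 2 * m < n" using card_length[of "concat (g # gs)"] n g by simp
  then obtain c where c: "c < n" "c \<notin> ?Z" "c \<notin> \<Union>B" by (rule fresh_vertex_exists[OF r finite_set])
  obtain b1 b2 where b: "b1 \<noteq> b2" "rim_ends g = {b1, b2}" by (rule rim_ends_pair[OF l3 dist])
  then obtain g1 where g1: "gadget_extension g c {{hd g, c}, {b1, c}} g1"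
    using gadget_extension_rim[OF l3 dist, of c b1] c(2) by auto
  have "2 * m + 2 < n" using n l(2) by simp
  then show ?thesis
  proof (rule force_gadgets_claim[OF st c(1,2) g1 r])
    show "{hd g, c} \<notin> C" "{hd g, c} \<notin> B" using gadgets_state_edge_vertices[OF st] c(2,3) by blast+
    show "hd g \<in> set g" using l3 by (cases g) auto
    fix f assume f: "after_rounds n (Suc m) (insert {hd g, c} C) (insert f B)"
    have "{b1, c} \<noteq> {b2, c}" using b(1) by (auto simp: doubleton_eq_iff)
    then obtain b where b: "b \<in> rim_ends g" "{b, c} \<noteq> f" using b(2) by auto
    then have "{b, c} \<notin> insert f B" using c(3) by blast
    then show "force n (gadget_begun n gs (Suc l) (m + 2)) (insert {hd g, c} C) (insert f B)"
      using force_rim_edge[OF st l3 c(1,2) b(1) _ f] n l(2) g by simp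
  qed auto
qed

lemma force_gadget:
  assumes "gadgets_state n gs m C B" "length (concat gs) + 2 * m + 5 * k + 7 < n"
  shows "force n (gadget_begun n gs (k + 3) (m + 2 * k + 2)) C B"
  using assms(2)
proof (induction k)
  case 0
  have r: "after_rounds n m C B" using assms(1) unfolding gadgets_state_def by blast
  have "card (set (concat gs)) + 2 * m < n" using card_length[of "concat gs"] 0 by linarith
  then obtain x where x: "x < n" "x \<notin> set (concat gs)"
    by (rule fresh_vertex_exists[OF r finite_set])
  then have "gadgets_state n ([x] # gs) m C B"
    using assms(1) by (auto simp: gadgets_state_def gadget_edges_def spokes_def rim_def)
  then have "gadget_begun n gs 1 m C B"
    unfolding gadget_begun_def by (intro exI[of _ "[x]"]) simp
  then have "force n (gadget_begun n gs (Suc 1) (Suc m)) C B"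
    by (rule force_spoke) (use 0 in simp_all)
  then have "force n (gadget_begun n gs (Suc (Suc 1)) (Suc (Suc m))) C B"
    by (rule force_trans, intro force_spoke) (use 0 in simp_all)
  then show ?case by (simp add: numeral_3_eq_3)
next
  case (Suc k)
  then have "force n (gadget_begun n gs (k + 3) (m + 2 * k + 2)) C B" by simp
  then show ?case
  proof (rule force_trans)
    fix C B assume "gadget_begun n gs (k + 3) (m + 2 * k + 2) C B"
    then show "force n (gadget_begun n gs (Suc k + 3) (m + 2 * Suc k + 2)) C B"
      using force_rim_extension[of n gs "k + 3" "m + 2 * k + 2"] Suc.prems by simp
  qed
qed

lemma length_concat_uniform: "\<forall>g\<in>set gs. length g = k \<Longrightarrow> length (concat gs) = k * length gs"
  by (induction gs) auto

definition gadgets_built :: "nat \<Rightarrow> nat \<Rightarrow> nat set set \<Rightarrow> nat set set \<Rightarrow> bool" where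
  "gadgets_built n M C B \<longleftrightarrow>
     (\<exists>gs. length gs = M \<and> (\<forall>g\<in>set gs. length g = 8) \<and> gadgets_state n gs (12 * M) C B)"

lemma force_gadgets: "40 * M \<le> n \<Longrightarrow> force n (gadgets_built n M) {} {}"
proof (induction M)
  case 0
  have "gadgets_state n [] 0 {} {}" by (simp add: gadgets_state_def after_rounds_def)
  then show ?case by (intro force.base) (simp add: gadgets_built_def)
next
  case (Suc M)
  then have "force n (gadgets_built n M) {} {}" by simp
  then show ?case
  proof (rule force_trans)
    fix C B assume "gadgets_built n M C B"
    then obtain gs where gs: "length gs = M" "\<forall>g\<in>set gs. length g = 8"
      "gadgets_state n gs (12 * M) C B"
      by (auto simp: gadgets_built_def)
    have "length (concat gs) = 8 * M" using length_concat_uniform[OF gs(2)] gs(1) by simp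
    then have "length (concat gs) + 2 * (12 * M) + 5 * 5 + 7 < n" using Suc.prems by simp
    from force_gadget[OF gs(3) this] show "force n (gadgets_built n (Suc M)) C B"
    proof (rule force_trans)
      fix C B assume "gadget_begun n gs (5 + 3) (12 * M + 2 * 5 + 2) C B"
      then obtain g where "length g = 8" "gadgets_state n (g # gs) (12 * Suc M) C B"
        by (auto simp: gadget_begun_def)
      then have "gadgets_built n (Suc M) C B"
        unfolding gadgets_built_def using gs(1,2) by (intro exI[of _ "g # gs"]) simp
      then show "force n (gadgets_built n (Suc M)) C B" by (rule force.base)
    qed
  qed
qed

section \<open>Inserting vertices\<close>

lemma triangles_cone:
  assumes C': "C \<union> (\<lambda>x. {w, x}) ` t \<subseteq> Kn_edges n" and t: "finite t" "w \<notin> t" "[t]\<^bsup>2\<^esup> \<subseteq> C"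
    and w: "w \<notin> \<Union>C"
  shows "triangles C + (card t choose 2) \<le> triangles (C \<union> (\<lambda>x. {w, x}) ` t)"
proof -
  let ?C' = "C \<union> (\<lambda>x. {w, x}) ` t"
  let ?new = "insert w ` [t]\<^bsup>2\<^esup>"
  have fin: "finite (triangle_sets ?C')" by (rule finite_triangle_sets[OF graph_Kn_edges[OF C']])
  have old: "triangle_sets C \<subseteq> triangle_sets ?C'" by (rule triangle_sets_mono) blast
  have "inj_on (insert w) ([t]\<^bsup>2\<^esup>)"
  proof (rule inj_onI)
    fix e f assume "e \<in> [t]\<^bsup>2\<^esup>" "f \<in> [t]\<^bsup>2\<^esup>" and eq: "insert w e = insert w f"
    then have "w \<notin> e" "w \<notin> f" using t(2) by (auto simp: nsets_def)
    then show "e = f" using eq by (simp add: insert_ident)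
  qed
  then have "card ?new = card t choose 2" by (simp add: card_image)
  moreover have "triangle_sets C \<inter> ?new = {}" using triangle_sets_subset_vertices w by blast
  ultimately have "triangles C + (card t choose 2) = card (triangle_sets C \<union> ?new)"
    using finite_subset[OF old fin] t(1)
      by (simp add: triangles_eq_card card_Un_disjoint finite_imp_finite_nsets)
  also have "\<dots> \<le> triangles ?C'"
    unfolding triangles_eq_card
  proof (rule card_mono[OF fin Un_least[OF old]], rule image_subsetI)
    fix e assume e: "e \<in> [t]\<^bsup>2\<^esup>"
    then obtain x y where xy: "e = {x, y}" "x \<in> t" "y \<in> t" "x \<noteq> y" by (rule nsets2_E)
    have "f \<in> ?C'" if "f \<in> [insert w e]\<^bsup>2\<^esup>" for f
    proof -
      obtain p q where "f = {p, q}" "p \<in> insert w e" "q \<in> insert w e" "p \<noteq> q" using \<open>f \<in> _\<close>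
        by (rule nsets2_E)
      moreover have "{x, y} \<in> ?C'" "{w, x} \<in> ?C'" "{w, y} \<in> ?C'" using xy e t(3) by auto
      ultimately show ?thesis unfolding xy(1)
        by (elim insertE emptyE) (simp_all add: insert_commute)
    qed
    moreover have "card (insert w e) = 3" using xy t(2) by (metis card_3_iff)
    ultimately show "insert w e \<in> triangle_sets ?C'" by (auto simp: triangle_sets_def)
  qed
  finally show ?thesis .
qed

lemma cone_subset_star:
  assumes "card t \<noteq> 1" "C \<subseteq> K" "t \<notin> C"
  shows "C \<union> (\<lambda>x. {w, x}) ` t \<subseteq> star w t K"
proof -
  have "{w, x} \<in> star w t K" if "x \<in> t" for x
  proof -
    have "{x} \<in> Pow t - {t}" using that assms(1) by auto
    then show ?thesis unfolding star_def by blast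
  qed
  moreover have "C \<subseteq> star w t K" using assms(2,3) unfolding star_def by blast
  ultimately show ?thesis by blast
qed

lemma cone_planar:
  assumes "apollonian K" "t \<in> K" "card t = 3" "w \<notin> \<Union>K" "C \<subseteq> K" "C' \<subseteq> C \<union> (\<lambda>x. {w, x}) ` t"
    "C \<union> C' \<subseteq> Kn_edges n"
  shows "planar_graph {0..<n} C'"
proof (rule apollonian_planar_graph[OF apollonian.insert[OF assms(1-4)]])
  have "t \<notin> C" using assms(3,7) by (auto simp: Kn_edges_eq_nsets nsets_def)
  with assms(3,5) have "C \<union> (\<lambda>x. {w, x}) ` t \<subseteq> star w t K" by (intro cone_subset_star) auto
  then show "C' \<subseteq> star w t K" using assms(6) by (rule order_trans[rotated])
  show "C' \<subseteq> [{0..<n}]\<^bsup>2\<^esup>" using assms(7) by (simp add: Kn_edges_eq_nsets)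
qed

definition open_face :: "nat set set \<Rightarrow> nat set set \<Rightarrow> nat set \<Rightarrow> bool" where
  "open_face C K t \<longleftrightarrow> card t = 3 \<and> t \<in> K \<and> [t]\<^bsup>2\<^esup> \<subseteq> C"

lemma open_face_cone:
  assumes "open_face C K t" "x \<in> t" "w \<notin> t"
  shows "open_face (C \<union> (\<lambda>x. {w, x}) ` t) (star w t K) (insert w (t - {x}))"
proof -
  have t: "card t = 3" "[t]\<^bsup>2\<^esup> \<subseteq> C" "finite t" using assms(1) card_ge_0_finite[of t]
    by (auto simp: open_face_def)
  have "card (insert w (t - {x})) = 3" using t assms(2,3) by simp
  moreover have "insert w (t - {x}) \<in> star w t K" using assms(2) by (auto simp: star_def)
  moreover have "e \<in> C \<union> (\<lambda>x. {w, x}) ` t" if e: "e \<in> [insert w (t - {x})]\<^bsup>2\<^esup>" for e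
  proof (cases "w \<in> e")
    case True
    obtain p q where "e = {p, q}" "p \<in> insert w (t - {x})" "q \<in> insert w (t - {x})" "p \<noteq> q"
      using e by (rule nsets2_E)
    then have "e \<in> (\<lambda>x. {w, x}) ` t" using True by (auto simp: insert_commute)
    then show ?thesis by blast
  next
    case False
    then have "e \<in> [t]\<^bsup>2\<^esup>" using e by (auto simp: nsets_def)
    then show ?thesis using t(2) by blast
  qed
  ultimately show ?thesis by (auto simp: open_face_def)
qed

lemma open_face_star:
  assumes "open_face C K s" "C \<subseteq> C'" "s \<noteq> t"
  shows "open_face C' (star w t K) s"
  using assms by (auto simp: open_face_def star_def)

lemma unblocked_pair_exists:
  assumes fin: "finite S" "finite B" and B: "card B < card S * M"
    and inj: "inj_on (\<lambda>(j, m). v j m) ({..<M} \<times> {..<k})" and v: "\<And>j m. j < M \<Longrightarrow> m < k \<Longrightarrow> v j m \<notin> S"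
  shows "\<exists>w\<in>S. \<exists>j<M. \<forall>m<k. {w, v j m} \<notin> B"
proof (rule ccontr)
  assume "\<not> ?thesis"
  then obtain f where f: "\<And>w j. w \<in> S \<Longrightarrow> j < M \<Longrightarrow> f w j < k \<and> {w, v j (f w j)} \<in> B" by metis
  have "inj_on (\<lambda>(w, j). {w, v j (f w j)}) (S \<times> {..<M})"
  proof (rule inj_onI, clarify)
    fix w j w' j' assume h: "w \<in> S" "w' \<in> S" "j < M" "j' < M"
      "{w, v j (f w j)} = {w', v j' (f w' j')}"
    have "v j (f w j) \<notin> S" "v j' (f w' j') \<notin> S" using h f v by auto
    then have "w = w'" "v j (f w j) = v j' (f w' j')" using h by (auto simp: doubleton_eq_iff)
    then show "w = w' \<and> j = j'" using inj_onD[OF inj, of "(j, f w j)" "(j', f w' j')"] f h by auto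
  qed
  then have "card (S \<times> {..<M}) \<le> card B" by (rule card_inj_on_le) (use f fin in auto)
  then show False using B by (simp add: card_cartesian_product)
qed

text \<open>Slots of a gadget: the hub \<open>0\<close>, and the two rim paths \<open>2\<close>--\<open>3\<close>--\<open>4\<close> and \<open>5\<close>--\<open>6\<close>--\<open>7\<close>. Each
  middle slot shares a face with either end of its path: Blocker's first reply spoils at most one
  path, and his second reply at most one end of the other.\<close>

definition face_slots :: "(nat \<times> nat) set" where
  "face_slots = {(3, 2), (3, 4), (6, 5), (6, 7)}"

definition face :: "(nat \<Rightarrow> nat) \<Rightarrow> nat \<times> nat \<Rightarrow> nat set" where
  "face u s = {u 0, u (fst s), u (snd s)}"

lemma face_slots_bounds:
  "s \<in> face_slots \<Longrightarrow> fst s < 8 \<and> snd s < 8 \<and> 0 < fst s \<and> 0 < snd s \<and> fst s \<noteq> snd s"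
  by (auto simp: face_slots_def)

lemma face_slots_distinct:
  "s \<in> face_slots \<Longrightarrow> s' \<in> face_slots \<Longrightarrow> s \<noteq> s' \<Longrightarrow> snd s \<notin> {0, fst s', snd s'}"
  by (auto simp: face_slots_def)

locale insertion_site =
  fixes n :: nat and K C :: "nat set set" and w :: nat and u :: "nat \<Rightarrow> nat"
  assumes complex: "apollonian K" "w \<notin> \<Union>K" "C \<subseteq> K" "C \<subseteq> Kn_edges n"
    and bounds: "w < n" "m < 8 \<Longrightarrow> u m < n"
    and inj: "inj_on u {..<8}"
    and faces: "s \<in> face_slots \<Longrightarrow> open_face C K (face u s)"
begin

definition inserted :: "nat \<Rightarrow> nat set set \<Rightarrow> nat set set \<Rightarrow> bool" where
  "inserted m C' B' \<longleftrightarrow> after_rounds n m C' B' \<and> (\<exists>s\<in>face_slots. C' = C \<union> (\<lambda>x. {w, x}) ` face u s)"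

lemma spoke_notin: "{w, x} \<notin> C"
  using complex(2,3) by blast

lemma inj_spokes: "inj_on (\<lambda>m. {w, u m}) {..<8}"
  using inj by (auto simp: inj_on_def doubleton_eq_iff)

lemma spokes_eq_iff: "m < 8 \<Longrightarrow> m' < 8 \<Longrightarrow> {w, u m} = {w, u m'} \<longleftrightarrow> m = m'"
  using inj_on_eq_iff[OF inj_spokes, of m m'] by simp

lemma force_claim_spoke:
  assumes s: "s \<in> face_slots" "x \<in> {0, fst s, snd s}"
    and r: "after_rounds n m C' B'" "2 * m + 1 < n choose 2"
    and x: "{w, u x} \<notin> C'" "{w, u x} \<notin> B'" "C' \<subseteq> C \<union> (\<lambda>x. {w, x}) ` face u s"
    and Q: "\<And>f. after_rounds n (Suc m) (insert {w, u x} C') (insert f B') \<Longrightarrow>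
      force n Q (insert {w, u x} C') (insert f B')"
  shows "force n Q C' B'"
proof (rule force_claim[OF r _ x(1,2) _ Q])
  have t: "face u s \<in> K" "card (face u s) = 3" using faces[OF s(1)] by (auto simp: open_face_def)
  have ux: "u x \<in> face u s" "u x < n"
    using s(2) bounds(2) face_slots_bounds[OF s(1)] by (auto simp: face_def)
  then have "w \<noteq> u x" using complex(2) t(1) by blast
  then show e: "{w, u x} \<in> Kn_edges n" using ux(2) bounds(1) unfolding Kn_edges_def by blast
  have C': "insert {w, u x} C' \<subseteq> C \<union> (\<lambda>x. {w, x}) ` face u s" using ux(1) x(3) by blast
  show "planar_graph {0..<n} (insert {w, u x} C')"
    by (rule cone_planar[OF complex(1) t complex(2,3) C'])
      (use complex(4) r(1) e in \<open>auto simp: after_rounds_def\<close>)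
qed

lemma force_end_spoke:
  assumes s: "(b, a) \<in> face_slots"
    and r: "after_rounds n m ({{w, u 0}, {w, u b}} \<union> C) B'" "2 * m + 1 < n choose 2"
    and free: "{w, u a} \<notin> B'"
  shows "force n (inserted (Suc m)) ({{w, u 0}, {w, u b}} \<union> C) B'"
proof (rule force_claim_spoke[OF s _ r _ free])
  show "{w, u a} \<notin> {{w, u 0}, {w, u b}} \<union> C"
    using spoke_notin spokes_eq_iff[of a] face_slots_bounds[OF s] by simp
  show "{{w, u 0}, {w, u b}} \<union> C \<subseteq> C \<union> (\<lambda>x. {w, x}) ` face u (b, a)" by (auto simp: face_def)
  have "insert {w, u a} ({{w, u 0}, {w, u b}} \<union> C) = C \<union> (\<lambda>x. {w, x}) ` face u (b, a)"
    by (auto simp: face_def)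
  then show "force n (inserted (Suc m)) (insert {w, u a} ({{w, u 0}, {w, u b}} \<union> C)) (insert f B')"
    if "after_rounds n (Suc m) (insert {w, u a} ({{w, u 0}, {w, u b}} \<union> C)) (insert f B')" for f
    using that s by (intro force.base) (auto simp: inserted_def)
qed simp

lemma force_middle_spoke:
  assumes s: "(b, a1) \<in> face_slots" "(b, a2) \<in> face_slots" "a1 \<noteq> a2"
    and r: "after_rounds n m (insert {w, u 0} C) B'" "2 * m + 3 < n choose 2"
    and free: "{w, u b} \<notin> B'" "{w, u a1} \<notin> B'" "{w, u a2} \<notin> B'"
  shows "force n (inserted (Suc (Suc m))) (insert {w, u 0} C) B'"
proof (rule force_claim_spoke[OF s(1) _ r(1) _ _ free(1)])
  show "{w, u b} \<notin> insert {w, u 0} C"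
    using spoke_notin spokes_eq_iff[of b] face_slots_bounds[OF s(1)] by simp
  show "insert {w, u 0} C \<subseteq> C \<union> (\<lambda>x. {w, x}) ` face u (b, a1)" by (auto simp: face_def)
  fix f assume "after_rounds n (Suc m) (insert {w, u b} (insert {w, u 0} C)) (insert f B')"
  moreover have "insert {w, u b} (insert {w, u 0} C) = {{w, u 0}, {w, u b}} \<union> C" by auto
  moreover have "{w, u a1} \<noteq> {w, u a2}"
    using spokes_eq_iff face_slots_bounds[OF s(1)] face_slots_bounds[OF s(2)] s(3) by simp
  then obtain a where "(b, a) \<in> face_slots" "{w, u a} \<notin> insert f B'" using s(1,2) free(2,3) by blast
  ultimately show "force n (inserted (Suc (Suc m))) (insert {w, u b} (insert {w, u 0} C))
      (insert f B')"
    using force_end_spoke[of b a "Suc m"] r(2) by simp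
qed (use r(2) in simp_all)

lemma unspoiled_face_slots:
  obtains b a1 a2 where "(b, a1) \<in> face_slots" "(b, a2) \<in> face_slots" "a1 \<noteq> a2"
    "f \<notin> {{w, u b}, {w, u a1}, {w, u a2}}"
proof (cases "f \<in> {{w, u 3}, {w, u 2}, {w, u 4}}")
  case True
  then obtain m where m: "f = {w, u m}" "m < 5" by auto
  have "f \<noteq> {w, u m'}" if "5 \<le> m'" "m' < 8" for m' using spokes_eq_iff[of m m'] m that by simp
  then show ?thesis using that[of 6 5 7] by (simp add: face_slots_def)
next
  case False
  then show ?thesis using that[of 3 2 4] by (simp add: face_slots_def)
qed

lemma force_insertion:
  assumes r: "after_rounds n m C B" "2 * m + 5 < n choose 2" and free: "\<And>m. m < 8 \<Longrightarrow> {w, u m} \<notin> B"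
  shows "force n (inserted (Suc (Suc (Suc m)))) C B"
proof (rule force_claim_spoke[of "(3, 2)" 0, OF _ _ r(1) _ spoke_notin])
  fix f assume f: "after_rounds n (Suc m) (insert {w, u 0} C) (insert f B)"
  obtain b a1 a2 where s: "(b, a1) \<in> face_slots" "(b, a2) \<in> face_slots" "a1 \<noteq> a2"
    "f \<notin> {{w, u b}, {w, u a1}, {w, u a2}}" by (rule unspoiled_face_slots)
  then show "force n (inserted (Suc (Suc (Suc m)))) (insert {w, u 0} C) (insert f B)"
    using r(2) free face_slots_bounds[OF s(1)] face_slots_bounds[OF s(2)]
    by (intro force_middle_spoke[OF s(1-3) f]) auto
qed (use r(2) free in \<open>auto simp: face_slots_def\<close>)

end

text \<open>The complex \<open>K\<close> may have vertices that are not below \<open>n\<close> and edges that were never claimed.\<close>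

definition insertion_state ::
    "nat \<Rightarrow> nat \<Rightarrow> nat \<Rightarrow> nat set set \<Rightarrow> nat set set \<Rightarrow> nat set set \<Rightarrow> (nat \<Rightarrow> nat \<Rightarrow> nat) \<Rightarrow> bool" where
  "insertion_state n M i C B K v \<longleftrightarrow> apollonian K \<and> C \<subseteq> K \<and> after_rounds n (12 * M + 3 * i) C B \<and>
     3 * i \<le> triangles C \<and> card (\<Union>K \<inter> {0..<n}) \<le> 8 * M + i \<and>
     inj_on (\<lambda>(j, m). v j m) ({..<M} \<times> {..<8}) \<and> (\<forall>j<M. \<forall>m<8. v j m \<in> \<Union>K \<inter> {0..<n}) \<and>
     (\<forall>j<M. \<forall>s\<in>face_slots. open_face C K (face (v j) s))"

lemma insertion_state_unblocked:
  assumes I: "insertion_state n M i C B K v" and B: "12 * M + 3 * i < (n - 8 * M - i) * M"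
  obtains w j where "w < n" "w \<notin> \<Union>K" "j < M" "\<And>m. m < 8 \<Longrightarrow> {w, v j m} \<notin> B"
proof -
  let ?S = "{0..<n} - \<Union>K"
  have r: "after_rounds n (12 * M + 3 * i) C B" and K: "card (\<Union>K \<inter> {0..<n}) \<le> 8 * M + i"
    and inj: "inj_on (\<lambda>(j, m). v j m) ({..<M} \<times> {..<8})" and v: "\<And>j m. j < M \<Longrightarrow> m < 8 \<Longrightarrow> v j m \<notin> ?S"
    using I unfolding insertion_state_def by blast+
  have "n - 8 * M - i \<le> card ?S" using K by (simp add: card_Diff_subset_Int Int_commute)
  then have "(n - 8 * M - i) * M \<le> card ?S * M" by (rule mult_le_mono1)
  moreover have "card B = 12 * M + 3 * i" "finite B" using r after_rounds_finite[OF r]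
    by (auto simp: after_rounds_def)
  moreover from calculation B have "card B < card ?S * M" by linarith
  ultimately have "\<exists>w\<in>?S. \<exists>j<M. \<forall>m<8. {w, v j m} \<notin> B"
    by (intro unblocked_pair_exists[OF _ _ _ inj v]) auto
  then obtain w j where "w \<in> ?S" "j < M" "\<forall>m<8. {w, v j m} \<notin> B" by blast
  then show thesis using that[of w j] by simp
qed

lemma face_eq_imp_same_slot:
  assumes "inj_on (\<lambda>(j, m). v j m) ({..<M} \<times> {..<8})" "j < M" "j' < M" "s \<in> face_slots"
    "s' \<in> face_slots"
    and "v j' (snd s') \<in> face (v j) s"
  shows "j = j' \<and> s = s'"
proof -
  obtain m where m: "m \<in> {0, fst s, snd s}" "v j' (snd s') = v j m" using assms(6)
    by (auto simp: face_def)
  have "m < 8" "snd s' < 8" using m(1) face_slots_bounds[OF assms(4)] face_slots_bounds[OF assms(5)]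
    by auto
  then have "j' = j" "snd s' = m"
    using inj_onD[OF assms(1), of "(j', snd s')" "(j, m)"] m(2) assms(2,3) by auto
  then show ?thesis using m(1) face_slots_distinct[OF assms(5,4)] by auto
qed

lemma inj_on_slots_update:
  assumes "inj_on (\<lambda>(j, m). v j m) S" "\<And>j m. (j, m) \<in> S \<Longrightarrow> v j m \<noteq> w"
  shows "inj_on (\<lambda>(j, m). (v(i := (v i)(k := w))) j m) S"
proof (rule inj_onI, clarify)
  fix j1 m1 j2 m2
  assume h: "(j1, m1) \<in> S" "(j2, m2) \<in> S"
    "(v(i := (v i)(k := w))) j1 m1 = (v(i := (v i)(k := w))) j2 m2"
  then show "j1 = j2 \<and> m1 = m2"
    using inj_onD[OF assms(1) _ h(1,2)] assms(2)[OF h(1)] assms(2)[OF h(2)]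
      by (auto split: if_splits)
qed

lemma inj_on_slots_row:
  assumes "inj_on (\<lambda>(j, m). v j m) (A \<times> B)" "j \<in> A"
  shows "inj_on (v j) B"
  using inj_onD[OF assms(1), of "(j, _)" "(j, _)"] assms(2) by (auto intro!: inj_onI)

lemma open_faces_insert:
  assumes inj: "inj_on (\<lambda>(j, m). v j m) ({..<M} \<times> {..<8})"
    and faces: "\<And>j s. j < M \<Longrightarrow> s \<in> face_slots \<Longrightarrow> open_face C K (face (v j) s)"
    and j: "j < M" "s \<in> face_slots" "w \<notin> face (v j) s" and h: "j' < M" "s' \<in> face_slots"
  shows "open_face (C \<union> (\<lambda>x. {w, x}) ` face (v j) s) (star w (face (v j) s) K)
    (face ((v(j := (v j)(snd s := w))) j') s')"
proof (cases "j' = j \<and> s' = s")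
  case True
  have b: "fst s < 8" "snd s < 8" "snd s \<noteq> 0" "snd s \<noteq> fst s" using face_slots_bounds[OF j(2)]
    by auto
  have "inj_on (v j) {..<8}" using inj_on_slots_row[OF inj] j(1) by simp
  then have "v j (snd s) \<noteq> v j 0" "v j (snd s) \<noteq> v j (fst s)" using b by (auto dest: inj_onD)
  then have "face ((v(j := (v j)(snd s := w))) j') s' = insert w (face (v j) s - {v j (snd s)})"
    using True b by (auto simp: face_def)
  then show ?thesis
    using open_face_cone[OF faces[OF j(1,2)] _ j(3), of "v j (snd s)"] by (simp add: face_def)
next
  case False
  then have "face ((v(j := (v j)(snd s := w))) j') s' = face (v j') s'"
    using face_slots_distinct[OF j(2) h(2)] by (auto simp: face_def)
  moreover have "v j' (snd s') \<notin> face (v j) s"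
    using face_eq_imp_same_slot[OF inj j(1) h(1) j(2) h(2)] False by auto
  then have "face (v j') s' \<noteq> face (v j) s" by (auto simp: face_def)
  ultimately show ?thesis using open_face_star[OF faces[OF h]] by simp
qed

lemma insertion_state_insert:
  assumes I: "insertion_state n M i C B K v" and j: "j < M" "s \<in> face_slots"
    and w: "w < n" "w \<notin> \<Union>K" and C': "C' = C \<union> (\<lambda>x. {w, x}) ` face (v j) s"
    and r: "after_rounds n (12 * M + 3 * Suc i) C' B'"
  shows "insertion_state n M (Suc i) C' B' (star w (face (v j) s) K) (v(j := (v j)(snd s := w)))"
proof -
  let ?t = "face (v j) s"
  let ?K = "star w ?t K" and ?v = "v(j := (v j)(snd s := w))"
  have K: "apollonian K" "C \<subseteq> K" "card (\<Union>K \<inter> {0..<n}) \<le> 8 * M + i" and tri: "3 * i \<le> triangles C"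
    and inj: "inj_on (\<lambda>(j, m). v j m) ({..<M} \<times> {..<8})"
    and v: "\<And>j m. j < M \<Longrightarrow> m < 8 \<Longrightarrow> v j m \<in> \<Union>K \<inter> {0..<n}"
    and faces: "\<And>j s. j < M \<Longrightarrow> s \<in> face_slots \<Longrightarrow> open_face C K (face (v j) s)"
    and CK: "C \<subseteq> Kn_edges n"
    using I unfolding insertion_state_def after_rounds_def by blast+
  have t: "card ?t = 3" "?t \<in> K" "finite ?t" "[?t]\<^bsup>2\<^esup> \<subseteq> C" "w \<notin> ?t"
    using faces[OF j] w(2) by (auto simp: open_face_def face_def)
  have U: "\<Union>?K = insert w (\<Union>K)" by (rule Union_star[OF t(2,1)])
  have "?t \<notin> C" using t(1) CK by (auto simp: Kn_edges_eq_nsets nsets_def)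
  then have C'K: "C' \<subseteq> ?K" unfolding C' by (intro cone_subset_star) (use t K(2) in auto)
  have ap: "apollonian ?K" by (rule apollonian.insert[OF K(1) t(2,1) w(2)])
  have "triangles C + (card ?t choose 2) \<le> triangles C'"
    unfolding C' by (rule triangles_cone) (use r w K(2) t in \<open>auto simp: C' after_rounds_def\<close>)
  then have tri': "3 * Suc i \<le> triangles C'" using tri t(1) by (simp add: choose_two)
  have card: "card (\<Union>?K \<inter> {0..<n}) \<le> 8 * M + Suc i"
    using K(3) w by (simp add: U Int_insert_left)
  have inj': "inj_on (\<lambda>(j, m). ?v j m) ({..<M} \<times> {..<8})"
    by (rule inj_on_slots_update[OF inj]) (use v w(2) in blast)
  have v': "?v j' m \<in> \<Union>?K \<inter> {0..<n}" if "j' < M" "m < 8" for j' m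
    using v[OF that] w(1) by (auto simp: U)
  have faces': "open_face C' ?K (face (?v j') s')" if "j' < M" "s' \<in> face_slots" for j' s'
    unfolding C' by (rule open_faces_insert[OF inj faces j t(5) that])
  show ?thesis
    unfolding insertion_state_def by (intro conjI allI impI ballI ap C'K r tri' card inj' v' faces')
qed

definition insertions_done :: "nat \<Rightarrow> nat \<Rightarrow> nat \<Rightarrow> nat set set \<Rightarrow> nat set set \<Rightarrow> bool" where
  "insertions_done n M i C B \<longleftrightarrow> (\<exists>K v. insertion_state n M i C B K v)"

lemma force_next_insertion:
  assumes I: "insertion_state n M i C B K v"
    and B: "12 * M + 3 * i < (n - 8 * M - i) * M" and c: "2 * (12 * M + 3 * i) + 5 < n choose 2"
  shows "force n (insertions_done n M (Suc i)) C B"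
proof -
  have K: "apollonian K" "C \<subseteq> K" and r: "after_rounds n (12 * M + 3 * i) C B"
    and inj: "inj_on (\<lambda>(j, m). v j m) ({..<M} \<times> {..<8})"
    and v: "\<And>j m. j < M \<Longrightarrow> m < 8 \<Longrightarrow> v j m < n"
    and faces: "\<And>j s. j < M \<Longrightarrow> s \<in> face_slots \<Longrightarrow> open_face C K (face (v j) s)"
    using I unfolding insertion_state_def by auto
  obtain w j where wj: "w < n" "w \<notin> \<Union>K" "j < M" "\<And>m. m < 8 \<Longrightarrow> {w, v j m} \<notin> B"
    by (rule insertion_state_unblocked[OF I B]) (rule that)
  have "inj_on (v j) {..<8}" using inj_on_slots_row[OF inj] wj(3) by simp
  moreover have "C \<subseteq> Kn_edges n" using r by (simp add: after_rounds_def)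
  ultimately interpret insertion_site n K C w "v j"
    by unfold_locales (use K wj(1,2) v[OF wj(3)] faces[OF wj(3)] in simp_all)
  have r': "Suc (Suc (Suc (12 * M + 3 * i))) = 12 * M + 3 * Suc i" by simp
  show ?thesis
  proof (rule force_trans[OF force_insertion[OF r c wj(4), unfolded r']])
    fix C' B' assume "inserted (12 * M + 3 * Suc i) C' B'"
    then obtain s where s: "s \<in> face_slots" "C' = C \<union> (\<lambda>x. {w, x}) ` face (v j) s"
      "after_rounds n (12 * M + 3 * Suc i) C' B'" unfolding inserted_def by blast
    then show "force n (insertions_done n M (Suc i)) C' B'"
      using insertion_state_insert[OF I wj(3) s(1) wj(1,2) s(2,3)]
      by (intro force.base) (auto simp: insertions_done_def)
  qed
qed

lemma inj_on_nth_nth_concat: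
  assumes "distinct (concat xss)" "[] \<notin> set xss"
  shows "inj_on (\<lambda>(i, a). xss ! i ! a) (SIGMA i:{..<length xss}. {..<length (xss ! i)})"
proof (rule inj_onI, clarify)
  fix i a j b assume h: "i < length xss" "j < length xss" "a < length (xss ! i)"
    "b < length (xss ! j)" "xss ! i ! a = xss ! j ! b"
  have d: "distinct xss" "\<And>ys. ys \<in> set xss \<Longrightarrow> distinct ys"
    "\<And>ys zs. ys \<in> set xss \<Longrightarrow> zs \<in> set xss \<Longrightarrow> ys \<noteq> zs \<Longrightarrow> set ys \<inter> set zs = {}"
    using assms by (auto simp: distinct_concat_iff)
  have "xss ! i ! a \<in> set (xss ! i) \<inter> set (xss ! j)" using h by (metis IntI nth_mem)
  then have "xss ! i = xss ! j" using d(3)[of "xss ! i" "xss ! j"] h(1,2) by auto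
  then show "i = j \<and> a = b" using h d(1) d(2)[of "xss ! i"] by (simp add: nth_eq_iff_index_eq)
qed

lemma gadget_open_faces:
  assumes g: "length g = 8" "distinct g" "gadget_edges g \<subseteq> C" "fan_faces (hd g) (z # tl g) \<subseteq> K"
    and s: "s \<in> face_slots"
  shows "open_face C K (face ((!) g) s)"
proof -
  obtain x d a b c e f h where gs: "g = [x, d, a, b, c, e, f, h]"
    using g(1) by (auto simp: numeral_eq_Suc length_Suc_conv)
  have new: "open_face C K {x, p, q}" if "{x, p, q} \<in> K" "{x, p} \<in> C" "{x, q} \<in> C" "{p, q} \<in> C"
    "distinct [x, p, q]" for p q
  proof -
    have "[{x, p, q}]\<^bsup>2\<^esup> \<subseteq> C"
    proof
      fix e assume "e \<in> [{x, p, q}]\<^bsup>2\<^esup>"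
      then obtain u v where "e = {u, v}" "u \<in> {x, p, q}" "v \<in> {x, p, q}" "u \<noteq> v" by (rule nsets2_E)
      then show "e \<in> C" using that(2-4) by (elim insertE emptyE) (simp_all add: insert_commute)
    qed
    then show ?thesis using that(1,5) by (simp add: open_face_def)
  qed
  have "{x, a, b} \<in> K" "{x, b, c} \<in> K" "{x, e, f} \<in> K" "{x, f, h} \<in> K"
    using g(4) gs by (simp_all add: fan_faces_def)
  moreover have "{x, a} \<in> C" "{x, b} \<in> C" "{x, c} \<in> C" "{x, e} \<in> C" "{x, f} \<in> C" "{x, h} \<in> C"
    "{a, b} \<in> C" "{b, c} \<in> C" "{e, f} \<in> C" "{f, h} \<in> C"
    using g(3) gs by (simp_all add: gadget_edges_def spokes_def rim_def)
  ultimately have "open_face C K {x, a, b}" "open_face C K {x, b, c}" "open_face C K {x, e, f}"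
    "open_face C K {x, f, h}"
    using g(2) gs by (simp_all add: new)
  then have "open_face C K (face ((!) g) (3, 2))" "open_face C K (face ((!) g) (3, 4))"
    "open_face C K (face ((!) g) (6, 5))" "open_face C K (face ((!) g) (6, 7))"
    by (simp_all add: gs face_def insert_commute)
  then show ?thesis using s unfolding face_slots_def by (elim insertE emptyE) simp_all
qed

lemma gadgets_built_imp_insertions_done:
  assumes "gadgets_built n M C B"
  shows "insertions_done n M 0 C B"
proof -
  obtain gs where gs: "length gs = M" "\<forall>g\<in>set gs. length g = 8"
    and st: "gadgets_state n gs (12 * M) C B"
    using assms by (auto simp: gadgets_built_def)
  have G: "[] \<notin> set gs" "distinct (concat gs)" "set (concat gs) \<subseteq> {0..<n}"
    "C = \<Union> (gadget_edges ` set gs)"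
    and r: "after_rounds n (12 * M) C B" using st unfolding gadgets_state_def by blast+
  obtain K where K: "apollonian K" "\<Union>K \<inter> {0..<n} = set (concat gs)"
    "\<And>g. g \<in> set gs \<Longrightarrow> gadget_edges g \<subseteq> K"
    "\<And>g. g \<in> set gs \<Longrightarrow> \<exists>z. fan_faces (hd g) (z # tl g) \<subseteq> K"
    using apollonian_gadgets[OF G(1-3)] by blast
  have len: "length (gs ! j) = 8" if "j < M" for j using that gs by simp
  have "inj_on (\<lambda>(j, m). gs ! j ! m) ({..<M} \<times> {..<8})"
    by (rule inj_on_subset[OF inj_on_nth_nth_concat[OF G(2,1)]]) (use len gs(1) in auto)
  moreover have "gs ! j ! m \<in> \<Union>K \<inter> {0..<n}" if "j < M" "m < 8" for j m
    unfolding K(2) using that len[OF that(1)] gs(1) by (auto intro!: bexI[of _ "gs ! j"])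
  moreover have "open_face C K (face ((!) (gs ! j)) s)" if "j < M" "s \<in> face_slots" for j s
  proof -
    have g: "gs ! j \<in> set gs" using that(1) gs(1) by simp
    then obtain z where "fan_faces (hd (gs ! j)) (z # tl (gs ! j)) \<subseteq> K" using K(4) by blast
    moreover have "gadget_edges (gs ! j) \<subseteq> C" using g G(4) by blast
    moreover have "distinct (gs ! j)" using g G(2) by (simp add: distinct_concat_iff)
    ultimately show ?thesis using gadget_open_faces len[OF that(1)] that(2) by blast
  qed
  moreover have "C \<subseteq> K" using K(3) G(4) by blast
  moreover have "card (\<Union>K \<inter> {0..<n}) \<le> 8 * M"
    unfolding K(2) using card_length[of "concat gs"] length_concat_uniform[OF gs(2)] gs(1) by simp
  ultimately have "insertion_state n M 0 C B K (\<lambda>j m. gs ! j ! m)"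
    using K(1) r unfolding insertion_state_def by simp
  then show ?thesis unfolding insertions_done_def by blast
qed

lemma force_insertions:
  assumes n: "100 \<le> n" "100 * M \<le> n" "1 \<le> M"
  shows "k \<le> n - 8 * M - (3 * n div M + 13) \<Longrightarrow> force n (insertions_done n M k) {} {}"
proof (induction k)
  case 0
  have "force n (gadgets_built n M) {} {}" using n(2) by (intro force_gadgets) simp
  then show ?case by (rule force_trans) (intro force.base gadgets_built_imp_insertions_done)
next
  case (Suc k)
  then have "force n (insertions_done n M k) {} {}" by simp
  then show ?case
  proof (rule force_trans)
    fix C B assume "insertions_done n M k C B"
    then obtain K v where I: "insertion_state n M k C B K v" by (auto simp: insertions_done_def)
    have kn: "k < n" using Suc.prems by simp
    have "3 * n = M * (3 * n div M) + 3 * n mod M" "3 * n mod M < M" using n(3) by simp_all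
    moreover have "M * (3 * n div M + 13) \<le> M * (n - 8 * M - k)"
      using Suc.prems by (intro mult_le_mono2) linarith
    then have "M * (3 * n div M) + 13 * M \<le> (n - 8 * M - k) * M" by (simp add: algebra_simps)
    ultimately have free: "12 * M + 3 * k < (n - 8 * M - k) * M" using kn by linarith
    have "2 * (12 * M + 3 * k) + 5 < 49 * n" using n kn by simp
    also have "\<dots> \<le> n choose 2" by (rule le_choose_two) (use n in simp)
    finally show "force n (insertions_done n M (Suc k)) C B"
      by (rule force_next_insertion[OF I free])
  qed
qed

theorem g_PCB_K3_ge:
  assumes "100 \<le> n" "100 * M \<le> n" "1 \<le> M"
  shows "3 * (n - 8 * M - (3 * n div M + 13)) \<le> g_PCB_K3 n"
  by (rule force_imp_le_g_PCB_K3[OF force_insertions[OF assms order_refl]])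
    (auto simp: insertions_done_def insertion_state_def)

lemma g_PCB_K3_ratio_ge:
  assumes "100 \<le> n" "100 * M \<le> n" "1 \<le> M"
  shows "1 - 3 / real M - (8 * real M + 13) / real n \<le> real (g_PCB_K3 n) / (3 * real n)"
proof -
  let ?q = "3 * n div M"
  have "1 - 3 / real M - (8 * real M + 13) / real n =
      (real n - 8 * real M - (3 * n / M + 13)) / real n"
    using assms by (simp add: field_simps)
  also have "\<dots> \<le> (real n - 8 * real M - (?q + 13)) / real n"
    using of_nat_div_le_of_nat[of "3 * n" M, where ?'a = real]
      by (intro divide_right_mono diff_left_mono) simp_all
  also have "\<dots> \<le> real (n - 8 * M - (?q + 13)) / real n" by (intro divide_right_mono) linarith+
  also have "\<dots> = real (3 * (n - 8 * M - (?q + 13))) / (3 * real n)" by simp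
  also have "\<dots> \<le> real (g_PCB_K3 n) / (3 * real n)"
    by (intro divide_right_mono of_nat_mono g_PCB_K3_ge[OF assms]) simp
  finally show ?thesis .
qed

text \<open>With \<open>sqrt n\<close> gadgets, both the vertices spent on gadgets and those left over are \<open>o(n)\<close>.\<close>

lemma eventually_g_PCB_K3_ratio_ge:
  "\<forall>\<^sub>F n in at_top. 1 - 3 / of_int \<lfloor>sqrt n\<rfloor> - (8 * sqrt n + 13) / n \<le>
      real (g_PCB_K3 n) / (3 * real n)"
  using eventually_ge_at_top[of "10000 :: nat"]
proof eventually_elim
  case (elim n)
  define M where "M = nat \<lfloor>sqrt n\<rfloor>"
  have s: "100 \<le> sqrt n" using elim real_le_rsqrt[of 100 "real n"] by simp
  then have M: "real M = of_int \<lfloor>sqrt n\<rfloor>" "real M \<le> sqrt n" by (simp_all add: M_def)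
  have "100 * real M \<le> sqrt n * sqrt n" using s M(2) by (intro mult_mono) auto
  then have "100 * M \<le> n" by simp
  moreover have "1 \<le> M" unfolding M_def by (rule le_nat_floor) (use elim in simp)
  ultimately have "1 - 3 / real M - (8 * real M + 13) / real n \<le> real (g_PCB_K3 n) / (3 * real n)"
    using elim by (intro g_PCB_K3_ratio_ge) auto
  moreover have "(8 * real M + 13) / real n \<le> (8 * sqrt n + 13) / n" using M(2)
    by (intro divide_right_mono) auto
  ultimately show ?case using M(1) by simp
qed

theorem theorem1p6:
  shows "(\<lambda>n. real (g_PCB_K3 n)) \<sim>[at_top] (\<lambda>n. 3 * real n)"
proof (rule asymp_equivI')
  have "real (g_PCB_K3 n) / (3 * real n) \<le> 1" for n
    using g_PCB_K3_le[of n] by (simp add: divide_le_eq)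
  then have upper: "\<forall>\<^sub>F n in at_top. real (g_PCB_K3 n) / (3 * real n) \<le> 1" by simp
  have "((\<lambda>n. 1 - 3 / of_int \<lfloor>sqrt (real n)\<rfloor> - (8 * sqrt (real n) + 13) / real n) \<longlongrightarrow> 1) at_top"
    by real_asymp
  then show "((\<lambda>n. real (g_PCB_K3 n) / (3 * real n)) \<longlongrightarrow> 1) at_top"
    by (rule tendsto_sandwich[OF eventually_g_PCB_K3_ratio_ge upper _ tendsto_const])
qed

end
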